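(* Let $A_0,A_1\in\mathbb{R}^{2\times 2}$ be Hurwitz matrices and let $\lambda\in(0,1)$ be such that $A_\lambda=(1-\lambda)A_0+\lambda A_1$ has two real eigenvalues of opposite signs, $-\lambda_-<0<\lambda_+$. For $\beta>0$ let $(X_t,I_t)_{t\ge 0}$ be the randomly switched process on $\mathbb{R}^2\times\{0,1\}$ with parameters $(A_0,A_1,\lambda,\beta)$ described in the context. Then for every $\beta>0$ there exists $\chi(\beta)\in\mathbb{R}$ such that, for every initial probability measure $\nu$ on $\mathbb{R}^2\times\{0,1\}$ with $\nu(\{0\}\times\{0,1\})=0$, $$\frac1t\log\|X_t\|\xrightarrow[t\to\infty]{}\chi(\beta)\qquad \mathbb{P}_\nu\text{-almost surely.}$$ Moreover, there exist two constants $0<\beta_1\le\beta_2<\infty$ such that: (i) if $\beta<\beta_1$, then $\chi(\beta)<0$ and $\|X_t\|\to 0$ as $t\to\infty$, $\mathbb{P}_\nu$-almost surely for every such $\nu$; (ii) if $\beta>\beta_2$, then $\chi(\beta)>0$ and $\|X_t\|\to\infty$ as $t\to\infty$, $\mathbb{P}_\nu$-almost surely for every such $\nu$.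
   Context: A real $2\times2$ matrix is Hurwitz if both of its eigenvalues have negative real part. Set $\lambda_0=\lambda$ and $\lambda_1=1-\lambda$. For $\beta>0$, $(I_t)_{t\ge0}$ is the continuous-time Markov process on $\{0,1\}$ that jumps from $i$ to $1-i$ at rate $\beta\lambda_i$, and $(X_t)_{t\ge0}$ is the solution of $X_t=X_0+\int_0^t A_{I_s}X_s\,ds$. Equivalently $(X,I)$ is the Markov process with generator $\mathcal{L}_\beta f(x,i)=A_ix\cdot\nabla_x f(x,i)+\beta\lambda_i\,(f(x,1-i)-f(x,i))$. $\mathbb{P}_\nu$ denotes the law of $(X,I)$ when $(X_0,I_0)$ has law $\nu$. *)

theory Defs
  imports "HOL-Probability.Probability"
begin

text \<open>Eigenvalues of a real matrix are taken over the complex numbers.\<close>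

definition is_eigenvalue :: "real ^ 'n ^ 'n \<Rightarrow> complex \<Rightarrow> bool" where
  "is_eigenvalue A \<mu> \<longleftrightarrow>
     (\<exists>v :: complex ^ 'n. v \<noteq> 0 \<and> (\<chi> i j. complex_of_real (A $ i $ j)) *v v = \<mu> *s v)"

definition hurwitz :: "real ^ 'n ^ 'n \<Rightarrow> bool" where
  "hurwitz A \<longleftrightarrow> (\<forall>\<mu>. is_eigenvalue A \<mu> \<longrightarrow> Re \<mu> < 0)"

text \<open>
  The state space of the switching process is the two-element numeral type \<open>2\<close>, whose elements
  are \<open>0\<close> and \<open>1\<close> (arithmetic is modulo 2), so that \<open>i \<mapsto> 1 - i\<close> exchanges the two states.
\<close>

definition switch_weight :: "real \<Rightarrow> 2 \<Rightarrow> real" where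
  "switch_weight lam i = (if i = 0 then lam else 1 - lam)"

text \<open>
  \<open>I\<close> is given by its jump chain and holding times: started at \<open>i\<^sub>0\<close>, it visits
  \<open>i\<^sub>0, 1 - i\<^sub>0, i\<^sub>0, \<dots>\<close>, and it stays in the \<open>k\<close>-th visited state for a time that is exponential with
  parameter the jump rate \<open>\<beta> \<lambda>\<^sub>i\<close> of that state, independently of everything else. The sequence \<open>e\<close>
  consists of independent unit exponential variables, and division by the rate yields the
  holding times.
\<close>

definition jump_chain :: "2 \<Rightarrow> nat \<Rightarrow> 2" where
  "jump_chain i0 k = ((\<lambda>i. 1 - i) ^^ k) i0"

definition jump_time :: "real \<Rightarrow> real \<Rightarrow> 2 \<Rightarrow> (nat \<Rightarrow> real) \<Rightarrow> nat \<Rightarrow> real" where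
  "jump_time lam \<beta> i0 e n = (\<Sum>k<n. e k / (\<beta> * switch_weight lam (jump_chain i0 k)))"

text \<open>
  The index selected by \<open>LEAST\<close> is the one with \<open>T\<^sub>n \<le> t < T\<^bsub>n+1\<^esub>\<close>. It exists for all
  \<open>t \<ge> 0\<close> outside the null event on which the jump times stay bounded.
\<close>

definition switch_path :: "real \<Rightarrow> real \<Rightarrow> 2 \<Rightarrow> (nat \<Rightarrow> real) \<Rightarrow> real \<Rightarrow> 2" where
  "switch_path lam \<beta> i0 e t = jump_chain i0 (LEAST n. t < jump_time lam \<beta> i0 e (Suc n))"

definition solves_switched ::
    "(2 \<Rightarrow> real ^ 2 ^ 2) \<Rightarrow> (real \<Rightarrow> 2) \<Rightarrow> real ^ 2 \<Rightarrow> (real \<Rightarrow> real ^ 2) \<Rightarrow> bool" where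
  "solves_switched A \<iota> x0 X \<longleftrightarrow>
     X 0 = x0 \<and> (\<forall>t\<ge>0. ((\<lambda>s. A (\<iota> s) *v X s) has_integral (X t - x0)) {0..t})"

text \<open>
  The sample space carries \<open>((X\<^sub>0, I\<^sub>0), e)\<close> with \<open>(X\<^sub>0, I\<^sub>0)\<close> of law \<open>\<nu>\<close> and independent of \<open>e\<close>. Almost
  sure statements are made on this space and not for the image measure on paths: events
  concerning the limit \<open>t \<rightarrow> \<infinity>\<close> depend on uncountably many times and are not determined
  by the product sigma-algebra on path space.
\<close>

type_synonym sample = "((real ^ 2) \<times> 2) \<times> (nat \<Rightarrow> real)"

definition switched_space :: "((real ^ 2) \<times> 2) measure \<Rightarrow> sample measure" where
  "switched_space \<nu> =
     \<nu> \<Otimes>\<^sub>M (\<Pi>\<^sub>M k\<in>(UNIV :: nat set). density lborel (\<lambda>x. ennreal (exponential_density 1 x)))"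

definition switched_I :: "real \<Rightarrow> real \<Rightarrow> real \<Rightarrow> sample \<Rightarrow> 2" where
  "switched_I lam \<beta> t = (\<lambda>((x0, i0), e). switch_path lam \<beta> i0 e t)"

text \<open>The solution is unique on \<open>t \<ge> 0\<close>; its values at negative times are irrelevant.\<close>

definition switched_X ::
    "(2 \<Rightarrow> real ^ 2 ^ 2) \<Rightarrow> real \<Rightarrow> real \<Rightarrow> real \<Rightarrow> sample \<Rightarrow> real ^ 2" where
  "switched_X A lam \<beta> t \<omega> =
     (SOME X. solves_switched A (\<lambda>s. switched_I lam \<beta> s \<omega>) (fst (fst \<omega>)) X) t"

definition initial_law :: "((real ^ 2) \<times> 2) measure \<Rightarrow> bool" where
  "initial_law \<nu> \<longleftrightarrow>
     prob_space \<nu> \<and> sets \<nu> = sets (borel \<Otimes>\<^sub>M count_space UNIV) \<and> emeasure \<nu> ({0} \<times> UNIV) = 0"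

end

theory Submission
  imports Defs "HOL-Library.Discrete_Functions" "HOL-Real_Asymp.Real_Asymp"
begin

text \<open>
  Between jumps the process follows one of two linear flows, so along the jump times it is a product
  of independent random matrices. The growth rate exists and does not depend on the initial vector
  because of a cancellation argument: for a product \<open>R\<close> with dominant row \<open>w\<close>, the norm of \<open>R x\<close> can
  be much smaller than that of \<open>R\<close> only if \<open>w\<close> and \<open>x\<close> are nearly orthogonal, and the randomness of
  the first two holding times alone makes this unlikely, uniformly in \<open>w\<close> and \<open>x\<close>, since the two
  matrices have no common eigenvector (otherwise \<open>A\<^sub>\<lambda>\<close> would be Hurwitz). Hence the expected
  logarithmic growth over \<open>m\<close> jumps is independent of the initial state up to \<open>o(m)\<close>. Averaging it
  over \<open>m\<close> gives an approximate solution of the Poisson equation, and a strong law for martingales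
  yields the almost sure limit.

  For slow switching, the exponential decay of both flows beats the bounded loss at each jump. For
  fast switching with \<open>h = 1 / (\<beta> \<lambda> (1 - \<lambda>))\<close>, the rows of the product started from the left
  eigenvector of \<open>\<lambda>\<^sub>+\<close> concentrate around \<open>(1 + h \<lambda>\<^sub>+)\<^sup>n\<close> times this eigenvector as long as \<open>n h\<^sup>2\<close> is
  small. The first cycle makes the pairing with the initial vector at least of order \<open>h\<close> with high
  probability, which costs only \<open>\<bar>ln h\<bar>\<close>. This is negligible against the gain \<open>n h \<lambda>\<^sub>+\<close> for \<open>n\<close> of
  order \<open>h\<close> to the power \<open>-3/2\<close>.
\<close>

section \<open>Planar linear flows\<close>

text \<open>No invariant measure of the angular process is used. Its role is taken by expectations
  of logarithmic growth, whose dependence on the starting point is bounded directly. Everything is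
  counted in jumps; only at the end is the rate per jump divided by the mean holding time. The
  quantity h is the mean length of a cycle, since 1/(\<beta> \<lambda>) + 1/(\<beta> (1 -
  \<lambda>)) = h. The mean share of state 0 in it is 1 - \<lambda>, which is how the averaged
  matrix enters. The obstacle for fast switching is uniformity in \<beta>. Compactness for a fixed
  \<beta> bounds the pairing of a row with a vector away from 0, but without control as \<beta>
  grows, and a short cycle moves a vector only by order h. The compactness argument is therefore
  repeated with \<beta> among the varying parameters and with the pairing divided by h, and all
  constants of the fast regime are fixed before \<beta>. The Hurwitz property enters through a bound
  on both flows that is uniform in time, through their decay, and through the exclusion of a common
  eigenvector.\<close>

lemma two_cases: "(i::2) = 0 \<or> i = 1"
  using exhaust_2[of i] by auto

lemma vec2_eq_iff: "(x :: 'a^2) = y \<longleftrightarrow> x$1 = y$1 \<and> x$2 = y$2"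
  by (auto simp: vec_eq_iff forall_2)

lemma matrix_vector_2:
  fixes M :: "'a::comm_semiring_1^2^2"
  shows "(M *v x)$1 = M$1$1 * x$1 + M$1$2 * x$2" "(M *v x)$2 = M$2$1 * x$1 + M$2$2 * x$2"
  by (simp_all add: matrix_vector_mult_def sum_2)

lemma inner_vec2: "inner (x::real^2) y = x$1 * y$1 + x$2 * y$2"
  by (simp add: inner_vec_def sum_2)

lemma trace_2: "trace (M :: 'a::comm_ring_1^2^2) = M$1$1 + M$2$2"
  by (simp add: trace_def sum_2)

text \<open>For the converse, the witnesses are up to sign the two columns of the adjugate of
  \<open>M - \<mu>\<close>; if both vanish, \<open>M\<close> is scalar and any nonzero vector
  serves. The lemma is applied over the complex numbers, for \<open>is_eigenvalue\<close>, and over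
  the reals, for eigenvectors in the plane.\<close>

lemma eigenvector_iff_char_poly:
  fixes M :: "'a::field^2^2"
  shows "(\<exists>v. v \<noteq> 0 \<and> M *v v = \<mu> *s v) \<longleftrightarrow> \<mu>\<^sup>2 - trace M * \<mu> + det M = 0"
proof
  assume "\<exists>v. v \<noteq> 0 \<and> M *v v = \<mu> *s v"
  then obtain v where v: "v \<noteq> 0" "M *v v = \<mu> *s v" by blast
  have e1: "M$1$1 * v$1 + M$1$2 * v$2 = \<mu> * v$1" and e2: "M$2$1 * v$1 + M$2$2 * v$2 = \<mu> * v$2"
    using v(2) by (auto simp: vec2_eq_iff matrix_vector_2)
  have "(\<mu>\<^sup>2 - trace M * \<mu> + det M) * v$1 = 0" "(\<mu>\<^sup>2 - trace M * \<mu> + det M) * v$2 = 0"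
    unfolding trace_2 det_2 power2_eq_square using e1 e2 by algebra+
  then show "\<mu>\<^sup>2 - trace M * \<mu> + det M = 0" using v(1) by (auto simp: vec2_eq_iff)
next
  assume "\<mu>\<^sup>2 - trace M * \<mu> + det M = 0"
  then have p: "(M$1$1 - \<mu>) * (M$2$2 - \<mu>) = M$1$2 * M$2$1"
    by (simp add: trace_2 det_2 power2_eq_square algebra_simps)
  show "\<exists>v. v \<noteq> 0 \<and> M *v v = \<mu> *s v"
  proof (cases "M$1$2 = 0 \<and> M$1$1 = \<mu>")
    case False
    let ?v = "vector [M$1$2, \<mu> - M$1$1] :: 'a^2"
    have "?v \<noteq> 0" using False by (auto simp: vec2_eq_iff)
    moreover have "M *v ?v = \<mu> *s ?v"
      using p by (simp add: vec2_eq_iff matrix_vector_2) algebra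
    ultimately show ?thesis by blast
  next
    case True
    show ?thesis
    proof (cases "M$2$1 = 0 \<and> M$2$2 = \<mu>")
      case False
      let ?v = "vector [\<mu> - M$2$2, M$2$1] :: 'a^2"
      have "?v \<noteq> 0" using False by (auto simp: vec2_eq_iff)
      moreover have "M *v ?v = \<mu> *s ?v"
        using True by (simp add: vec2_eq_iff matrix_vector_2 algebra_simps)
      ultimately show ?thesis by blast
    next
      case T2: True
      let ?v = "vector [1, 0] :: 'a^2"
      have "?v \<noteq> 0" by (auto simp: vec2_eq_iff)
      moreover have "M *v ?v = \<mu> *s ?v"
        using True T2 by (simp add: vec2_eq_iff matrix_vector_2)
      ultimately show ?thesis by blast
    qed
  qed
qed

lemma is_eigenvalue_iff:
  fixes A :: "real^2^2"
  shows "is_eigenvalue A \<mu> \<longleftrightarrow> \<mu>\<^sup>2 - of_real (trace A) * \<mu> + of_real (det A) = 0"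
  unfolding is_eigenvalue_def eigenvector_iff_char_poly by (simp add: trace_2 det_2)

text \<open>The principal square root \<open>w\<close> of the discriminant has nonnegative real
  part, so the root built with \<open>+ w\<close> is the one of larger real part. Its negativity
  forces the trace to be negative; if the determinant were not positive, \<open>w\<close> would be
  real and at least the absolute value of the trace, and this root would be nonnegative.\<close>

lemma hurwitz_trace_det:
  fixes A :: "real^2^2"
  assumes "hurwitz A"
  shows "trace A < 0" "det A > 0"
proof -
  define w where "w = csqrt (of_real ((trace A)\<^sup>2 - 4 * det A))"
  have w2: "w\<^sup>2 = of_real ((trace A)\<^sup>2 - 4 * det A)" by (simp add: w_def)
  have "is_eigenvalue A ((of_real (trace A) + w) / 2)"
  proof -
    have "w * w = of_real (trace A) * of_real (trace A) - 4 * of_real (det A)"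
      using w2 by (simp add: power2_eq_square)
    then show ?thesis
      unfolding is_eigenvalue_iff power2_eq_square by (simp add: field_simps) algebra
  qed
  then have neg: "trace A + Re w < 0" using assms by (auto simp: hurwitz_def)
  moreover have "Re w \<ge> 0" using csqrt_principal[of "of_real ((trace A)\<^sup>2 - 4 * det A)"] unfolding w_def by auto
  ultimately show tr: "trace A < 0" by simp
  show "det A > 0"
  proof (rule ccontr)
    assume d: "\<not> det A > 0"
    then have "w = of_real (sqrt ((trace A)\<^sup>2 - 4 * det A))"
      unfolding w_def by (subst csqrt_of_real_nonneg) (use d in \<open>auto intro: order_trans[of _ 0]\<close>)
    moreover have "sqrt ((trace A)\<^sup>2 - 4 * det A) \<ge> sqrt ((trace A)\<^sup>2)"
      using d by (intro real_sqrt_le_mono) (auto intro: order_trans[of _ 0])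
    ultimately show False using neg tr by simp
  qed
qed

text \<open>The functions \<open>q\<close> and \<open>r = q'\<close> with \<open>q'' = t q' - d q\<close> express the flow through Cayley-Hamilton.\<close>

lemma scalar_flow_ex:
  fixes t d :: real
  shows "\<exists>q r. q 0 = 0 \<and> r 0 = 1 \<and> (\<forall>s. (q has_real_derivative r s) (at s)) \<and>
    (\<forall>s. (r has_real_derivative t * r s - d * q s) (at s))"
proof -
  define a where "a = t / 2"
  \<comment> \<open>\<open>D\<close> is a quarter of the discriminant; its sign separates real,
    complex and double characteristic roots, which call for sinh, sin and a linear factor
    respectively.\<close>
  define D where "D = a\<^sup>2 - d"
  have td: "t = 2 * a" "d = a\<^sup>2 - D" by (simp_all add: a_def D_def)
  consider "D > 0" | "D < 0" | "D = 0" by linarith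
  then show ?thesis
  proof cases
    case 1
    define w where "w = sqrt D"
    have w: "w > 0" "D = w * w" using 1 by (simp_all add: w_def)
    show ?thesis
      apply (rule exI[of _ "\<lambda>s. exp (a * s) * sinh (w * s) / w"])
      apply (rule exI[of _ "\<lambda>s. exp (a * s) * (a * sinh (w * s) / w + cosh (w * s))"])
      unfolding td using w
      by (auto intro!: derivative_eq_intros simp: field_simps power2_eq_square)
  next
    case 2
    define w where "w = sqrt (-D)"
    have w: "w > 0" "D = - (w * w)" using 2 by (simp_all add: w_def)
    show ?thesis
      apply (rule exI[of _ "\<lambda>s. exp (a * s) * sin (w * s) / w"])
      apply (rule exI[of _ "\<lambda>s. exp (a * s) * (a * sin (w * s) / w + cos (w * s))"])
      unfolding td using w
      by (auto intro!: derivative_eq_intros simp: field_simps power2_eq_square)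
  next
    case 3
    show ?thesis
      apply (rule exI[of _ "\<lambda>s. exp (a * s) * s"])
      apply (rule exI[of _ "\<lambda>s. exp (a * s) * (a * s + 1)"])
      unfolding td using 3
      by (auto intro!: derivative_eq_intros simp: field_simps power2_eq_square)
  qed
qed

text \<open>This is the matrix exponential exp(s A), introduced by its differential equation because
  all later arguments go through uniqueness of solutions and never through a power series.\<close>

definition flow :: "real^2^2 \<Rightarrow> real \<Rightarrow> real^2^2" where
  "flow A = (SOME \<Phi>. \<Phi> 0 = mat 1 \<and> (\<forall>s. (\<Phi> has_vector_derivative A ** \<Phi> s) (at s)))"

lemma flow_0: "flow A 0 = mat 1"
  and flow_deriv: "(flow A has_vector_derivative A ** flow A s) (at s)"
proof -
  obtain q r where qr: "q 0 = 0" "r 0 = 1" "\<And>s. (q has_real_derivative r s) (at s)"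
    "\<And>s. (r has_real_derivative trace A * r s - det A * q s) (at s)"
    using scalar_flow_ex[of "trace A" "det A"] by blast
  define \<Phi> where "\<Phi> s = (r s - trace A * q s) *\<^sub>R mat 1 + q s *\<^sub>R A" for s
  have "\<Phi> 0 = mat 1" by (simp add: \<Phi>_def qr)
  moreover have "(\<Phi> has_vector_derivative A ** \<Phi> s) (at s)" for s
  proof -
    have "((\<lambda>s. r s - trace A * q s) has_vector_derivative - det A * q s) (at s)"
      unfolding has_real_derivative_iff_has_vector_derivative[symmetric]
      by (rule DERIV_cong, rule DERIV_diff, rule qr, rule DERIV_cmult, rule qr) simp
    moreover have "(q has_vector_derivative r s) (at s)"
      using qr(3) by (simp add: has_real_derivative_iff_has_vector_derivative)
    ultimately have "(\<Phi> has_vector_derivative (- det A * q s) *\<^sub>R mat 1 + r s *\<^sub>R A) (at s)"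
      unfolding \<Phi>_def
      by (intro has_vector_derivative_add bounded_linear.has_vector_derivative[OF bounded_linear_scaleR_left])
    \<comment> \<open>This is the Cayley-Hamilton identity A A = trace A * A - det A * 1, verified
      entry by entry.\<close>
    also have "(- det A * q s) *\<^sub>R mat 1 + r s *\<^sub>R A = A ** \<Phi> s"
      unfolding vec2_eq_iff
      by (simp add: \<Phi>_def matrix_matrix_mult_def mat_def sum_2 trace_2 det_2) (simp add: algebra_simps)
    finally show ?thesis .
  qed
  ultimately have "\<exists>\<Phi>. \<Phi> 0 = mat 1 \<and> (\<forall>s. (\<Phi> has_vector_derivative A ** \<Phi> s) (at s))" by blast
  then have "flow A 0 = mat 1 \<and> (\<forall>s. (flow A has_vector_derivative A ** flow A s) (at s))"
    unfolding flow_def by (rule someI_ex)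
  then show "flow A 0 = mat 1" "(flow A has_vector_derivative A ** flow A s) (at s)" by auto
qed

lemma bounded_linear_matrix_vector: "bounded_linear (\<lambda>M::real^2^2. M *v x)"
  by (intro linear_conv_bounded_linear[THEN iffD1] linearI)
     (simp_all add: matrix_vector_mult_add_rdistrib scaleR_matrix_vector_assoc)

lemma flow_vec_0 [simp]: "flow A 0 *v x = x"
  by (simp add: flow_0)

lemma flow_vec_deriv: "((\<lambda>s. flow A s *v x) has_vector_derivative A *v (flow A s *v x)) (at s within S)"
  using bounded_linear.has_vector_derivative[OF bounded_linear_matrix_vector flow_deriv]
  by (auto simp: matrix_vector_mul_assoc intro: has_vector_derivative_at_within)

lemma continuous_flow: "continuous_on S (flow A)"
  by (intro continuous_at_imp_continuous_on ballI has_vector_derivative_continuous[OF flow_deriv])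

lemma matrix_bound_ex: "\<exists>C>0. \<forall>x. norm ((A::real^2^2) *v x) \<le> C * norm x"
proof -
  have "bounded_linear ((*v) A)" by (rule matrix_vector_mul_bounded_linear)
  from bounded_linear.pos_bounded[OF this] show ?thesis by (simp only: mult.commute)
qed

text \<open>The derivative of the squared norm is at most 2 C times the squared norm in absolute
  value, so multiplying by exp(-2 C s) or exp(2 C s) gives a monotone function. The lower bound
  matters as much as the upper one: it keeps the logarithm of the norm finite and Lipschitz in
  time.\<close>

lemma linear_ode_norm_bounds:
  fixes y :: "real \<Rightarrow> real^2"
  assumes "a \<le> b" and C: "\<And>x. norm (A *v x) \<le> C * norm x"
    and cont: "continuous_on {a..b} y"
    and der: "\<And>s. a < s \<Longrightarrow> s < b \<Longrightarrow> (y has_vector_derivative A *v y s) (at s)"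
  shows "norm (y b) \<le> exp (C * (b - a)) * norm (y a)"
    and "exp (- C * (b - a)) * norm (y a) \<le> norm (y b)"
proof -
  have d: "((\<lambda>s. inner (y s) (y s)) has_real_derivative 2 * inner (y s) (A *v y s)) (at s)"
    if "a < s" "s < b" for s
    using bounded_bilinear.has_vector_derivative[OF bounded_bilinear_inner der[OF that] der[OF that]]
    by (simp add: has_real_derivative_iff_has_vector_derivative inner_commute)
  have i: "\<bar>inner (y s) (A *v y s)\<bar> \<le> C * inner (y s) (y s)" for s
  proof -
    have "\<bar>inner (y s) (A *v y s)\<bar> \<le> norm (y s) * norm (A *v y s)" by (rule Cauchy_Schwarz_ineq2)
    also have "\<dots> \<le> norm (y s) * (C * norm (y s))" by (intro mult_left_mono C) auto
    finally show ?thesis by (simp add: dot_square_norm power2_eq_square mult_ac)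
  qed
  have D: "((\<lambda>s. inner (y s) (y s) * exp (k * (s - a))) has_real_derivative
      (2 * inner (y s) (A *v y s) + k * inner (y s) (y s)) * exp (k * (s - a))) (at s)"
    if "a < s" "s < b" for s k
    by (rule derivative_eq_intros d that refl)+ (simp add: algebra_simps)
  have cont': "continuous_on {a..b} (\<lambda>s. inner (y s) (y s) * exp (k * (s - a)))" for k
    by (intro continuous_intros cont)
  have up: "inner (y b) (y b) * exp (-(2*C) * (b - a)) \<le> inner (y a) (y a) * exp (-(2*C) * (a - a))"
    apply (rule DERIV_nonpos_imp_decreasing_open[OF assms(1) _ cont'])
    subgoal for s
      by (rule exI[of _ "(2 * inner (y s) (A *v y s) + -(2*C) * inner (y s) (y s)) * exp (-(2*C) * (s - a))"])
         (use D[of s "-(2*C)"] i[of s] in \<open>auto intro!: mult_nonpos_nonneg\<close>)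
    done
  have lo: "inner (y a) (y a) * exp ((2*C) * (a - a)) \<le> inner (y b) (y b) * exp ((2*C) * (b - a))"
    apply (rule DERIV_nonneg_imp_increasing_open[OF assms(1) _ cont'])
    subgoal for s
      by (rule exI[of _ "(2 * inner (y s) (A *v y s) + (2*C) * inner (y s) (y s)) * exp ((2*C) * (s - a))"])
         (use D[of s "2*C"] i[of s] in \<open>auto intro!: mult_nonneg_nonneg\<close>)
    done
  have sq: "exp (2 * z) = (exp z)\<^sup>2" for z :: real by (simp add: exp_double)
  have e: "exp (2*C*(b-a)) = (exp (C * (b-a)))\<^sup>2" using sq[of "C*(b-a)"] by (simp add: mult_ac)
  have e': "exp (-(2*C)*(b-a)) = inverse ((exp (C * (b-a)))\<^sup>2)" using e by (simp add: exp_minus)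
  have "(norm (y b))\<^sup>2 \<le> (exp (C * (b - a)) * norm (y a))\<^sup>2"
    using up unfolding e' by (simp add: dot_square_norm power_mult_distrib field_simps)
  then show "norm (y b) \<le> exp (C * (b - a)) * norm (y a)"
    by (rule power2_le_imp_le) auto
  have "(norm (y a))\<^sup>2 \<le> (exp (C * (b - a)) * norm (y b))\<^sup>2"
    using lo unfolding e by (simp add: dot_square_norm power_mult_distrib field_simps)
  then have "norm (y a) \<le> exp (C * (b - a)) * norm (y b)"
    by (rule power2_le_imp_le) auto
  then show "exp (- C * (b - a)) * norm (y a) \<le> norm (y b)"
    using mult_left_mono[of "norm (y a)" "exp (C * (b - a)) * norm (y b)" "exp (- C * (b - a))"]
    by (simp add: mult.assoc[symmetric] mult_exp_exp)
qed

lemma flow_bounds: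
  assumes "\<And>x. norm (A *v x) \<le> C * norm x" "0 \<le> s"
  shows "norm (flow A s *v x) \<le> exp (C * s) * norm x"
    and "exp (- C * s) * norm x \<le> norm (flow A s *v x)"
proof -
  have "continuous_on {0..s} (\<lambda>s. flow A s *v x)"
    by (intro continuous_at_imp_continuous_on ballI has_vector_derivative_continuous[OF flow_vec_deriv])
  from linear_ode_norm_bounds[OF assms(2,1) this flow_vec_deriv]
  show "norm (flow A s *v x) \<le> exp (C * s) * norm x"
    and "exp (- C * s) * norm x \<le> norm (flow A s *v x)" by auto
qed

text \<open>The difference from the flow started at \<open>y a\<close> solves the same equation and
  vanishes at \<open>a\<close>, so the norm bound kills it. Differentiability is asked only in the
  open interval, because a solution of the switched equation has corners at the jump times.\<close>

lemma linear_ode_unique: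
  fixes y :: "real \<Rightarrow> real^2"
  assumes "a \<le> b" "continuous_on {a..b} y"
    and der: "\<And>s. a < s \<Longrightarrow> s < b \<Longrightarrow> (y has_vector_derivative A *v y s) (at s)"
  shows "y b = flow A (b - a) *v y a"
proof -
  obtain C where C: "\<And>x. norm (A *v x) \<le> C * norm x" using matrix_bound_ex by blast
  define z where "z s = y s - flow A (s - a) *v y a" for s
  have d: "((\<lambda>s. flow A (s - a) *v y a) has_vector_derivative A *v (flow A (s - a) *v y a)) (at s)" for s
  proof -
    have "((\<lambda>s. s - a) has_vector_derivative 1) (at s)"
      by (auto intro!: derivative_eq_intros)
    from vector_diff_chain_at[OF this flow_vec_deriv] show ?thesis by (simp add: o_def)
  qed
  have "continuous_on {a..b} (\<lambda>s. flow A (s - a) *v y a)"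
    by (intro continuous_at_imp_continuous_on ballI has_vector_derivative_continuous[OF d])
  then have "continuous_on {a..b} z" unfolding z_def by (intro continuous_intros assms)
  moreover have "(z has_vector_derivative A *v z s) (at s)" if "a < s" "s < b" for s
    unfolding z_def matrix_vector_mult_diff_distrib
    by (intro derivative_intros der d that)
  ultimately have "norm (z b) \<le> exp (C * (b - a)) * norm (z a)"
    by (rule linear_ode_norm_bounds[OF assms(1) C])
  then show ?thesis by (simp add: z_def)
qed

text \<open>The Lyapunov function is V x = d |x|^2 + |N x|^2 with N = t - A, the adjugate of A.
  Since N A = d and A + N = t, its derivative along the flow is 2 d <x, A x> + 2 d <N x, x> = 2 t d
  |x|^2, which is negative because t < 0 < d.\<close>

lemma hurwitz_flow_decay:
  fixes A :: "real^2^2"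
  assumes "hurwitz A"
  shows "\<exists>K\<ge>1. \<exists>a>0. \<forall>s\<ge>0. \<forall>x. norm (flow A s *v x) \<le> K * exp (- a * s) * norm x"
proof -
  define d t where "d = det A" and "t = trace A"
  have td: "t < 0" "d > 0" using hurwitz_trace_det[OF assms] by (auto simp: d_def t_def)
  define N where "N = t *\<^sub>R mat 1 - A"
  define V where "V x = d * inner x x + inner (N *v x) (N *v x)" for x
  have N: "(N *v x)$1 = A$2$2 * x$1 - A$1$2 * x$2" "(N *v x)$2 = A$1$1 * x$2 - A$2$1 * x$1" for x
    by (simp_all add: matrix_vector_2 N_def mat_def t_def trace_2 algebra_simps)
  obtain B where B: "B > 0" "\<And>x. norm (N *v x) \<le> B * norm x" using matrix_bound_ex by blast
  define m where "m = d + B\<^sup>2"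
  have m: "m > 0" using td by (simp add: m_def add_pos_nonneg)
  have V_up: "V x \<le> m * inner x x" for x
  proof -
    have "(norm (N *v x))\<^sup>2 \<le> (B * norm x)\<^sup>2" using B by (intro power_mono) auto
    then show ?thesis by (simp add: V_def m_def dot_square_norm power_mult_distrib algebra_simps)
  qed
  have V_lo: "d * inner x x \<le> V x" for x by (simp add: V_def)
  \<comment> \<open>With V x <= m |x|^2, this is the rate for which 2 t d |x|^2 <= - k V x.\<close>
  define k where "k = - 2 * t * d / m"
  have k: "k > 0" using td m by (simp add: k_def divide_neg_pos mult_neg_pos)
  have bound: "V (flow A s *v x) * exp (k * s) \<le> V x" if "s \<ge> 0" for s x
  proof -
    define y where "y s = flow A s *v x" for s
    have y: "(y has_vector_derivative A *v y s) (at s)" for s unfolding y_def by (rule flow_vec_deriv)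
    have y1: "((\<lambda>s. y s $ 1) has_real_derivative (A *v y s)$1) (at s)"
     and y2: "((\<lambda>s. y s $ 2) has_real_derivative (A *v y s)$2) (at s)" for s
      using bounded_linear.has_vector_derivative[OF bounded_linear_vec_nth y]
      by (auto simp: has_real_derivative_iff_has_vector_derivative)
    define a b c e where "a = A$1$1" and "b = A$1$2" and "c = A$2$1" and "e = A$2$2"
    define p q where "p s = y s $ 1" and "q s = y s $ 2" for s
    have p: "(p has_real_derivative a * p s + b * q s) (at s)"
     and q: "(q has_real_derivative c * p s + e * q s) (at s)" for s
      using y1[of s] y2[of s] by (simp_all add: p_def[abs_def] q_def[abs_def] a_def b_def c_def e_def matrix_vector_2)
    have Vp: "V (y s) = d * (p s * p s + q s * q s) + ((e * p s - b * q s) * (e * p s - b * q s)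
        + (a * q s - c * p s) * (a * q s - c * p s))" for s
      by (simp only: V_def inner_vec2 N p_def q_def a_def b_def c_def e_def)
    have dV: "((\<lambda>s. V (y s)) has_real_derivative 2 * t * d * inner (y s) (y s)) (at s)" for s
      unfolding Vp inner_vec2 p_def[symmetric] q_def[symmetric] d_def t_def trace_2 det_2
        a_def[symmetric] b_def[symmetric] c_def[symmetric] e_def[symmetric]
      apply (rule DERIV_cong, (rule DERIV_add DERIV_diff DERIV_mult' DERIV_const p q)+)
      apply (simp only: algebra_simps)
      done
    have D: "((\<lambda>s. V (y s) * exp (k * s)) has_real_derivative
        (2 * t * d * inner (y s) (y s) + k * V (y s)) * exp (k * s)) (at s)" for s
      by (rule derivative_eq_intros dV refl)+ (simp add: algebra_simps)
    have np: "2 * t * d * inner (y s) (y s) + k * V (y s) \<le> 0" for s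
    proof -
      have "k * V (y s) \<le> k * (m * inner (y s) (y s))" using k V_up by (intro mult_left_mono) auto
      also have "\<dots> = - 2 * t * d * inner (y s) (y s)" using m by (simp add: k_def)
      finally show ?thesis by simp
    qed
    have "V (y s) * exp (k * s) \<le> V (y 0) * exp (k * 0)"
      using D np by (intro DERIV_nonpos_imp_nonincreasing[OF that]) (meson exp_ge_zero mult_nonpos_nonneg)
    then show ?thesis by (simp add: y_def)
  qed
  define K where "K = sqrt (m / d)"
  have K: "K > 0" "K\<^sup>2 = m / d" using m td by (simp_all add: K_def)
  have K1: "K \<ge> 1" unfolding K_def using td by (simp add: m_def)
  have "norm (flow A s *v x) \<le> K * exp (- (k/2) * s) * norm x" if "s \<ge> 0" for s x
  proof (rule power2_le_imp_le)
    have e: "exp (k * s) = (exp (k / 2 * s))\<^sup>2" by (simp add: exp_double[symmetric])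
    have "d * (norm (flow A s *v x))\<^sup>2 * exp (k * s) \<le> V (flow A s *v x) * exp (k * s)"
      using V_lo[of "flow A s *v x"] by (simp add: dot_square_norm)
    also have "\<dots> \<le> m * (norm x)\<^sup>2"
      using bound[OF that, of x] V_up[of x] by (simp add: dot_square_norm)
    finally have "(norm (flow A s *v x))\<^sup>2 * (exp (k / 2 * s))\<^sup>2 \<le> m / d * (norm x)\<^sup>2"
      using td unfolding e by (simp add: field_simps)
    then have "(norm (flow A s *v x))\<^sup>2 * ((exp (k / 2 * s))\<^sup>2 * (exp (- (k / 2) * s))\<^sup>2)
        \<le> m / d * (norm x)\<^sup>2 * (exp (- (k / 2) * s))\<^sup>2"
      unfolding mult.assoc[symmetric] by (rule mult_right_mono) simp
    moreover have "(exp (k / 2 * s))\<^sup>2 * (exp (- (k / 2) * s))\<^sup>2 = 1"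
      unfolding power_mult_distrib[symmetric] by (simp add: mult_exp_exp)
    ultimately show "(norm (flow A s *v x))\<^sup>2 \<le> (K * exp (- (k/2) * s) * norm x)\<^sup>2"
      unfolding power_mult_distrib K(2) by (simp add: mult_ac)
  qed (use K in auto)
  then have "\<forall>s\<ge>0. \<forall>x. norm (flow A s *v x) \<le> K * exp (- (k/2) * s) * norm x" by blast
  moreover have "k / 2 > 0" using k by simp
  ultimately show ?thesis using K1 by blast
qed

section \<open>Real eigenvalues and common eigenvectors\<close>

lemma real_eigenvalue_char_poly:
  fixes A :: "real^2^2"
  assumes "is_eigenvalue A (complex_of_real c)"
  shows "c\<^sup>2 - trace A * c + det A = 0"
  using assms unfolding is_eigenvalue_iff
  by (metis (no_types, opaque_lifting) of_real_0 of_real_add of_real_diff of_real_eq_iff of_real_mult of_real_power)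

lemma opposite_eigenvalues_trace_det:
  fixes A :: "real^2^2"
  assumes "0 < a" "0 < b" "is_eigenvalue A (complex_of_real (- a))" "is_eigenvalue A (complex_of_real b)"
  shows "trace A = b - a" "det A = - (a * b)"
proof -
  note e = assms(3,4)[THEN real_eigenvalue_char_poly]
  have "(b + a) * (b - a - trace A) = 0"
    using e by (simp add: power2_eq_square algebra_simps)
  then show t: "trace A = b - a" using assms by simp
  show "det A = - (a * b)"
    using e(2) unfolding t by (simp add: power2_eq_square algebra_simps)
qed

text \<open>The number \<open>trace A - c\<close> is the other root of the characteristic
  polynomial; the two roots have positive product and negative sum.\<close>

lemma hurwitz_real_eigenpair:
  fixes A :: "real^2^2"
  assumes "hurwitz A" "x \<noteq> 0" "A *v x = c *\<^sub>R x"
  shows "c < 0" "trace A - c < 0"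
proof -
  have "c\<^sup>2 - trace A * c + det A = 0"
    using eigenvector_iff_char_poly[of A c] assms(2,3) by (auto simp: scalar_mult_eq_scaleR)
  then have p: "c * (trace A - c) = det A" by (simp add: power2_eq_square algebra_simps)
  have "c * (trace A - c) > 0" "c + (trace A - c) < 0"
    using p hurwitz_trace_det[OF assms(1)] by auto
  then show "c < 0" "trace A - c < 0" by (auto simp: zero_less_mult_iff)
qed

text \<open>On a common eigenvector the averaged matrix has the convex combination of the two
  eigenvalues as eigenvalue, and the other root is the same convex combination of the two
  complementary roots. All four numbers are negative, so the determinant of the average would be
  positive. This is the only place where the saddle condition yields irreducibility.\<close>

lemma no_common_eigenvector:
  fixes A :: "2 \<Rightarrow> real^2^2"
  assumes "hurwitz (A 0)" "hurwitz (A 1)" "0 < lam" "lam < 1" "x \<noteq> 0"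
    and "det ((1 - lam) *\<^sub>R A 0 + lam *\<^sub>R A 1) < 0"
    and "A 0 *v x = c *\<^sub>R x" "A 1 *v x = d *\<^sub>R x"
  shows False
proof -
  let ?M = "(1 - lam) *\<^sub>R A 0 + lam *\<^sub>R A 1"
  let ?c = "(1 - lam) * c + lam * d"
  have "?M *v x = ?c *\<^sub>R x"
    using assms(7,8) by (simp add: matrix_vector_mult_add_rdistrib scaleR_matrix_vector_assoc[symmetric] algebra_simps)
  then have "?c\<^sup>2 - trace ?M * ?c + det ?M = 0"
    using eigenvector_iff_char_poly[of ?M ?c] assms(5) by (auto simp: scalar_mult_eq_scaleR)
  then have "?c * (trace ?M - ?c) < 0" using assms(6) by (simp add: power2_eq_square algebra_simps)
  moreover have "trace ?M - ?c = (1 - lam) * (trace (A 0) - c) + lam * (trace (A 1) - d)"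
    by (simp add: trace_2 algebra_simps)
  moreover have "?c < 0" "(1 - lam) * (trace (A 0) - c) + lam * (trace (A 1) - d) < 0"
    using hurwitz_real_eigenpair[OF assms(1,5,7)] hurwitz_real_eigenpair[OF assms(2,5,8)] assms(3,4)
    by (intro add_neg_neg mult_pos_neg; simp)+
  ultimately show False using mult_neg_neg by (smt (verit))
qed

lemma parallel_2:
  fixes x y w :: "real^2"
  assumes "w \<noteq> 0" "x \<noteq> 0" "inner w x = 0" "inner w y = 0"
  shows "\<exists>c. y = c *\<^sub>R x"
proof -
  have xy: "x$1 * y$2 = x$2 * y$1"
  proof (cases "w$1 = 0")
    case True
    then have "w$2 \<noteq> 0" using assms(1) by (auto simp: vec2_eq_iff)
    then show ?thesis using assms(3,4) True by (simp add: inner_vec2)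
  next
    case False
    have "w$1 * (x$1 * y$2 - x$2 * y$1) = 0"
      using assms(3,4) unfolding inner_vec2 by algebra
    then show ?thesis using False by simp
  qed
  show ?thesis
  proof (cases "x$1 = 0")
    case True
    then have "x$2 \<noteq> 0" using assms(2) by (auto simp: vec2_eq_iff)
    then show ?thesis using True xy
      by (intro exI[of _ "y$2 / x$2"]) (auto simp: vec2_eq_iff)
  next
    case False
    then show ?thesis using xy
      by (intro exI[of _ "y$1 / x$1"]) (auto simp: vec2_eq_iff field_simps)
  qed
qed

section \<open>Independent exponential variables\<close>

definition expm :: "real measure" where
  "expm = density lborel (\<lambda>x. ennreal (exponential_density 1 x))"

definition seqm :: "(nat \<Rightarrow> real) measure" where
  "seqm = (\<Pi>\<^sub>M k\<in>(UNIV :: nat set). expm)"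

lemma sets_expm [simp, measurable_cong]: "sets expm = sets borel"
  by (simp add: expm_def)

lemma space_expm [simp]: "space expm = UNIV"
  by (simp add: expm_def)

interpretation expm: prob_space expm
  unfolding expm_def by (rule prob_space_exponential_density) simp

interpretation seq: sequence_space expm
  by unfold_locales

interpretation seqm: prob_space seqm
  unfolding seqm_def by unfold_locales

lemma prob_UNIV [simp]: "measure expm UNIV = 1" "measure seqm UNIV = 1"
  using expm.prob_space seqm.prob_space by (simp_all add: seqm_def space_PiM)

interpretation es: pair_prob_space expm seqm
  by unfold_locales

interpretation ee: pair_prob_space expm expm
  by unfold_locales

interpretation ees: pair_prob_space "expm \<Otimes>\<^sub>M expm" seqm
  by unfold_locales

lemma sets_seqm [simp, measurable_cong]: "sets seqm = sets (\<Pi>\<^sub>M k\<in>(UNIV :: nat set). expm)"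
  by (simp add: seqm_def)

lemma space_seqm [simp]: "space seqm = UNIV"
  by (simp add: seqm_def space_PiM)

lemma measurable_component_seqm [measurable]: "(\<lambda>e. e k) \<in> seqm \<rightarrow>\<^sub>M expm"
  unfolding seqm_def by measurable

lemma measurable_cons [measurable]: "(\<lambda>(s, e). case_nat s e) \<in> expm \<Otimes>\<^sub>M seqm \<rightarrow>\<^sub>M seqm"
  unfolding seqm_def by measurable

lemma distr_case_nat: "distr (expm \<Otimes>\<^sub>M seqm) seqm (\<lambda>(s, e). case_nat s e) = seqm"
  unfolding seqm_def by (rule seq.PiM_iter)

abbreviation cons2 :: "'a \<times> 'a \<Rightarrow> (nat \<Rightarrow> 'a) \<Rightarrow> nat \<Rightarrow> 'a" where
  "cons2 p e \<equiv> case_nat (fst p) (case_nat (snd p) e)"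

lemma measurable_cons2 [measurable]:
  "(\<lambda>(p, e). cons2 p e) \<in> (expm \<Otimes>\<^sub>M expm) \<Otimes>\<^sub>M seqm \<rightarrow>\<^sub>M seqm"
  unfolding seqm_def by measurable

text \<open>Two variables are split off together because two jumps form a cycle, after which the
  discrete state has returned to its initial value. The proof uses the one-variable statement twice,
  for \<open>A\<close> and then for its section along the first variable.\<close>

lemma distr_case_nat2:
  "distr ((expm \<Otimes>\<^sub>M expm) \<Otimes>\<^sub>M seqm) seqm (\<lambda>(p, e). cons2 p e) = seqm"
proof (rule measure_eqI)
  fix A assume "A \<in> sets (distr ((expm \<Otimes>\<^sub>M expm) \<Otimes>\<^sub>M seqm) seqm (\<lambda>(p, e). cons2 p e))"
  then have A[measurable]: "A \<in> sets seqm" by simp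
  have one: "emeasure seqm A = (\<integral>\<^sup>+s. \<integral>\<^sup>+e. indicator A (case_nat s e) \<partial>seqm \<partial>expm)"
    if [measurable]: "A \<in> sets seqm" for A
  proof -
    have "emeasure seqm A = (\<integral>\<^sup>+e. indicator A e \<partial>distr (expm \<Otimes>\<^sub>M seqm) seqm (\<lambda>(s, e). case_nat s e))"
      unfolding distr_case_nat using that by (rule nn_integral_indicator[symmetric])
    also have "\<dots> = (\<integral>\<^sup>+x. indicator A (case x of (s, e) \<Rightarrow> case_nat s e) \<partial>(expm \<Otimes>\<^sub>M seqm))"
      by (subst nn_integral_distr) measurable
    also have "\<dots> = (\<integral>\<^sup>+s. \<integral>\<^sup>+e. indicator A (case_nat s e) \<partial>seqm \<partial>expm)"
      using seqm.nn_integral_fst[OF measurable_compose[OF measurable_cons borel_measurable_indicator[OF that]]]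
      by simp
    finally show ?thesis .
  qed
  have "emeasure (distr ((expm \<Otimes>\<^sub>M expm) \<Otimes>\<^sub>M seqm) seqm (\<lambda>(p, e). cons2 p e)) A
    = (\<integral>\<^sup>+e. indicator A e \<partial>distr ((expm \<Otimes>\<^sub>M expm) \<Otimes>\<^sub>M seqm) seqm (\<lambda>(p, e). cons2 p e))"
    by (rule nn_integral_indicator[symmetric]) (use A in simp)
  also have "\<dots> = (\<integral>\<^sup>+x. indicator A (case x of (p, e) \<Rightarrow> cons2 p e) \<partial>((expm \<Otimes>\<^sub>M expm) \<Otimes>\<^sub>M seqm))"
    by (rule nn_integral_distr[OF measurable_cons2]) simp
  also have "\<dots> = (\<integral>\<^sup>+p. \<integral>\<^sup>+e. indicator A (cons2 p e) \<partial>seqm \<partial>(expm \<Otimes>\<^sub>M expm))"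
    using seqm.nn_integral_fst[OF measurable_compose[OF measurable_cons2 borel_measurable_indicator[OF A]]]
    by simp
  also have "\<dots> = (\<integral>\<^sup>+s. \<integral>\<^sup>+s'. \<integral>\<^sup>+e. indicator A (case_nat s (case_nat s' e)) \<partial>seqm \<partial>expm \<partial>expm)"
    using expm.nn_integral_fst[OF seqm.borel_measurable_nn_integral_fst[OF
        measurable_compose[OF measurable_cons2 borel_measurable_indicator[OF A]]]]
    by simp
  also have "\<dots> = emeasure seqm A"
  proof -
    have "(\<integral>\<^sup>+e. indicator A (case_nat s e) \<partial>seqm) = (\<integral>\<^sup>+s'. \<integral>\<^sup>+e. indicator A (case_nat s (case_nat s' e)) \<partial>seqm \<partial>expm)" for s
    proof -
      have m: "case_nat s -` A \<in> sets seqm"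
      proof -
        have "case_nat s -` A \<inter> space seqm \<in> sets seqm" by measurable
        then show ?thesis by simp
      qed
      have i: "indicator A (case_nat s e) = (indicator (case_nat s -` A) e :: ennreal)" for e
        by (simp add: indicator_def)
      show ?thesis using one[OF m] m unfolding i by simp
    qed
    then show ?thesis using one[OF A] by simp
  qed
  finally show "emeasure (distr ((expm \<Otimes>\<^sub>M expm) \<Otimes>\<^sub>M seqm) seqm (\<lambda>(p, e). cons2 p e)) A
    = emeasure seqm A" .
qed simp

lemma
  fixes f :: "(nat \<Rightarrow> real) \<Rightarrow> real"
  assumes f: "integrable seqm f"
  shows integral_case_nat: "integral\<^sup>L seqm f = (\<integral>s. \<integral>e. f (case_nat s e) \<partial>seqm \<partial>expm)"
    and integrable_outer_case_nat: "integrable expm (\<lambda>s. \<integral>e. f (case_nat s e) \<partial>seqm)"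
proof -
  have [measurable]: "f \<in> borel_measurable seqm" using f by auto
  have "integrable (expm \<Otimes>\<^sub>M seqm) (\<lambda>x. f (case x of (s, e) \<Rightarrow> case_nat s e))"
    by (rule integrable_distr[OF measurable_cons]) (unfold distr_case_nat, rule f)
  then have i: "integrable (expm \<Otimes>\<^sub>M seqm) (\<lambda>(s, e). f (case_nat s e))"
    by (simp add: case_prod_beta')
  have "integral\<^sup>L seqm f = integral\<^sup>L (distr (expm \<Otimes>\<^sub>M seqm) seqm (\<lambda>(s, e). case_nat s e)) f"
    by (simp add: distr_case_nat)
  also have "\<dots> = (\<integral>x. f (case x of (s, e) \<Rightarrow> case_nat s e) \<partial>(expm \<Otimes>\<^sub>M seqm))"
    by (rule integral_distr[OF measurable_cons]) measurable
  also have "\<dots> = (\<integral>s. \<integral>e. f (case_nat s e) \<partial>seqm \<partial>expm)"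
    using es.integral_fst'[OF i] by (simp add: case_prod_beta')
  finally show "integral\<^sup>L seqm f = (\<integral>s. \<integral>e. f (case_nat s e) \<partial>seqm \<partial>expm)" .
  show "integrable expm (\<lambda>s. \<integral>e. f (case_nat s e) \<partial>seqm)"
    using es.integrable_fst'[OF i] by simp
qed

text \<open>The order of integration is reversed compared with the one-variable version: the tail is
  outside. Later the tail product is frozen and the randomness of the first two holding times alone
  is exploited.\<close>

lemma
  fixes f :: "(nat \<Rightarrow> real) \<Rightarrow> real"
  assumes f: "integrable seqm f"
  shows integral_case_nat2: "integral\<^sup>L seqm f =
      (\<integral>e. \<integral>p. f (cons2 p e) \<partial>(expm \<Otimes>\<^sub>M expm) \<partial>seqm)"
    and integrable_outer_case_nat2:
      "integrable seqm (\<lambda>e. \<integral>p. f (cons2 p e) \<partial>(expm \<Otimes>\<^sub>M expm))"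
proof -
  have [measurable]: "f \<in> borel_measurable seqm" using f by auto
  let ?c = "\<lambda>(p, e). cons2 p e :: nat \<Rightarrow> real"
  have "integrable ((expm \<Otimes>\<^sub>M expm) \<Otimes>\<^sub>M seqm) (\<lambda>x. f (?c x))"
    by (rule integrable_distr[OF measurable_cons2]) (unfold distr_case_nat2, rule f)
  then have i: "integrable ((expm \<Otimes>\<^sub>M expm) \<Otimes>\<^sub>M seqm) (\<lambda>(p, e). f (cons2 p e))"
    by (simp add: case_prod_beta')
  have "integral\<^sup>L seqm f = integral\<^sup>L (distr ((expm \<Otimes>\<^sub>M expm) \<Otimes>\<^sub>M seqm) seqm ?c) f"
    by (simp add: distr_case_nat2)
  also have "\<dots> = (\<integral>x. f (?c x) \<partial>((expm \<Otimes>\<^sub>M expm) \<Otimes>\<^sub>M seqm))"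
    by (rule integral_distr[OF measurable_cons2]) measurable
  also have "\<dots> = (\<integral>e. \<integral>p. f (cons2 p e) \<partial>(expm \<Otimes>\<^sub>M expm) \<partial>seqm)"
    using ees.integral_snd[OF i] by (simp add: case_prod_beta')
  finally show "integral\<^sup>L seqm f =
      (\<integral>e. \<integral>p. f (cons2 p e) \<partial>(expm \<Otimes>\<^sub>M expm) \<partial>seqm)" .
  show "integrable seqm (\<lambda>e. \<integral>p. f (cons2 p e) \<partial>(expm \<Otimes>\<^sub>M expm))"
    using ees.integrable_snd[OF i] by simp
qed

lemma AE_expm_pos: "AE s in expm. s > 0"
proof -
  have "AE s in lborel. s \<noteq> (0::real)" by (rule AE_lborel_singleton)
  then have "AE s in lborel. 0 < ennreal (exponential_density 1 s) \<longrightarrow> s > 0"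
    by eventually_elim (auto simp: exponential_density_def)
  then show ?thesis unfolding expm_def by (subst AE_density) auto
qed

lemma AE_expm_countable: "countable N \<Longrightarrow> AE s in expm. s \<notin> N"
  unfolding expm_def
  by (subst AE_density, simp, rule eventually_mono[OF AE_not_in[OF countable_imp_null_set_lborel]]) auto

lemma AE_seqm_pos: "AE e in seqm. \<forall>k. e k > 0"
  unfolding AE_all_countable seqm_def
  by (intro allI AE_PiM_component expm.prob_space_axioms AE_expm_pos) auto

lemma integrable_dominated:
  fixes f g :: "'a \<Rightarrow> real"
  assumes "integrable M g" "f \<in> borel_measurable M" "\<And>x. \<bar>f x\<bar> \<le> g x"
  shows "integrable M f"
  using assms(1,2)
  by (rule Bochner_Integration.integrable_bound)
     (auto intro!: AE_I2 order_trans[OF assms(3) abs_ge_self])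

lemma expm_moment: "has_bochner_integral expm (\<lambda>s. s ^ i) (fact i)"
proof -
  have "distributed expm lborel (\<lambda>s. s) (exponential_density 1)"
    unfolding distributed_def by (auto simp: expm_def distr_id2 erlang_density_nonneg intro!: measurable_ident_sets)
  from expm.has_bochner_integral_erlang_ith_moment[OF _ this, of i] show ?thesis by simp
qed

lemma integrable_expm_power [simp]: "integrable expm (\<lambda>s. s ^ i)"
  and integral_expm_power: "(\<integral>s. s ^ i \<partial>expm) = fact i"
  using expm_moment by (auto simp: has_bochner_integral_iff)

lemma integrable_expm_ident [simp]: "integrable expm (\<lambda>s. s)" "integrable expm (\<lambda>s. \<bar>s\<bar>)"
  using integrable_expm_power[of 1] by auto

lemma integral_expm_ident [simp]: "(\<integral>s. s \<partial>expm) = 1" "(\<integral>s. \<bar>s\<bar> \<partial>expm) = 1"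
proof -
  show "(\<integral>s. s \<partial>expm) = 1" using integral_expm_power[of 1] by simp
  moreover have "(\<integral>s. \<bar>s\<bar> \<partial>expm) = (\<integral>s. s \<partial>expm)"
    using AE_expm_pos by (intro integral_cong_AE) (auto elim: eventually_mono)
  ultimately show "(\<integral>s. \<bar>s\<bar> \<partial>expm) = 1" by simp
qed

lemma integral_expm_sq [simp]: "(\<integral>s. s\<^sup>2 \<partial>expm) = 2"
  using integral_expm_power[of 2] by simp

lemma distr_component: "distr seqm expm (\<lambda>e. e k) = expm"
  unfolding seqm_def by (rule distr_PiM_component) (auto intro: expm.prob_space_axioms)

lemma
  fixes f :: "real \<Rightarrow> real"
  assumes "integrable expm f"
  shows integrable_component: "integrable seqm (\<lambda>e. f (e k))"
    and integral_component: "(\<integral>e. f (e k) \<partial>seqm) = integral\<^sup>L expm f"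
proof -
  have [measurable]: "f \<in> borel_measurable expm" using assms by auto
  show "integrable seqm (\<lambda>e. f (e k))"
    by (rule integrable_distr[OF measurable_component_seqm]) (simp add: distr_component assms)
  have "integral\<^sup>L expm f = integral\<^sup>L (distr seqm expm (\<lambda>e. e k)) f" by (simp add: distr_component)
  also have "\<dots> = (\<integral>e. f (e k) \<partial>seqm)" by (rule integral_distr) measurable
  finally show "(\<integral>e. f (e k) \<partial>seqm) = integral\<^sup>L expm f" by simp
qed

text \<open>Up to the factor C h, this dominates the logarithmic growth over \<open>n\<close> jumps
  for every sequence; it is also the reference process that controls fluctuations in the strong
  law.\<close>

definition esum :: "nat \<Rightarrow> (nat \<Rightarrow> real) \<Rightarrow> real" where
  "esum n e = (\<Sum>k<n. \<bar>e k\<bar>)"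

lemma esum_nonneg [simp]: "esum n e \<ge> 0"
  by (simp add: esum_def sum_nonneg)

lemma esum_case_nat: "esum (Suc n) (case_nat s e) = \<bar>s\<bar> + esum n e"
  unfolding esum_def by (subst sum.lessThan_Suc_shift) simp

lemma esum_measurable [measurable]: "esum n \<in> borel_measurable seqm"
  unfolding esum_def[abs_def] by measurable

lemma integrable_esum [simp]: "integrable seqm (esum n)"
  and integral_esum: "(\<integral>e. esum n e \<partial>seqm) = n"
proof -
  have i: "integrable seqm (\<lambda>e. \<bar>e k\<bar>)" for k by (rule integrable_component) simp
  then show "integrable seqm (esum n)" unfolding esum_def[abs_def] by auto
  show "(\<integral>e. esum n e \<partial>seqm) = n"
    unfolding esum_def using i integral_component[of "\<lambda>s. \<bar>s\<bar>"] by (subst Bochner_Integration.integral_sum) auto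
qed

lemma integrable_esum_sq [simp]: "integrable seqm (\<lambda>e. (esum n e)\<^sup>2)"
  and integral_esum_sq: "(\<integral>e. (esum n e)\<^sup>2 \<partial>seqm) \<le> 2 * (real n)\<^sup>2"
proof -
  have i: "integrable seqm (\<lambda>e. (e k)\<^sup>2)" for k by (rule integrable_component) simp
  have le: "(esum n e)\<^sup>2 \<le> (\<Sum>k<n. (e k)\<^sup>2) * n" for e
    using sum_squared_le_sum_of_squares[of "\<lambda>k. \<bar>e k\<bar>" "{..<n}"] unfolding esum_def by simp
  have j: "integrable seqm (\<lambda>e. (\<Sum>k<n. (e k)\<^sup>2) * n)" using i by auto
  show k: "integrable seqm (\<lambda>e. (esum n e)\<^sup>2)"
    by (rule Bochner_Integration.integrable_bound[OF j]) (use le in \<open>auto intro: order_trans abs_ge_self\<close>)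
  have "(\<integral>e. (esum n e)\<^sup>2 \<partial>seqm) \<le> (\<integral>e. (\<Sum>k<n. (e k)\<^sup>2) * n \<partial>seqm)"
    by (rule integral_mono[OF k j le])
  also have "\<dots> = (\<Sum>k<n. 2) * n"
    using i integral_component[of "\<lambda>s. s\<^sup>2"] by (simp add: Bochner_Integration.integral_sum)
  finally show "(\<integral>e. (esum n e)\<^sup>2 \<partial>seqm) \<le> 2 * (real n)\<^sup>2" by (simp add: power2_eq_square)
qed

section \<open>A strong law for martingale increments along a chain driven by independent
  exponential variables\<close>

primrec state :: "('z \<Rightarrow> real \<Rightarrow> 'z) \<Rightarrow> nat \<Rightarrow> 'z \<Rightarrow> (nat \<Rightarrow> real) \<Rightarrow> 'z" where
  "state F 0 z e = z"
| "state F (Suc n) z e = F (state F n z e) (e n)"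

lemma state_case_nat: "state F (Suc n) z (case_nat s e) = state F n (F z s) e"
  by (induction n) auto

lemma state_measurable [measurable]:
  assumes [measurable]: "(\<lambda>(z, s). F z s) \<in> Z \<Otimes>\<^sub>M borel \<rightarrow>\<^sub>M Z"
  shows "(\<lambda>(z, e). state F n z e) \<in> Z \<Otimes>\<^sub>M seqm \<rightarrow>\<^sub>M Z"
proof (induction n)
  case (Suc n)
  then have [measurable]: "(\<lambda>x. state F n (fst x) (snd x)) \<in> Z \<Otimes>\<^sub>M seqm \<rightarrow>\<^sub>M Z"
    by (simp add: case_prod_beta')
  have [measurable]: "(\<lambda>x::'a \<times> (nat \<Rightarrow> real). snd x n) \<in> Z \<Otimes>\<^sub>M seqm \<rightarrow>\<^sub>M borel"
    using measurable_compose[OF measurable_snd measurable_component_seqm]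
    by (simp add: measurable_cong_sets[OF refl sets_expm])
  have "(\<lambda>x. (state F n (fst x) (snd x), snd x n)) \<in> Z \<Otimes>\<^sub>M seqm \<rightarrow>\<^sub>M Z \<Otimes>\<^sub>M borel"
    by measurable
  from measurable_compose[OF this assms] show ?case by (simp add: case_prod_beta')
qed (simp add: case_prod_beta')

text \<open>Between consecutive squares \<open>Q\<close> moves by at most C times the gap plus the
  increment of \<open>W\<close>. The gap is 2 r + 1 = o(r^2), and the increment of \<open>W\<close>
  is o(r^2) because \<open>W\<close> divided by its index converges along the squares. In the
  application \<open>W\<close> is \<open>esum\<close>.\<close>

lemma square_interpolation:
  fixes Q W :: "nat \<Rightarrow> real"
  assumes W: "(\<lambda>n. W ((Suc n)\<^sup>2) / (Suc n)\<^sup>2) \<longlonglongrightarrow> c" "mono W"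
    and Q: "(\<lambda>n. Q ((Suc n)\<^sup>2) / (Suc n)\<^sup>2) \<longlonglongrightarrow> 0"
    and QW: "\<And>j k. j \<le> k \<Longrightarrow> \<bar>Q k - Q j\<bar> \<le> C * (real k - real j + W k - W j)"
    and C: "C \<ge> 0"
  shows "(\<lambda>n. Q n / n) \<longlonglongrightarrow> 0"
proof -
  \<comment> \<open>This bounds the quotient for all n with integer square root r. The ratio of
    consecutive squares is kept as a separate factor so that the two \<open>W\<close> terms visibly
    have the same limit \<open>c\<close>.\<close>
  define b where "b r = \<bar>Q (r\<^sup>2) / (real r)\<^sup>2\<bar> + C * ((2 * real r + 1) / (real r)\<^sup>2
      + (W ((Suc r)\<^sup>2) / (real (Suc r))\<^sup>2 * ((real (Suc r))\<^sup>2 / (real r)\<^sup>2) - W (r\<^sup>2) / (real r)\<^sup>2))" for r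
  have Q': "(\<lambda>r. Q (r\<^sup>2) / (real r)\<^sup>2) \<longlonglongrightarrow> 0" and W': "(\<lambda>r. W (r\<^sup>2) / (real r)\<^sup>2) \<longlonglongrightarrow> c"
    using Q W(1) filterlim_sequentially_Suc[of "\<lambda>r. Q (r\<^sup>2) / (real r)\<^sup>2"]
      filterlim_sequentially_Suc[of "\<lambda>r. W (r\<^sup>2) / (real r)\<^sup>2"] by auto
  have W'': "(\<lambda>r. W ((Suc r)\<^sup>2) / (real (Suc r))\<^sup>2) \<longlonglongrightarrow> c" using W(1) by simp
  have r: "(\<lambda>r. (2 * real r + 1) / (real r)\<^sup>2) \<longlonglongrightarrow> 0" "(\<lambda>r. (real (Suc r))\<^sup>2 / (real r)\<^sup>2) \<longlonglongrightarrow> 1"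
    by real_asymp+
  have "b \<longlonglongrightarrow> \<bar>0\<bar> + C * (0 + (c * 1 - c))"
    unfolding b_def by (intro tendsto_intros Q' W' W'' r)
  then have b: "b \<longlonglongrightarrow> 0" by simp
  have le: "\<bar>Q n / n\<bar> \<le> b (floor_sqrt n)" if n: "n > 0" for n
  proof -
    define r where "r = floor_sqrt n"
    have r: "r\<^sup>2 \<le> n" "n < (Suc r)\<^sup>2" by (simp_all add: r_def Suc_floor_sqrt_power2_gt)
    have r0: "r > 0" using n by (auto simp: r_def intro: Nat.gr0I)
    have "\<bar>Q n\<bar> \<le> \<bar>Q (r\<^sup>2)\<bar> + C * (real n - real (r\<^sup>2) + W n - W (r\<^sup>2))"
      using QW[OF r(1)] by linarith
    also have "\<dots> \<le> \<bar>Q (r\<^sup>2)\<bar> + C * ((2 * real r + 1) + W ((Suc r)\<^sup>2) - W (r\<^sup>2))"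
    proof -
      have "real n \<le> real ((Suc r)\<^sup>2)" using r by linarith
      then have "real n - real (r\<^sup>2) \<le> 2 * real r + 1" by (simp add: power2_eq_square algebra_simps)
      moreover have "W n \<le> W ((Suc r)\<^sup>2)" using r W(2) by (simp add: monoD)
      ultimately show ?thesis using C by (intro add_left_mono mult_left_mono) auto
    qed
    also have "\<dots> = b r * (real r)\<^sup>2"
    proof -
      have "W ((Suc r)\<^sup>2) / (real (Suc r))\<^sup>2 * ((real (Suc r))\<^sup>2 / (real r)\<^sup>2) = W ((Suc r)\<^sup>2) / (real r)\<^sup>2"
        using of_nat_neq_0[of r, where 'a=real] by (simp del: of_nat_Suc)
      then show ?thesis unfolding b_def using r0
        by (simp add: distrib_right right_diff_distrib diff_divide_distrib add_divide_distrib abs_divide algebra_simps)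
    qed
    finally have *: "\<bar>Q n\<bar> \<le> b r * (real r)\<^sup>2" .
    then have "0 \<le> b r * (real r)\<^sup>2" by linarith
    then have "b r \<ge> 0" using r0 by (simp add: zero_le_mult_iff)
    moreover have "(real r)\<^sup>2 \<le> real n" using r(1) by (metis of_nat_le_iff of_nat_power)
    ultimately have "\<bar>Q n\<bar> \<le> b r * real n" using * by (meson mult_left_mono order_trans)
    then show ?thesis using n by (simp add: r_def field_simps)
  qed
  have fs: "filterlim floor_sqrt sequentially sequentially"
    unfolding filterlim_at_top eventually_sequentially
    by (metis floor_sqrt_inverse_power2 mono_floor_sqrt')
  show ?thesis
  proof (rule tendsto_rabs_zero_cancel, rule tendsto_sandwich[OF _ _ tendsto_const])
    show "(\<lambda>n. b (floor_sqrt n)) \<longlonglongrightarrow> 0" by (rule filterlim_compose[OF b fs])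
    show "\<forall>\<^sub>F n in sequentially. \<bar>Q n / n\<bar> \<le> b (floor_sqrt n)"
      using eventually_gt_at_top[of 0] by eventually_elim (rule le)
  qed simp
qed

lemma ennreal_sq_sum_tendsto_0:
  fixes f :: "nat \<Rightarrow> real"
  assumes "(\<Sum>n. ennreal ((f n)\<^sup>2)) \<noteq> \<infinity>"
  shows "f \<longlonglongrightarrow> 0"
proof -
  have "summable (\<lambda>n. (f n)\<^sup>2)"
    by (rule summable_suminf_not_top) (use assms in auto)
  then have "(\<lambda>n. sqrt ((f n)\<^sup>2)) \<longlonglongrightarrow> sqrt 0" by (intro tendsto_real_sqrt summable_LIMSEQ_zero)
  then show ?thesis by (simp add: tendsto_rabs_zero_iff)
qed

text \<open>The martingale property is expressed without a filtration: from every state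
  \<open>z\<close>, the increment has mean zero over the next exponential variable. It is used three
  times: with a one-point state space, for the alternating discrete state, and for the vector
  together with the discrete state.\<close>

locale martingale_increment =
  fixes F :: "'z \<Rightarrow> real \<Rightarrow> 'z" and Z :: "'z measure" and D :: "'z \<Rightarrow> real \<Rightarrow> real" and C :: real
  assumes F_meas [measurable]: "(\<lambda>(z, s). F z s) \<in> Z \<Otimes>\<^sub>M borel \<rightarrow>\<^sub>M Z"
    and D_meas: "(\<lambda>(z, s). D z s) \<in> borel_measurable (Z \<Otimes>\<^sub>M borel)"
    and Z_space: "space Z = UNIV"
    and C_nonneg: "C \<ge> 0"
    and D_bound: "\<And>z s. \<bar>D z s\<bar> \<le> C * (1 + \<bar>s\<bar>)"
    and D_mean: "\<And>z. (\<integral>s. D z s \<partial>expm) = 0"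
begin

definition Q :: "nat \<Rightarrow> 'z \<Rightarrow> (nat \<Rightarrow> real) \<Rightarrow> real" where
  "Q n z e = (\<Sum>k<n. D (state F k z e) (e k))"

lemma Q_case_nat: "Q (Suc n) z (case_nat s e) = D z s + Q n (F z s) e"
  unfolding Q_def
  by (subst sum.lessThan_Suc_shift) (simp add: state_case_nat del: state.simps(2))

lemma Q_diff: "j \<le> k \<Longrightarrow> \<bar>Q k z e - Q j z e\<bar> \<le> C * (real k - real j + esum k e - esum j e)"
proof (induction rule: dec_induct)
  case (step n)
  have "\<bar>D (state F n z e) (e n)\<bar> \<le> C * (1 + \<bar>e n\<bar>)" by (rule D_bound)
  moreover have "Q (Suc n) z e = Q n z e + D (state F n z e) (e n)" by (simp add: Q_def)
  moreover have "C * (real (Suc n) - real j + esum (Suc n) e - esum j e)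
      = C * (real n - real j + esum n e - esum j e) + C * (1 + \<bar>e n\<bar>)"
    by (simp add: esum_def algebra_simps)
  ultimately show ?case using step.IH by linarith
qed simp

lemma Q_bound: "\<bar>Q n z e\<bar> \<le> C * (real n + esum n e)"
  using Q_diff[of 0 n z e] by (simp add: Q_def esum_def)

lemma D_meas' [measurable]: "D z \<in> borel_measurable expm"
proof -
  have "(\<lambda>s. (z, s)) \<in> borel \<rightarrow>\<^sub>M Z \<Otimes>\<^sub>M borel" using Z_space by simp
  from measurable_compose[OF this D_meas] show ?thesis by (simp add: expm_def)
qed

lemma Q_meas [measurable]: "Q n z \<in> borel_measurable seqm"
proof -
  have s: "state F k z \<in> seqm \<rightarrow>\<^sub>M Z" for k
  proof -
    have "(\<lambda>e. (z, e)) \<in> seqm \<rightarrow>\<^sub>M Z \<Otimes>\<^sub>M seqm" using Z_space by simp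
    from measurable_compose[OF this state_measurable[OF F_meas]] show ?thesis by simp
  qed
  have [measurable]: "(\<lambda>e. D (state F k z e) (e k)) \<in> borel_measurable seqm" for k
  proof -
    have "(\<lambda>e. (state F k z e, e k)) \<in> seqm \<rightarrow>\<^sub>M Z \<Otimes>\<^sub>M expm" by (intro measurable_Pair s measurable_component_seqm)
    then have "(\<lambda>e. (state F k z e, e k)) \<in> seqm \<rightarrow>\<^sub>M Z \<Otimes>\<^sub>M borel" by (simp cong: measurable_cong_sets)
    from measurable_compose[OF this D_meas] show ?thesis by simp
  qed
  show ?thesis unfolding Q_def[abs_def] by measurable
qed

lemma Q_integrable [simp]: "integrable seqm (Q n z)"
by (rule integrable_dominated[of _ "\<lambda>e. C * (real n + esum n e)"])
     (simp, measurable, rule Q_bound)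

lemma Q_sq_integrable [simp]: "integrable seqm (\<lambda>e. (Q n z e)\<^sup>2)"
proof (rule Bochner_Integration.integrable_bound)
  have "integrable seqm (\<lambda>e. C\<^sup>2 * ((real n)\<^sup>2 + 2 * real n * esum n e + (esum n e)\<^sup>2))" by simp
  then show "integrable seqm (\<lambda>e. (C * (real n + esum n e))\<^sup>2)"
    by (simp add: power_mult_distrib power2_sum algebra_simps)
  show "AE e in seqm. norm ((Q n z e)\<^sup>2) \<le> norm ((C * (real n + esum n e))\<^sup>2)"
  proof (rule AE_I2)
    fix e
    have "(Q n z e)\<^sup>2 \<le> (C * (real n + esum n e))\<^sup>2"
      using Q_bound[of n z e] by (metis abs_le_square_iff abs_ge_self order_trans)
    then show "norm ((Q n z e)\<^sup>2) \<le> norm ((C * (real n + esum n e))\<^sup>2)" by simp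
  qed
qed measurable

lemma D_integrable [simp]: "integrable expm (D z)"
by (rule integrable_dominated[of _ "\<lambda>s. C * (1 + \<bar>s\<bar>)"])
     (simp, measurable, rule D_bound)

lemma D_sq_le: "(D z s)\<^sup>2 \<le> C\<^sup>2 * (1 + 2 * \<bar>s\<bar> + s\<^sup>2)"
proof -
  have "(D z s)\<^sup>2 \<le> (C * (1 + \<bar>s\<bar>))\<^sup>2"
    using D_bound[of z s] by (metis abs_le_square_iff abs_ge_self order_trans)
  also have "\<dots> = C\<^sup>2 * (1 + 2 * \<bar>s\<bar> + s\<^sup>2)"
    by (simp add: power_mult_distrib power2_sum)
  finally show ?thesis .
qed

lemma D_sq_integrable [simp]: "integrable expm (\<lambda>s. (D z s)\<^sup>2)"
by (rule integrable_dominated[of _ "\<lambda>s. C\<^sup>2 * (1 + 2 * \<bar>s\<bar> + s\<^sup>2)"])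
     (simp, measurable, unfold abs_power2, rule D_sq_le)

text \<open>The factor 5 is the expectation of (1 + s)^2 = 1 + 2 s + s^2 for a unit exponential s,
  that is 1 + 2 + 2.\<close>

lemma D_sq_integral: "(\<integral>s. (D z s)\<^sup>2 \<partial>expm) \<le> 5 * C\<^sup>2"
proof -
  have "(\<integral>s. (D z s)\<^sup>2 \<partial>expm) \<le> (\<integral>s. C\<^sup>2 * (1 + 2 * \<bar>s\<bar> + s\<^sup>2) \<partial>expm)"
    by (intro integral_mono D_sq_le) auto
  then show ?thesis by simp
qed

lemma Q_mean: "(\<integral>e. Q n z e \<partial>seqm) = 0"
proof (induction n arbitrary: z)
  case (Suc n)
  have "(\<integral>e. Q (Suc n) z e \<partial>seqm) = (\<integral>s. \<integral>e. D z s + Q n (F z s) e \<partial>seqm \<partial>expm)"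
    using integral_case_nat[OF Q_integrable, of "Suc n" z] by (simp add: Q_case_nat)
  also have "\<dots> = (\<integral>s. D z s \<partial>expm)"
    using Suc.IH by (simp add: seqm.prob_space)
  finally show ?case by (simp add: D_mean)
qed (simp add: Q_def[abs_def])

text \<open>Increments are orthogonal: given the first variable, the remaining sum has mean zero
  from whatever state it starts in, so the mixed term vanishes and second moments add up.\<close>

lemma Q_variance: "(\<integral>e. (Q n z e)\<^sup>2 \<partial>seqm) \<le> n * (5 * C\<^sup>2)"
proof (induction n arbitrary: z)
  case (Suc n)
  have *: "(\<integral>e. (Q (Suc n) z (case_nat s e))\<^sup>2 \<partial>seqm) = (D z s)\<^sup>2 + (\<integral>e. (Q n (F z s) e)\<^sup>2 \<partial>seqm)" for s
  proof -
    have "(\<integral>e. (Q (Suc n) z (case_nat s e))\<^sup>2 \<partial>seqm)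
        = (\<integral>e. (D z s)\<^sup>2 + 2 * D z s * Q n (F z s) e + (Q n (F z s) e)\<^sup>2 \<partial>seqm)"
      by (simp add: Q_case_nat power2_sum algebra_simps)
    also have "\<dots> = (D z s)\<^sup>2 + (\<integral>e. (Q n (F z s) e)\<^sup>2 \<partial>seqm)"
      by (simp add: Q_mean seqm.prob_space)
    finally show ?thesis .
  qed
  have "(\<integral>e. (Q (Suc n) z e)\<^sup>2 \<partial>seqm) = (\<integral>s. \<integral>e. (Q (Suc n) z (case_nat s e))\<^sup>2 \<partial>seqm \<partial>expm)"
    by (rule integral_case_nat) simp
  also have "\<dots> \<le> (\<integral>s. (D z s)\<^sup>2 + n * (5 * C\<^sup>2) \<partial>expm)"
  proof (rule integral_mono)
    show "integrable expm (\<lambda>s. \<integral>e. (Q (Suc n) z (case_nat s e))\<^sup>2 \<partial>seqm)"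
      by (rule integrable_outer_case_nat) simp
    show "(\<integral>e. (Q (Suc n) z (case_nat s e))\<^sup>2 \<partial>seqm) \<le> (D z s)\<^sup>2 + n * (5 * C\<^sup>2)" for s
      unfolding * using Suc.IH by simp
  qed simp
  also have "\<dots> \<le> 5 * C\<^sup>2 + n * (5 * C\<^sup>2)"
    using D_sq_integral[of z] by (simp add: expm.prob_space)
  finally show ?case by (simp add: algebra_simps)
qed (simp add: Q_def)

text \<open>Along the squares the second moments are of order 1/n^2 and hence summable; the series
  of squares then has finite expectation, so it converges almost surely and its terms tend to
  0.\<close>

lemma Q_squares: "AE e in seqm. (\<lambda>n. Q ((Suc n)\<^sup>2) z e / (Suc n)\<^sup>2) \<longlonglongrightarrow> 0"
proof -
  have i: "(\<integral>\<^sup>+e. ennreal ((Q ((Suc n)\<^sup>2) z e / (Suc n)\<^sup>2)\<^sup>2) \<partial>seqm) \<le> ennreal (5 * C\<^sup>2 * (1 / (Suc n)\<^sup>2))" for n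
  proof -
    have "(\<integral>\<^sup>+e. ennreal ((Q ((Suc n)\<^sup>2) z e / (Suc n)\<^sup>2)\<^sup>2) \<partial>seqm)
      = ennreal (\<integral>e. (Q ((Suc n)\<^sup>2) z e / (Suc n)\<^sup>2)\<^sup>2 \<partial>seqm)"
      by (rule nn_integral_eq_integral) (auto simp: power_divide)
    also have "(\<integral>e. (Q ((Suc n)\<^sup>2) z e / (Suc n)\<^sup>2)\<^sup>2 \<partial>seqm) \<le> real ((Suc n)\<^sup>2) * (5 * C\<^sup>2) / (real ((Suc n)\<^sup>2))\<^sup>2"
      using Q_variance[of "(Suc n)\<^sup>2" z] by (simp add: power_divide divide_right_mono)
    also have "real ((Suc n)\<^sup>2) * (5 * C\<^sup>2) / (real ((Suc n)\<^sup>2))\<^sup>2 = 5 * C\<^sup>2 * (1 / (Suc n)\<^sup>2)"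
      by (simp add: power2_eq_square)
    finally show ?thesis by (simp add: ennreal_leI)
  qed
  have "(\<integral>\<^sup>+e. (\<Sum>n. ennreal ((Q ((Suc n)\<^sup>2) z e / (Suc n)\<^sup>2)\<^sup>2)) \<partial>seqm)
    = (\<Sum>n. \<integral>\<^sup>+e. ennreal ((Q ((Suc n)\<^sup>2) z e / (Suc n)\<^sup>2)\<^sup>2) \<partial>seqm)"
    by (rule nn_integral_suminf) measurable
  also have "\<dots> \<le> (\<Sum>n. ennreal (5 * C\<^sup>2 * (1 / (Suc n)\<^sup>2)))"
    by (intro suminf_le i) auto
  also have "\<dots> < \<infinity>"
  proof -
    have "summable (\<lambda>n. 1 / (real (Suc n))\<^sup>2)"
      using inverse_power_summable[of 2, where 'a=real] by (subst summable_Suc_iff) (simp add: inverse_eq_divide)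
    then have "summable (\<lambda>n. 5 * C\<^sup>2 * (1 / (Suc n)\<^sup>2))" by (intro summable_mult) simp
    then have "(\<Sum>n. ennreal (5 * C\<^sup>2 * (1 / (Suc n)\<^sup>2))) = ennreal (\<Sum>n. 5 * C\<^sup>2 * (1 / (Suc n)\<^sup>2))"
      by (intro suminf_ennreal2) auto
    then show ?thesis by simp
  qed
  finally have "(\<integral>\<^sup>+e. (\<Sum>n. ennreal ((Q ((Suc n)\<^sup>2) z e / (Suc n)\<^sup>2)\<^sup>2)) \<partial>seqm) \<noteq> \<infinity>"
    by (rule less_imp_neq)
  then have "AE e in seqm. (\<Sum>n. ennreal ((Q ((Suc n)\<^sup>2) z e / (Suc n)\<^sup>2)\<^sup>2)) \<noteq> \<infinity>"
    by (rule nn_integral_noteq_infinite[rotated]) measurable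
  then show ?thesis by eventually_elim (rule ennreal_sq_sum_tendsto_0)
qed

end

text \<open>The centred absolute values are martingale increments over a one-point state space. The
  result along squares is exactly what \<open>square_interpolation\<close> needs to treat every
  other instance, so there is no circularity with \<open>strong_law\<close>.\<close>

lemma AE_esum_squares: "AE e in seqm. (\<lambda>n. esum ((Suc n)\<^sup>2) e / (Suc n)\<^sup>2) \<longlonglongrightarrow> 1"
proof -
  interpret martingale_increment "\<lambda>(z::unit) (s::real). z" "count_space UNIV" "\<lambda>z s. \<bar>s\<bar> - 1" 1
    by standard (auto simp: expm.prob_space)
  have Q: "Q n () e = esum n e - n" for n e
    unfolding Q_def esum_def by (simp add: sum_subtractf)
  have d: "(esum ((Suc n)\<^sup>2) e - real ((Suc n)\<^sup>2)) / real ((Suc n)\<^sup>2) + 1 = esum ((Suc n)\<^sup>2) e / (Suc n)\<^sup>2" for n e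
    by (simp add: diff_divide_distrib)
  show ?thesis using Q_squares[of "()"]
  proof eventually_elim
    case (elim e)
    from tendsto_add[OF elim[unfolded Q] tendsto_const[of 1]] show ?case unfolding d by simp
  qed
qed

theorem (in martingale_increment) strong_law:
  "AE e in seqm. (\<lambda>n. (\<Sum>k<n. D (state F k z e) (e k)) / n) \<longlonglongrightarrow> 0"
  using Q_squares[of z] AE_esum_squares
proof eventually_elim
  case (elim e)
  have "mono (\<lambda>n. esum n e)" by (intro monoI) (auto simp: esum_def intro!: sum_mono2)
  from square_interpolation[OF elim(2) this elim(1) Q_diff C_nonneg]
  show ?case by (simp add: Q_def)
qed

section \<open>The Lyapunov exponent of the jump chain\<close>

lemma bounded_bilinear_matrix_vector: "bounded_bilinear ((*v) :: real^2^2 \<Rightarrow> real^2 \<Rightarrow> real^2)"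
proof (rule bilinear_conv_bounded_bilinear[THEN iffD1])
  have "linear (\<lambda>M::real^2^2. M *v x)" for x :: "real^2"
    using bounded_linear_matrix_vector[of x] by (simp add: linear_conv_bounded_linear)
  moreover have "linear (\<lambda>x. M *v x)" for M :: "real^2^2"
    by simp
  ultimately show "bilinear ((*v) :: real^2^2 \<Rightarrow> real^2 \<Rightarrow> real^2)" by (auto simp: bilinear_def)
qed

lemma continuous_flow_pair:
  "continuous_on UNIV (\<lambda>p. flow M (fst p) *v snd p)"
  by (intro bounded_bilinear.continuous_on[OF bounded_bilinear_matrix_vector] continuous_intros
      continuous_on_compose2[OF continuous_flow[of UNIV]]) auto

lemma jump_chain_Suc: "jump_chain i (Suc n) = jump_chain (1 - i) n"
  unfolding jump_chain_def by (simp add: funpow_swap1)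

lemma jump_chain_Suc': "jump_chain i (Suc n) = 1 - jump_chain i n"
  unfolding jump_chain_def by simp

lemma jump_chain_0 [simp]: "jump_chain i 0 = i"
  by (simp add: jump_chain_def)

lemma jump_chain_double: "jump_chain i (2 * n) = i"
  by (induction n) (simp_all add: jump_chain_Suc')

locale switched =
  fixes A :: "2 \<Rightarrow> real^2^2" and lam \<beta> C :: real
  assumes lam: "0 < lam" "lam < 1" and beta: "0 < \<beta>"
    and C_pos: "0 < C" and C_bound: "\<And>i x. norm (A i *v x) \<le> C * norm x"
begin

definition rate :: "2 \<Rightarrow> real" where "rate i = \<beta> * switch_weight lam i"

lemma rate_pos: "rate i > 0"
  using lam beta by (auto simp: rate_def switch_weight_def)

text \<open>Mean duration of a cycle: the two mean holding times are \<open>h * (1 - lam)\<close>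
  and \<open>h * lam\<close>. It is the small parameter of fast switching.\<close>

definition h :: real where "h = 1 / (\<beta> * lam * (1 - lam))"

lemma h_pos: "h > 0" using lam beta by (simp add: h_def)

lemma rate_0: "1 / rate 0 = h * (1 - lam)" and rate_1: "1 / rate 1 = h * lam"
  using lam beta by (simp_all add: rate_def h_def switch_weight_def field_simps)

lemma rate_le_h: "1 / rate i \<le> h"
  using two_cases[of i] rate_0 rate_1 lam h_pos by (auto simp: mult_le_cancel_left1)

text \<open>Taking absolute values makes the bounds below valid everywhere; exponential variables are
  nonnegative almost surely.\<close>

definition step :: "(real^2) \<times> 2 \<Rightarrow> real \<Rightarrow> (real^2) \<times> 2" where
  "step z s = (flow (A (snd z)) (\<bar>s\<bar> / rate (snd z)) *v fst z, 1 - snd z)"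

abbreviation Z :: "((real^2) \<times> 2) measure" where "Z \<equiv> borel \<Otimes>\<^sub>M count_space UNIV"

lemma step_measurable [measurable]: "(\<lambda>(z, s). step z s) \<in> Z \<Otimes>\<^sub>M borel \<rightarrow>\<^sub>M Z"
proof -
  have g: "(\<lambda>p. flow (A i) (\<bar>snd p\<bar> / rate i) *v fst (fst p)) \<in> borel_measurable (Z \<Otimes>\<^sub>M borel)" for i
    by (rule borel_measurable_continuous_Pair[OF _ _ continuous_flow_pair]) measurable
  have "(\<lambda>p. if snd (fst p) = 0 then flow (A 0) (\<bar>snd p\<bar> / rate 0) *v fst (fst p)
      else flow (A 1) (\<bar>snd p\<bar> / rate 1) *v fst (fst p)) \<in> borel_measurable (Z \<Otimes>\<^sub>M borel)"
    by (intro measurable_If g) measurable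
  also have "(\<lambda>p. if snd (fst p) = 0 then flow (A 0) (\<bar>snd p\<bar> / rate 0) *v fst (fst p)
      else flow (A 1) (\<bar>snd p\<bar> / rate 1) *v fst (fst p)) =
      (\<lambda>p. flow (A (snd (fst p))) (\<bar>snd p\<bar> / rate (snd (fst p))) *v fst (fst p))"
    using two_cases by (intro ext) (metis (full_types))
  finally have [measurable]: "(\<lambda>p. flow (A (snd (fst p))) (\<bar>snd p\<bar> / rate (snd (fst p))) *v fst (fst p))
      \<in> borel_measurable (Z \<Otimes>\<^sub>M borel)" .
  show ?thesis unfolding step_def case_prod_beta' by measurable
qed

definition X :: "nat \<Rightarrow> (real^2) \<times> 2 \<Rightarrow> (nat \<Rightarrow> real) \<Rightarrow> real^2" where
  "X n z e = fst (state step n z e)"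

lemma X_0 [simp]: "X 0 z e = fst z" by (simp add: X_def)

lemma X_case_nat: "X (Suc n) z (case_nat s e) = X n (step z s) e"
  unfolding X_def by (simp add: state_case_nat del: state.simps(2))

lemma snd_state: "snd (state step n z e) = jump_chain (snd z) n"
  by (induction n) (simp_all add: step_def jump_chain_Suc')

lemma X_Suc: "X (Suc n) z e =
    flow (A (jump_chain (snd z) n)) (\<bar>e n\<bar> / rate (jump_chain (snd z) n)) *v X n z e"
  by (simp add: X_def step_def snd_state)

lemma X_measurable_pair [measurable]: "(\<lambda>(z, e). X n z e) \<in> borel_measurable (Z \<Otimes>\<^sub>M seqm)"
  unfolding X_def case_prod_beta'
  using measurable_compose[OF state_measurable[OF step_measurable] measurable_fst]
  by (simp add: case_prod_beta')

lemma X_measurable [measurable]: "X n z \<in> borel_measurable seqm"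
proof -
  have "(\<lambda>e. (z, e)) \<in> seqm \<rightarrow>\<^sub>M Z \<Otimes>\<^sub>M seqm" by (simp add: space_pair_measure)
  from measurable_compose[OF this X_measurable_pair] show ?thesis by simp
qed

lemma flow_ln:
  assumes "x \<noteq> 0" "s \<ge> 0"
  shows "flow (A i) s *v x \<noteq> 0" "\<bar>ln (norm (flow (A i) s *v x)) - ln (norm x)\<bar> \<le> C * s"
proof -
  have lo: "exp (- C * s) * norm x \<le> norm (flow (A i) s *v x)"
    and up: "norm (flow (A i) s *v x) \<le> exp (C * s) * norm x"
    using flow_bounds[OF C_bound assms(2)] by auto
  have p: "0 < exp (- C * s) * norm x" using assms(1) by simp
  then show nz: "flow (A i) s *v x \<noteq> 0" using lo by auto
  have "ln (exp (- C * s) * norm x) \<le> ln (norm (flow (A i) s *v x))" using p lo nz by simp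
  moreover have "ln (norm (flow (A i) s *v x)) \<le> ln (exp (C * s) * norm x)" using up nz assms(1) by simp
  ultimately show "\<bar>ln (norm (flow (A i) s *v x)) - ln (norm x)\<bar> \<le> C * s"
    using assms(1) by (simp add: ln_mult abs_le_iff)
qed

definition inc :: "(real^2) \<times> 2 \<Rightarrow> real \<Rightarrow> real" where
  "inc z s = ln (norm (fst (step z s))) - ln (norm (fst z))"

lemma step_nz: "fst z \<noteq> 0 \<Longrightarrow> fst (step z s) \<noteq> 0"
  using flow_ln(1)[of "fst z" "\<bar>s\<bar> / rate (snd z)"] rate_pos[of "snd z"] by (simp add: step_def)

lemma inc_bound: "\<bar>inc z s\<bar> \<le> C * h * \<bar>s\<bar>"
proof (cases "fst z = 0")
  case False
  have "\<bar>inc z s\<bar> \<le> C * (\<bar>s\<bar> / rate (snd z))"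
    using flow_ln(2)[OF False, of "\<bar>s\<bar> / rate (snd z)" "snd z"] rate_pos[of "snd z"]
    by (simp add: inc_def step_def)
  also have "\<dots> \<le> C * (h * \<bar>s\<bar>)"
    using mult_right_mono[OF rate_le_h[of "snd z"], of "\<bar>s\<bar>"] C_pos by (intro mult_left_mono) auto
  finally show ?thesis by simp
next
  \<comment> \<open>At the origin the step stays at the origin, and the two equal logarithms cancel;
    the bound therefore holds for every state.\<close>
  case True
  then show ?thesis using C_pos h_pos by (simp add: inc_def step_def)
qed

lemma inc_measurable_pair [measurable]: "(\<lambda>(z, s). inc z s) \<in> borel_measurable (Z \<Otimes>\<^sub>M borel)"
proof -
  have [measurable]: "(\<lambda>p. step (fst p) (snd p)) \<in> Z \<Otimes>\<^sub>M borel \<rightarrow>\<^sub>M Z"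
    using step_measurable by (simp add: case_prod_beta')
  show ?thesis unfolding inc_def case_prod_beta' by measurable
qed

lemma inc_measurable [measurable]: "inc z \<in> borel_measurable borel"
proof -
  have "(\<lambda>s. (z, s)) \<in> borel \<rightarrow>\<^sub>M Z \<Otimes>\<^sub>M borel" by (simp add: space_pair_measure)
  from measurable_compose[OF this inc_measurable_pair] show ?thesis by simp
qed

lemma step_measurable' [measurable]: "step z \<in> borel \<rightarrow>\<^sub>M Z"
proof -
  have "(\<lambda>s. (z, s)) \<in> borel \<rightarrow>\<^sub>M Z \<Otimes>\<^sub>M borel" by (simp add: space_pair_measure)
  from measurable_compose[OF this step_measurable] show ?thesis by simp
qed

lemma inc_integrable [simp]: "integrable expm (inc z)"
by (rule integrable_dominated[of _ "\<lambda>s. C * h * \<bar>s\<bar>"])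
     (simp, measurable, rule inc_bound)

definition growth :: "nat \<Rightarrow> (real^2) \<times> 2 \<Rightarrow> (nat \<Rightarrow> real) \<Rightarrow> real" where
  "growth n z e = ln (norm (X n z e)) - ln (norm (fst z))"

lemma growth_sum: "growth n z e = (\<Sum>k<n. inc (state step k z e) (e k))"
proof -
  have "(\<Sum>k<n. inc (state step k z e) (e k)) = (\<Sum>k<n. ln (norm (X (Suc k) z e)) - ln (norm (X k z e)))"
    by (simp add: inc_def X_def)
  also have "\<dots> = growth n z e" by (subst sum_lessThan_telescope) (simp add: growth_def)
  finally show ?thesis by simp
qed

lemma growth_case_nat: "growth (Suc n) z (case_nat s e) = inc z s + growth n (step z s) e"
  by (simp add: growth_def inc_def X_case_nat)

lemma growth_bound: "\<bar>growth n z e\<bar> \<le> C * h * esum n e"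
proof -
  have "\<bar>growth n z e\<bar> \<le> (\<Sum>k<n. \<bar>inc (state step k z e) (e k)\<bar>)" unfolding growth_sum by (rule sum_abs)
  also have "\<dots> \<le> (\<Sum>k<n. C * h * \<bar>e k\<bar>)" by (intro sum_mono inc_bound)
  finally show ?thesis by (simp add: esum_def sum_distrib_left)
qed

lemma growth_measurable_pair: "(\<lambda>(z, e). growth n z e) \<in> borel_measurable (Z \<Otimes>\<^sub>M seqm)"
proof -
  have [measurable]: "(\<lambda>p. X n (fst p) (snd p)) \<in> borel_measurable (Z \<Otimes>\<^sub>M seqm)"
    using X_measurable_pair by (simp add: case_prod_beta')
  show ?thesis unfolding growth_def case_prod_beta' by measurable
qed

lemma growth_measurable [measurable]: "growth n z \<in> borel_measurable seqm"
  unfolding growth_def[abs_def] by measurable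

lemma growth_integrable [simp]: "integrable seqm (growth n z)"
by (rule integrable_dominated[of _ "\<lambda>e. C * h * esum n e"])
     (simp, measurable, rule growth_bound)

section \<open>Expected logarithmic growth and the rate per jump\<close>

definition \<psi> :: "nat \<Rightarrow> (real^2) \<times> 2 \<Rightarrow> real" where
  "\<psi> n z = (\<integral>e. growth n z e \<partial>seqm)"

lemma psi_0 [simp]: "\<psi> 0 z = 0" by (simp add: \<psi>_def growth_def)

lemma psi_bound: "\<bar>\<psi> n z\<bar> \<le> C * h * n"
proof -
  have "\<bar>\<psi> n z\<bar> \<le> (\<integral>e. \<bar>growth n z e\<bar> \<partial>seqm)" unfolding \<psi>_def by (rule integral_abs_bound)
  also have "\<dots> \<le> (\<integral>e. C * h * esum n e \<partial>seqm)"
    by (intro integral_mono growth_bound) auto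
  finally show ?thesis by (simp add: integral_esum)
qed

lemma psi_measurable [measurable]: "\<psi> n \<in> borel_measurable Z"
  unfolding \<psi>_def[abs_def] using growth_measurable_pair by (rule seqm.borel_measurable_lebesgue_integral)

lemma psi_step_integrable [simp]: "integrable expm (\<lambda>s. \<psi> n (step z s))"
  by (rule expm.integrable_const_bound[of _ "C * h * n"]) (use psi_bound in auto)

lemma psi_Suc: "\<psi> (Suc n) z = (\<integral>s. inc z s \<partial>expm) + (\<integral>s. \<psi> n (step z s) \<partial>expm)"
proof -
  have "\<psi> (Suc n) z = (\<integral>s. \<integral>e. inc z s + growth n (step z s) e \<partial>seqm \<partial>expm)"
    unfolding \<psi>_def using integral_case_nat[OF growth_integrable, of "Suc n" z] by (simp add: growth_case_nat)
  also have "\<dots> = (\<integral>s. inc z s + \<psi> n (step z s) \<partial>expm)"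
    by (simp add: \<psi>_def)
  finally show ?thesis by simp
qed

text \<open>The lower bound on \<open>\<psi> m\<close> is inserted at the state reached after
  \<open>n\<close> jumps, by the recursion \<open>psi_Suc\<close>. The discrete state after
  \<open>n\<close> jumps is deterministic, so the bound may be restricted to starting states in
  \<open>J\<close>; for fast switching it is available only from state 0.\<close>

lemma psi_add_ge:
  assumes "\<And>z. fst z \<noteq> 0 \<Longrightarrow> snd z \<in> J \<Longrightarrow> b \<le> \<psi> m z" "fst z \<noteq> 0" "jump_chain (snd z) n \<in> J"
  shows "\<psi> n z + b \<le> \<psi> (n + m) z"
  using assms(2,3)
proof (induction n arbitrary: z)
  case (Suc n)
  have "(\<integral>s. \<psi> n (step z s) + b \<partial>expm) \<le> (\<integral>s. \<psi> (n + m) (step z s) \<partial>expm)"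
  proof (rule integral_mono)
    have "jump_chain (snd (step z s)) n \<in> J" for s
      using Suc.prems(2) by (simp add: step_def jump_chain_Suc)
    then show "\<psi> n (step z s) + b \<le> \<psi> (n + m) (step z s)" for s
      by (intro Suc.IH step_nz Suc.prems(1))
  qed auto
  then show ?case by (simp add: psi_Suc)
qed (use assms(1) in auto)

lemma psi_mult_ge:
  assumes "\<And>z. fst z \<noteq> 0 \<Longrightarrow> snd z \<in> J \<Longrightarrow> b \<le> \<psi> m z"
    and "\<And>i k. i \<in> J \<Longrightarrow> jump_chain i (k * m) \<in> J" "fst z \<noteq> 0" "snd z \<in> J"
  shows "real k * b \<le> \<psi> (k * m) z"
proof (induction k)
  case (Suc k)
  have "\<psi> (k * m) z + b \<le> \<psi> (k * m + m) z" by (rule psi_add_ge[OF assms(1,3) assms(2)[OF assms(4)]])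
  then show ?case using Suc by (simp add: algebra_simps)
qed simp

lemma psi_add_le:
  assumes "\<And>z. fst z \<noteq> 0 \<Longrightarrow> \<psi> m z \<le> a" "fst z \<noteq> 0"
  shows "\<psi> (n + m) z \<le> \<psi> n z + a"
  using assms(2)
proof (induction n arbitrary: z)
  case (Suc n)
  have "(\<integral>s. \<psi> (n + m) (step z s) \<partial>expm) \<le> (\<integral>s. \<psi> n (step z s) + a \<partial>expm)"
    by (intro integral_mono Suc.IH step_nz Suc.prems) auto
  then show ?case by (simp add: psi_Suc)
qed (use assms(1) in auto)

lemma psi_mult_le:
  assumes "\<And>z. fst z \<noteq> 0 \<Longrightarrow> \<psi> m z \<le> a" "fst z \<noteq> 0"
  shows "\<psi> (k * m) z \<le> real k * a"
proof (induction k)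
  case (Suc k)
  have "\<psi> (k * m + m) z \<le> \<psi> (k * m) z + a" by (intro psi_add_le assms)
  then show ?case using Suc by (simp add: algebra_simps)
qed simp

definition sup_psi :: "nat \<Rightarrow> real" where "sup_psi m = (SUP z\<in>{z. fst z \<noteq> 0}. \<psi> m z)"

text \<open>The suprema are subadditive in \<open>m\<close>, so this infimum is the natural
  candidate for their normalised limit. It is a rate per jump and does not depend on the block
  length used to approximate it.\<close>

definition \<gamma> :: real where "\<gamma> = (INF m\<in>{1..}. sup_psi m / real m)"

lemma sup_psi_ge: "fst z \<noteq> 0 \<Longrightarrow> \<psi> m z \<le> sup_psi m"
  unfolding sup_psi_def
  by (rule cSUP_upper) (use psi_bound in \<open>auto intro!: bdd_aboveI2[of _ _ "C * h * m"] simp: abs_le_iff\<close>)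

lemma ex_nonzero: "\<exists>z :: (real^2) \<times> 2. fst z \<noteq> 0 \<and> snd z = i"
  by (rule exI[of _ "(axis 1 1, i)"]) (simp add: axis_eq_0_iff)

text \<open>Growth over m j jumps is counted in two ways: from below as j blocks of m jumps, and
  from above as m blocks of j jumps.\<close>

lemma gamma_lower:
  assumes "\<And>z. fst z \<noteq> 0 \<Longrightarrow> snd z \<in> J \<Longrightarrow> b \<le> \<psi> m z"
    and "\<And>i k. i \<in> J \<Longrightarrow> jump_chain i (k * m) \<in> J" "J \<noteq> {}" "m \<ge> 1"
  shows "b / m \<le> \<gamma>"
  unfolding \<gamma>_def
proof (rule cINF_greatest)
  fix j :: nat assume "j \<in> {1..}"
  then have j: "j \<ge> 1" by simp
  obtain i where "i \<in> J" using assms(3) by blast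
  then obtain z :: "(real^2) \<times> 2" where z: "fst z \<noteq> 0" "snd z \<in> J" using ex_nonzero[of i] by auto
  have "real j * b \<le> \<psi> (j * m) z" by (intro psi_mult_ge[of J] assms z)
  also have "\<dots> = \<psi> (m * j) z" by (simp add: mult.commute)
  also have "\<dots> \<le> real m * sup_psi j" by (intro psi_mult_le sup_psi_ge z)
  finally show "b / m \<le> sup_psi j / j" using j assms(4) by (simp add: field_simps)
qed simp

lemma gamma_upper:
  assumes "\<And>z. fst z \<noteq> 0 \<Longrightarrow> \<psi> m z \<le> a" "m \<ge> 1"
  shows "\<gamma> \<le> a / m"
proof -
  have "\<gamma> \<le> sup_psi m / m" unfolding \<gamma>_def
  proof (rule cINF_lower)
    show "bdd_below ((\<lambda>m. sup_psi m / real m) ` {1..})"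
    proof (rule bdd_belowI2[of _ "- (C * h)"])
      fix j :: nat assume "j \<in> {1..}"
      moreover obtain z :: "(real^2) \<times> 2" where "fst z \<noteq> 0" using ex_nonzero by blast
      ultimately show "- (C * h) \<le> sup_psi j / real j"
        using sup_psi_ge[of z j] psi_bound[of j z] by (simp add: field_simps abs_le_iff)
    qed
  qed (use assms in simp)
  also have "sup_psi m \<le> a" unfolding sup_psi_def
    by (rule cSUP_least) (use assms ex_nonzero in auto)
  finally show ?thesis using assms(2) by (simp add: divide_right_mono)
qed

text \<open>With g = (1/m) * (sum of \<open>\<psi> k\<close> over k < m), the mean of g after one
  step is g z + \<open>\<psi> m z / m\<close> minus the mean increment. Hence \<open>inc\<close>
  corrected by the variation of g and by \<open>\<psi> m z / m\<close> is a martingale increment.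
  The corrector g is bounded and telescopes, and \<open>\<psi> m z / m\<close> is within \<eta> of
  the rate.\<close>

lemma corrector_law:
  assumes m: "m \<ge> 1" and z: "fst z \<noteq> 0" and eta: "\<And>z. fst z \<noteq> 0 \<Longrightarrow> \<bar>\<psi> m z - m * \<gamma>\<bar> \<le> \<eta> * m"
  shows "AE e in seqm. \<forall>\<epsilon>>0. \<forall>\<^sub>F n in sequentially. \<bar>ln (norm (X n z e)) / n - \<gamma>\<bar> \<le> \<eta> + \<epsilon>"
proof -
  define g where "g z = (\<Sum>k<m. \<psi> k z) / m" for z
  define D where "D z s = inc z s + g (step z s) - g z - \<psi> m z / m" for z s
  have g_bound: "\<bar>g z\<bar> \<le> C * h * m" for z
  proof -
    have "\<bar>\<Sum>k<m. \<psi> k z\<bar> \<le> (\<Sum>k<m. \<bar>\<psi> k z\<bar>)" by (rule sum_abs)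
    also have "\<dots> \<le> (\<Sum>k<m. C * h * m)"
      by (intro sum_mono order_trans[OF psi_bound]) (use C_pos h_pos in auto)
    finally show ?thesis using m by (simp add: g_def field_simps)
  qed
  have g_meas [measurable]: "g \<in> borel_measurable Z" unfolding g_def[abs_def] by measurable
  interpret martingale_increment step Z D "C * h * (2 * m + 1)"
  proof
    have [measurable]: "(\<lambda>p. step (fst p) (snd p)) \<in> Z \<Otimes>\<^sub>M borel \<rightarrow>\<^sub>M Z"
      "(\<lambda>p. inc (fst p) (snd p)) \<in> borel_measurable (Z \<Otimes>\<^sub>M borel)"
      using step_measurable inc_measurable_pair by (simp_all add: case_prod_beta')
    show "(\<lambda>(z, s). D z s) \<in> borel_measurable (Z \<Otimes>\<^sub>M borel)"
      unfolding D_def case_prod_beta' by measurable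
    show "\<bar>D z s\<bar> \<le> C * h * (2 * m + 1) * (1 + \<bar>s\<bar>)" for z s
    proof -
      have "\<bar>\<psi> m z / m\<bar> \<le> C * h" using psi_bound[of m z] m by (simp add: abs_divide field_simps)
      then have "\<bar>D z s\<bar> \<le> C * h * \<bar>s\<bar> + C * h * m + C * h * m + C * h"
        unfolding D_def using inc_bound[of z s] g_bound[of z] g_bound[of "step z s"] by linarith
      also have "\<dots> \<le> C * h * (2 * m + 1) * (1 + \<bar>s\<bar>)"
        using C_pos h_pos m by (simp add: algebra_simps)
      finally show ?thesis .
    qed
    show "(\<integral>s. D z s \<partial>expm) = 0" for z
    proof -
      have gi: "integrable expm (\<lambda>s. g (step z s))" unfolding g_def by auto
      have "(\<integral>s. g (step z s) \<partial>expm) = (\<Sum>k<m. \<integral>s. \<psi> k (step z s) \<partial>expm) / m"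
        unfolding g_def by (simp add: Bochner_Integration.integral_sum)
      also have "\<dots> = (\<Sum>k<m. \<psi> (Suc k) z - (\<integral>s. inc z s \<partial>expm)) / m"
        by (simp add: psi_Suc)
      also have "\<dots> = ((\<Sum>k<m. \<psi> (Suc k) z) - m * (\<integral>s. inc z s \<partial>expm)) / m"
        by (simp add: sum_subtractf)
      \<comment> \<open>Shifting the index loses the term for k = 0, which vanishes, and gains the
        one for k = m.\<close>
      also have "(\<Sum>k<m. \<psi> (Suc k) z) = (\<Sum>k<m. \<psi> k z) + \<psi> m z"
        using sum.lessThan_Suc_shift[of "\<lambda>k. \<psi> k z" m] by simp
      finally have "(\<integral>s. g (step z s) \<partial>expm) = g z + \<psi> m z / m - (\<integral>s. inc z s \<partial>expm)"
        using m by (simp add: g_def field_simps)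
      then show ?thesis unfolding D_def using gi by simp
    qed
  qed (use C_pos h_pos step_measurable in \<open>auto simp: space_pair_measure\<close>)
  show ?thesis using strong_law[of z]
  proof eventually_elim
    case (elim e)
    define R where "R n = (\<Sum>k<n. D (state step k z e) (e k))" for n
    have nz: "fst (state step k z e) \<noteq> 0" for k by (induction k) (use z step_nz in auto)
    have R: "R n = growth n z e + g (state step n z e) - g z - (\<Sum>k<n. \<psi> m (state step k z e) / m)" for n
      unfolding R_def growth_sum by (induction n) (simp_all add: D_def)
    have S: "\<bar>(\<Sum>k<n. \<psi> m (state step k z e) / m) - n * \<gamma>\<bar> \<le> \<eta> * n" for n
    proof -
      have "\<bar>(\<Sum>k<n. \<psi> m (state step k z e) / m) - n * \<gamma>\<bar> = \<bar>\<Sum>k<n. (\<psi> m (state step k z e) - m * \<gamma>) / m\<bar>"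
        using m by (simp add: diff_divide_distrib sum_subtractf)
      also have "\<dots> \<le> (\<Sum>k<n. \<bar>(\<psi> m (state step k z e) - m * \<gamma>) / m\<bar>)" by (rule sum_abs)
      also have "\<dots> \<le> (\<Sum>k<n. \<eta>)"
        by (rule sum_mono) (use eta[OF nz] m in \<open>simp add: abs_divide field_simps\<close>)
      finally show ?thesis by (simp add: mult.commute)
    qed
    show ?case
    proof (intro allI impI)
      fix \<epsilon> :: real assume eps: "\<epsilon> > 0"
      define K where "K = 2 * (C * h * m) + \<bar>ln (norm (fst z))\<bar>"
      have "(\<lambda>n. \<bar>R n / n\<bar> + K / n) \<longlonglongrightarrow> \<bar>0\<bar> + 0"
        by (intro tendsto_intros elim[folded R_def] lim_const_over_n)
      then have "\<forall>\<^sub>F n in sequentially. \<bar>R n / n\<bar> + K / n < \<epsilon>"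
        using eps by (intro order_tendstoD(2)) auto
      then show "\<forall>\<^sub>F n in sequentially. \<bar>ln (norm (X n z e)) / n - \<gamma>\<bar> \<le> \<eta> + \<epsilon>"
        using eventually_gt_at_top[of 0]
      proof eventually_elim
        case (elim n)
        have "\<bar>ln (norm (X n z e)) - n * \<gamma>\<bar> \<le> \<bar>R n\<bar> + K + \<eta> * n"
          using R[of n] S[of n] g_bound[of z] g_bound[of "state step n z e"]
          unfolding growth_def K_def by linarith
        moreover have "\<bar>ln (norm (X n z e)) / n - \<gamma>\<bar> = \<bar>ln (norm (X n z e)) - n * \<gamma>\<bar> / n"
        proof -
          have "ln (norm (X n z e)) / n - \<gamma> = (ln (norm (X n z e)) - n * \<gamma>) / n"
            using elim(2) by (simp add: diff_divide_distrib)
          then show ?thesis by (simp add: abs_divide)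
        qed
        moreover have "(\<bar>R n\<bar> + K + \<eta> * n) / n = \<bar>R n / n\<bar> + K / n + \<eta>"
          using elim(2) by (simp add: add_divide_distrib abs_divide)
        ultimately show ?case using elim by (smt (verit) divide_right_mono of_nat_0_le_iff)
      qed
    qed
  qed
qed

text \<open>A small oscillation of \<open>\<psi> m\<close> makes each single value
  \<open>\<psi> m z' / m\<close> both an almost upper and an almost lower bound for
  \<open>\<gamma>\<close>. The block length depends on the precision, so countably many precisions
  are treated, each with its own null set.\<close>

lemma lyapunov_law:
  assumes osc: "\<And>\<eta> :: real. \<eta> > 0 \<Longrightarrow> \<exists>m\<ge>1. \<forall>z z'. fst z \<noteq> 0 \<longrightarrow> fst z' \<noteq> 0 \<longrightarrow> \<psi> m z \<le> \<psi> m z' + \<eta> * m"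
    and z: "fst z \<noteq> 0"
  shows "AE e in seqm. (\<lambda>n. ln (norm (X n z e)) / n) \<longlonglongrightarrow> \<gamma>"
proof -
  have "AE e in seqm. \<forall>\<epsilon>>0. \<forall>\<^sub>F n in sequentially. \<bar>ln (norm (X n z e)) / n - \<gamma>\<bar> \<le> inverse (real (Suc j)) + \<epsilon>" for j
  proof -
    obtain m where m: "m \<ge> 1" and o: "\<And>z z'. fst z \<noteq> 0 \<Longrightarrow> fst z' \<noteq> 0 \<Longrightarrow> \<psi> m z \<le> \<psi> m z' + inverse (real (Suc j)) * m"
      using osc[of "inverse (real (Suc j))"] by auto
    show ?thesis
    proof (rule corrector_law[OF m z])
      fix z' :: "(real^2) \<times> 2" assume z': "fst z' \<noteq> 0"
      define \<eta> where "\<eta> = inverse (real (Suc j))"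
      have "\<gamma> \<le> (\<psi> m z' + \<eta> * m) / m" unfolding \<eta>_def by (intro gamma_upper m o z')
      moreover have "(\<psi> m z' - \<eta> * m) / m \<le> \<gamma>"
      proof (rule gamma_lower[of UNIV])
        show "\<psi> m z' - \<eta> * m \<le> \<psi> m z" if "fst z \<noteq> 0" for z
          using o[OF z' that] unfolding \<eta>_def by linarith
      qed (use m in auto)
      ultimately have "\<bar>\<psi> m z' - m * \<gamma>\<bar> \<le> \<eta> * m"
        using m by (simp add: field_simps abs_le_iff)
      then show "\<bar>\<psi> m z' - m * \<gamma>\<bar> \<le> inverse (real (Suc j)) * m" unfolding \<eta>_def .
    qed
  qed
  then have "AE e in seqm. \<forall>j. \<forall>\<epsilon>>0. \<forall>\<^sub>F n in sequentially. \<bar>ln (norm (X n z e)) / n - \<gamma>\<bar> \<le> inverse (real (Suc j)) + \<epsilon>"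
    by (simp add: AE_all_countable)
  then show ?thesis
  proof eventually_elim
    case (elim e)
    show ?case
    proof (rule tendstoI)
      fix r :: real assume "r > 0"
      then obtain j where "inverse (real (Suc j)) < r / 2" using reals_Archimedean[of "r/2"] by auto
      moreover have "\<forall>\<^sub>F n in sequentially. \<bar>ln (norm (X n z e)) / n - \<gamma>\<bar> \<le> inverse (real (Suc j)) + r / 4"
        using elim \<open>r > 0\<close> by simp
      ultimately show "\<forall>\<^sub>F n in sequentially. dist (ln (norm (X n z e)) / n) \<gamma> < r"
        using \<open>r > 0\<close> by (auto elim!: eventually_mono simp: dist_real_def)
    qed
  qed
qed

end

section \<open>Dependence on the initial direction\<close>

text \<open>A zero with nonzero derivative is isolated among the zeros. By the Lindelof property
  countably many isolating neighbourhoods cover the zero set, and each contains one zero.\<close>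

lemma countable_transversal_zeros:
  fixes f f' :: "real \<Rightarrow> real"
  assumes "\<And>s. s \<in> S \<Longrightarrow> f s = 0 \<Longrightarrow> (f has_real_derivative f' s) (at s) \<and> f' s \<noteq> 0"
  shows "countable {s \<in> S. f s = 0}"
proof -
  define N where "N = {s \<in> S. f s = 0}"
  have iso: "\<exists>U. open U \<and> U \<inter> N = {s}" if s: "s \<in> N" for s
  proof -
    from s assms have d: "(f has_real_derivative f' s) (at s)" "f' s \<noteq> 0" and f0: "f s = 0" by (auto simp: N_def)
    then have "((\<lambda>y. (f y - f s) / (y - s)) \<longlongrightarrow> f' s) (at s)" by (simp add: has_field_derivative_iff)
    from tendsto_imp_eventually_ne[OF this d(2)] have "\<forall>\<^sub>F y in at s. (f y - f s) / (y - s) \<noteq> 0" .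
    then obtain U where "open U" "s \<in> U" "\<And>y. y \<in> U \<Longrightarrow> y \<noteq> s \<Longrightarrow> (f y - f s) / (y - s) \<noteq> 0"
      unfolding eventually_at_topological by auto
    then show ?thesis using f0 s by (intro exI[of _ U]) (auto simp: N_def)
  qed
  then obtain U where U: "\<And>s. s \<in> N \<Longrightarrow> open (U s)" "\<And>s. s \<in> N \<Longrightarrow> U s \<inter> N = {s}" by metis
  obtain F where F: "F \<subseteq> U ` N" "countable F" "\<Union>F = \<Union>(U ` N)"
    by (rule Lindelof[of "U ` N"]) (use U in auto)
  have "N \<subseteq> (\<lambda>V. THE s. V \<inter> N = {s}) ` F"
  proof
    fix s assume s: "s \<in> N"
    then have "s \<in> \<Union>F" using U(2)[OF s] unfolding F(3) by blast
    then obtain t where t: "t \<in> N" "U t \<in> F" "s \<in> U t" using F(1) by blast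
    then have "s = t" using U(2)[OF t(1)] s by blast
    then have "(THE r. U t \<inter> N = {r}) = s" using U(2)[OF t(1)] by auto
    then show "s \<in> (\<lambda>V. THE s. V \<inter> N = {s}) ` F" using t(2) by force
  qed
  then show ?thesis using F(2) unfolding N_def by (meson countable_image countable_subset)
qed

lemma flow_commute: "s \<ge> 0 \<Longrightarrow> M *v (flow M s *v x) = flow M s *v (M *v x)"
proof -
  assume s: "s \<ge> 0"
  have d: "((\<lambda>s. M *v (flow M s *v x)) has_vector_derivative M *v (M *v (flow M s *v x))) (at s)" for s
    by (rule bounded_linear.has_vector_derivative[OF matrix_vector_mul_bounded_linear flow_vec_deriv])
  have c: "continuous_on {0..s} (\<lambda>s. M *v (flow M s *v x))"
    by (intro continuous_at_imp_continuous_on ballI has_vector_derivative_continuous[OF d])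
  show ?thesis using linear_ode_unique[OF s c d] by simp
qed

lemma flow_eigenvector:
  assumes "M *v x = c *\<^sub>R x" "s \<ge> 0"
  shows "flow M s *v x = exp (c * s) *\<^sub>R x"
proof -
  have "M *v (exp (c * s) *\<^sub>R x) = exp (c * s) *\<^sub>R (c *\<^sub>R x)" for s
    using assms(1) by (simp add: matrix_vector_mult_scaleR)
  then have d: "((\<lambda>s. exp (c * s) *\<^sub>R x) has_vector_derivative M *v (exp (c * s) *\<^sub>R x)) (at s)" for s
    by (auto intro!: derivative_eq_intros)
  have c: "continuous_on {0..s} (\<lambda>s. exp (c * s) *\<^sub>R x)" by (intro continuous_intros)
  show ?thesis using linear_ode_unique[OF assms(2) c d] by simp
qed

lemma flow_nonzero: "x \<noteq> 0 \<Longrightarrow> s \<ge> 0 \<Longrightarrow> flow M s *v x \<noteq> 0"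
proof -
  assume x: "x \<noteq> 0" and s: "s \<ge> 0"
  obtain C where "\<And>x. norm (M *v x) \<le> C * norm x" using matrix_bound_ex by blast
  from flow_bounds(2)[OF this s, of x] x show ?thesis
    by (metis exp_gt_zero mult_pos_pos norm_zero not_le zero_less_norm_iff)
qed

text \<open>If \<open>x\<close> is an eigenvector, the flow keeps its direction and the pairing
  never vanishes. Otherwise all zeros are transversal: if y = flow x and M y were both orthogonal to
  \<open>w\<close>, they would be parallel in the plane, and since M commutes with its flow,
  \<open>x\<close> would be an eigenvector.\<close>

lemma flow_zeros_countable:
  assumes w: "w \<noteq> 0" and x: "x \<noteq> 0" and ne: "(\<nexists>c. M *v x = c *\<^sub>R x) \<or> inner w x \<noteq> 0"
  shows "countable {s \<in> {0..}. inner w (flow M s *v x) = 0}"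
proof (cases "\<exists>c. M *v x = c *\<^sub>R x")
  case True
  then obtain c where "M *v x = c *\<^sub>R x" by blast
  then have *: "{s \<in> {0..}. inner w (flow M s *v x) = 0} = {}"
    using ne True by (auto simp: flow_eigenvector[of M x c])
  show ?thesis unfolding * by simp
next
  case False
  show ?thesis
  proof (rule countable_transversal_zeros)
    fix s assume s: "s \<in> {0::real..}" and z: "inner w (flow M s *v x) = 0"
    let ?y = "flow M s *v x"
    have "((\<lambda>s. inner w (flow M s *v x)) has_real_derivative inner w (M *v ?y)) (at s)"
      using bounded_linear.has_vector_derivative[OF bounded_linear_inner_right flow_vec_deriv]
      by (simp add: has_real_derivative_iff_has_vector_derivative)
    moreover have "inner w (M *v ?y) \<noteq> 0"
    proof
      assume "inner w (M *v ?y) = 0"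
      then obtain c where "M *v ?y = c *\<^sub>R ?y"
        using parallel_2[OF w flow_nonzero[OF x] z] s by auto
      then have "flow M s *v (M *v x - c *\<^sub>R x) = 0"
        using s by (simp add: flow_commute matrix_vector_mult_diff_distrib matrix_vector_mult_scaleR)
      then have "M *v x - c *\<^sub>R x = 0" using flow_nonzero[of "M *v x - c *\<^sub>R x" s M] s by fastforce
      then show False using False by auto
    qed
    ultimately show "((\<lambda>s. inner w (flow M s *v x)) has_real_derivative inner w (M *v ?y)) (at s)
      \<and> inner w (M *v ?y) \<noteq> 0" by blast
  qed
qed

lemma AE_flow_nonzero:
  assumes "w \<noteq> 0" "x \<noteq> 0" "(\<nexists>c. M *v x = c *\<^sub>R x) \<or> inner w x \<noteq> 0" "r > 0"
  shows "AE s in expm. inner w (flow M (\<bar>s\<bar> / r) *v x) \<noteq> 0"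
proof -
  define N where "N = {s \<in> {0..}. inner w (flow M s *v x) = 0}"
  have "countable N" unfolding N_def by (rule flow_zeros_countable) (use assms in auto)
  \<comment> \<open>Both signs occur because the time is the absolute value of
    \<open>s\<close>.\<close>
  then have "countable ((\<lambda>t. t * r) ` N \<union> (\<lambda>t. - (t * r)) ` N)" by auto
  from AE_expm_countable[OF this] show ?thesis
  proof eventually_elim
    case (elim s)
    show ?case
    proof
      assume "inner w (flow M (\<bar>s\<bar> / r) *v x) = 0"
      then have "\<bar>s\<bar> / r \<in> N" using assms(4) by (simp add: N_def)
      then have "(\<bar>s\<bar> / r) * r \<in> (\<lambda>t. t * r) ` N" "- ((\<bar>s\<bar> / r) * r) \<in> (\<lambda>t. - (t * r)) ` N" by blast+
      then show False using elim assms(4) by (cases "s \<ge> 0") auto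
    qed
  qed
qed

text \<open>This is dominated convergence for indicators. It ends both compactness arguments:
  functions that almost surely stay away from 0 cannot have sublevel sets of fixed positive
  probability when the thresholds tend to 0.\<close>

lemma (in prob_space) sublevel_tendsto_0:
  fixes f :: "nat \<Rightarrow> 'a \<Rightarrow> real"
  assumes [measurable]: "\<And>n. f n \<in> borel_measurable M"
    and f: "AE x in M. \<exists>c>0. \<forall>\<^sub>F n in sequentially. c \<le> \<bar>f n x\<bar>" and d: "d \<longlonglongrightarrow> 0"
  shows "(\<lambda>n. prob {x \<in> space M. \<bar>f n x\<bar> < d n}) \<longlonglongrightarrow> 0"
proof -
  have "(\<lambda>n. \<integral>x. indicator {x \<in> space M. \<bar>f n x\<bar> < d n} x \<partial>M) \<longlonglongrightarrow> (\<integral>x. 0 \<partial>M :: real)"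
  proof (rule integral_dominated_convergence)
    show "AE x in M. (\<lambda>n. indicator {x \<in> space M. \<bar>f n x\<bar> < d n} x) \<longlonglongrightarrow> (0::real)"
      using f
    proof eventually_elim
      case (elim x)
      then obtain c where "c > 0" and c: "\<forall>\<^sub>F n in sequentially. c \<le> \<bar>f n x\<bar>" by blast
      have "\<forall>\<^sub>F n in sequentially. d n < c" by (rule order_tendstoD(2)[OF d \<open>c > 0\<close>])
      with c have "\<forall>\<^sub>F n in sequentially. indicator {x \<in> space M. \<bar>f n x\<bar> < d n} x = (0::real)"
        by eventually_elim auto
      then show ?case by (rule tendsto_eventually)
    qed
    show "AE x in M. norm (indicator {x \<in> space M. \<bar>f n x\<bar> < d n} x :: real) \<le> 1" for n
      by (auto simp: indicator_def)
  qed auto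
  then show ?thesis by simp
qed

text \<open>\<open>N\<close> is the sum of the column norms. It is at most the sum of the absolute
  values of the four entries, hence at most twice the sum of the two row norms, so one row has norm
  at least N/4. Its direction is the \<open>w\<close> of the statement: \<open>f y\<close> can be
  small only if \<open>y\<close> is nearly orthogonal to it.\<close>

lemma linear_row_bound:
  fixes f :: "real^2 \<Rightarrow> real^2"
  assumes "linear f"
  defines "N \<equiv> norm (f (axis 1 1)) + norm (f (axis 2 1))"
  shows "norm (f y) \<le> N * norm y" "N > 0 \<Longrightarrow> \<exists>w. norm w = 1 \<and> (\<forall>y. N / 4 * \<bar>inner w y\<bar> \<le> norm (f y))"
proof -
  have y: "y = y$1 *\<^sub>R axis 1 1 + y$2 *\<^sub>R axis 2 1" for y :: "real^2"
    by (simp add: vec2_eq_iff axis_def)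
  have fy: "f y = y$1 *\<^sub>R f (axis 1 1) + y$2 *\<^sub>R f (axis 2 1)" for y
    by (subst y) (simp add: linear_add[OF assms(1)] linear_scale[OF assms(1)])
  have "norm (f y) \<le> \<bar>y$1\<bar> * norm (f (axis 1 1)) + \<bar>y$2\<bar> * norm (f (axis 2 1))"
    unfolding fy[of y] by (rule order_trans[OF norm_triangle_ineq]) simp
  also have "\<dots> \<le> norm y * norm (f (axis 1 1)) + norm y * norm (f (axis 2 1))"
    by (intro add_mono mult_right_mono) (use component_le_norm_cart in auto)
  finally show "norm (f y) \<le> N * norm y" by (simp add: N_def algebra_simps)
  assume N: "N > 0"
  define row where "row j = (vector [f (axis 1 1) $ j, f (axis 2 1) $ j] :: real^2)" for j
  have row: "inner (row j) y = f y $ j" for j y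
    unfolding fy[of y] by (simp add: row_def inner_vec2 algebra_simps)
  have n2: "norm x \<le> \<bar>x$1\<bar> + \<bar>x$2\<bar>" for x :: "real^2"
    using norm_le_l1_cart[of x] by (simp add: sum_2)
  have "N \<le> (\<bar>row 1 $ 1\<bar> + \<bar>row 2 $ 1\<bar>) + (\<bar>row 1 $ 2\<bar> + \<bar>row 2 $ 2\<bar>)"
    unfolding N_def using n2[of "f (axis 1 1)"] n2[of "f (axis 2 1)"] by (simp add: row_def)
  also have "\<dots> \<le> (norm (row 1) + norm (row 2)) + (norm (row 1) + norm (row 2))"
    by (intro add_mono component_le_norm_cart)
  finally have "N / 4 \<le> norm (row 1) \<or> N / 4 \<le> norm (row 2)" by linarith
  then obtain j where j: "N / 4 \<le> norm (row j)" by blast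
  then have nz: "norm (row j) > 0" using N by linarith
  show "\<exists>w. norm w = 1 \<and> (\<forall>y. N / 4 * \<bar>inner w y\<bar> \<le> norm (f y))"
  proof (intro exI conjI allI)
    let ?w = "row j /\<^sub>R norm (row j)"
    show "norm ?w = 1" using nz by simp
    fix y
    have "N / 4 * \<bar>inner ?w y\<bar> \<le> norm (row j) * \<bar>inner ?w y\<bar>" by (intro mult_right_mono j) simp
    also have "\<dots> = \<bar>f y $ j\<bar>" using nz by (simp add: row[symmetric] abs_mult)
    also have "\<dots> \<le> norm (f y)" by (rule component_le_norm_cart)
    finally show "N / 4 * \<bar>inner ?w y\<bar> \<le> norm (f y)" .
  qed
qed

context switched
begin

definition cycle :: "2 \<Rightarrow> real^2 \<Rightarrow> real \<times> real \<Rightarrow> real^2" where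
  "cycle i x p = flow (A (1 - i)) (\<bar>snd p\<bar> / rate (1 - i)) *v (flow (A i) (\<bar>fst p\<bar> / rate i) *v x)"

lemma step_step: "step (step (x, i) s) s' = (cycle i x (s, s'), i)"
  by (simp add: step_def cycle_def)

lemma continuous_flow_comp:
  assumes "continuous_on S f" "continuous_on S g"
  shows "continuous_on S (\<lambda>x. flow M (f x) *v g x)"
  using continuous_on_compose2[OF continuous_flow_pair continuous_on_Pair[OF assms]] by simp

lemma continuous_cycle: "continuous_on UNIV (\<lambda>q. cycle i (fst q) (snd q))"
  unfolding cycle_def using rate_pos by (intro continuous_flow_comp continuous_intros) (auto simp: less_imp_neq[symmetric])

lemma sets_ee: "sets (expm \<Otimes>\<^sub>M expm) = sets borel"
  by (simp add: borel_prod[symmetric] cong: sets_pair_measure_cong)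

lemma cycle_measurable [measurable]: "cycle i x \<in> borel_measurable (expm \<Otimes>\<^sub>M expm)"
proof -
  have "continuous_on UNIV (cycle i x)"
    using continuous_on_compose2[OF continuous_cycle, of UNIV "\<lambda>p. (x, p)" i]
    by (simp add: continuous_on_Pair[OF continuous_on_const continuous_on_id])
  then show ?thesis using borel_measurable_continuous_onI[of "cycle i x"]
    by (simp add: measurable_cong_sets[OF sets_ee refl])
qed

lemma X_linear: "linear (\<lambda>x. X n (x, i) e)"
proof (induction n)
  case (Suc n)
  have "linear (\<lambda>x. M *v X n (x, i) e)" for M :: "real^2^2"
    using linear_compose[OF Suc matrix_vector_mul_linear, of M] by (simp add: o_def)
  then show ?case by (simp add: X_Suc)
qed (auto simp: linear_iff)

lemma X_nonzero: "fst z \<noteq> 0 \<Longrightarrow> X n z e \<noteq> 0"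
  unfolding X_def by (induction n) (use step_nz in auto)

lemma psi_scale: "c \<noteq> 0 \<Longrightarrow> \<psi> n (c *\<^sub>R x, i) = \<psi> n (x, i)"
proof -
  assume c: "c \<noteq> 0"
  have "growth n (c *\<^sub>R x, i) e = growth n (x, i) e" for e
  proof (cases "x = 0")
    case False
    have "X n (c *\<^sub>R x, i) e = c *\<^sub>R X n (x, i) e" by (rule linear_scale[OF X_linear])
    then show ?thesis using c False X_nonzero[of "(x, i)"] by (simp add: growth_def ln_mult)
  qed simp
  then show ?thesis by (simp add: \<psi>_def)
qed

text \<open>A substitute for the operator norm of the product of \<open>n\<close> factors. It does
  not involve the initial vector, and the growth from two vectors is compared through the mean of
  its logarithm.\<close>

definition N :: "nat \<Rightarrow> 2 \<Rightarrow> (nat \<Rightarrow> real) \<Rightarrow> real" where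
  "N n i e = norm (X n (axis 1 1, i) e) + norm (X n (axis 2 1, i) e)"

lemma N_pos: "N n i e > 0"
  using X_nonzero[of "(axis 1 1, i)" n e] by (simp add: N_def add_pos_nonneg axis_eq_0_iff)

lemma X_le_N: "norm (X n (y, i) e) \<le> N n i e * norm y"
  unfolding N_def by (rule linear_row_bound(1)[OF X_linear])

lemma X_ge_N: "\<exists>w. norm w = 1 \<and> (\<forall>y. N n i e / 4 * \<bar>inner w y\<bar> \<le> norm (X n (y, i) e))"
  using linear_row_bound(2)[OF X_linear] N_pos unfolding N_def by blast

lemma N_measurable [measurable]: "N n i \<in> borel_measurable seqm"
  unfolding N_def[abs_def] by measurable

lemma ln_N_bounds: "- (C * h * esum n e) \<le> ln (N n i e)" "ln (N n i e) \<le> ln 2 + C * h * esum n e"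
proof -
  have g: "\<bar>ln (norm (X n (axis j 1, i) e))\<bar> \<le> C * h * esum n e" for j
    using growth_bound[of n "(axis j 1, i)" e] by (simp add: growth_def)
  have p: "norm (X n (axis j 1, i) e) > 0" for j using X_nonzero[of "(axis j 1, i)" n e] by (simp add: axis_eq_0_iff)
  have "ln (norm (X n (axis 1 1, i) e)) \<le> ln (N n i e)"
    using p N_pos by (simp add: N_def)
  then show "- (C * h * esum n e) \<le> ln (N n i e)" using g[of 1] by linarith
  have "norm (X n (axis j 1, i) e) \<le> exp (C * h * esum n e)" for j
    using g[of j] p[of j] by (metis abs_le_D1 exp_le_cancel_iff exp_ln)
  then have "N n i e \<le> 2 * exp (C * h * esum n e)" unfolding N_def by (smt (verit))
  then have "ln (N n i e) \<le> ln (2 * exp (C * h * esum n e))" using N_pos by simp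
  then show "ln (N n i e) \<le> ln 2 + C * h * esum n e" by (simp add: ln_mult)
qed

lemma ln_N_integrable [simp]: "integrable seqm (\<lambda>e. ln (N n i e))"
proof (rule Bochner_Integration.integrable_bound)
  show "integrable seqm (\<lambda>e. ln 2 + C * h * esum n e)" by simp
  show "AE e in seqm. norm (ln (N n i e)) \<le> norm (ln 2 + C * h * esum n e)"
  proof (rule AE_I2)
    fix e
    have "0 \<le> C * h * esum n e" using C_pos h_pos by simp
    moreover have "(0::real) \<le> ln 2" by simp
    ultimately show "norm (ln (N n i e)) \<le> norm (ln 2 + C * h * esum n e)"
      using ln_N_bounds(1)[of n e i] ln_N_bounds(2)[of n i e] unfolding real_norm_def by linarith
  qed
qed measurable

lemma growth_cycle: "growth (Suc (Suc n)) (x, i) (cons2 p e)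
    = ln (norm (X n (cycle i x p, i) e)) - ln (norm x)"
  unfolding growth_def by (simp add: X_case_nat step_step)

lemma growth_cycle_bound: "\<bar>growth (Suc (Suc n)) (x, i) (cons2 p e)\<bar>
    \<le> C * h * esum n e + C * h * (\<bar>fst p\<bar> + \<bar>snd p\<bar>)"
  using growth_bound[of "Suc (Suc n)" "(x, i)" "cons2 p e"]
  by (simp add: esum_case_nat algebra_simps)

end

lemma distr_ee_fst: "distr (expm \<Otimes>\<^sub>M expm) expm fst = expm"
  by (rule expm.distr_pair_fst) 

lemma distr_ee_snd: "distr (expm \<Otimes>\<^sub>M expm) expm snd = expm"
proof (rule measure_eqI)
  fix A assume "A \<in> sets (distr (expm \<Otimes>\<^sub>M expm) expm snd)"
  then have A: "A \<in> sets expm" by simp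
  have "snd -` A \<inter> space (expm \<Otimes>\<^sub>M expm) = UNIV \<times> A" by (auto simp: space_pair_measure)
  then show "emeasure (distr (expm \<Otimes>\<^sub>M expm) expm snd) A = emeasure expm A"
    using A expm.emeasure_pair_measure_Times[of UNIV expm A] expm.emeasure_space_1
    by (simp add: emeasure_distr)
qed simp

lemma
  fixes f :: "real \<Rightarrow> real"
  assumes "integrable expm f"
  shows integrable_ee_fst: "integrable (expm \<Otimes>\<^sub>M expm) (\<lambda>p. f (fst p))"
    and integral_ee_fst: "(\<integral>p. f (fst p) \<partial>(expm \<Otimes>\<^sub>M expm)) = integral\<^sup>L expm f"
    and integrable_ee_snd: "integrable (expm \<Otimes>\<^sub>M expm) (\<lambda>p. f (snd p))"
    and integral_ee_snd: "(\<integral>p. f (snd p) \<partial>(expm \<Otimes>\<^sub>M expm)) = integral\<^sup>L expm f"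
proof -
  have m: "f \<in> borel_measurable expm" using assms by auto
  show "integrable (expm \<Otimes>\<^sub>M expm) (\<lambda>p. f (fst p))"
    by (rule integrable_distr[OF measurable_fst]) (unfold distr_ee_fst, rule assms)
  show "integrable (expm \<Otimes>\<^sub>M expm) (\<lambda>p. f (snd p))"
    by (rule integrable_distr[OF measurable_snd]) (unfold distr_ee_snd, rule assms)
  show "(\<integral>p. f (fst p) \<partial>(expm \<Otimes>\<^sub>M expm)) = integral\<^sup>L expm f"
    using integral_distr[OF measurable_fst m, of expm] unfolding distr_ee_fst by simp
  show "(\<integral>p. f (snd p) \<partial>(expm \<Otimes>\<^sub>M expm)) = integral\<^sup>L expm f"
    using integral_distr[OF measurable_snd m, of expm] unfolding distr_ee_snd by simp
qed

abbreviation ee :: "(real \<times> real) measure" where "ee \<equiv> expm \<Otimes>\<^sub>M expm"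

definition psum :: "real \<times> real \<Rightarrow> real" where "psum p = \<bar>fst p\<bar> + \<bar>snd p\<bar>"

lemma psum_nonneg [simp]: "psum p \<ge> 0" by (simp add: psum_def)

lemma psum_integrable [simp]: "integrable ee psum" and psum_integral: "(\<integral>p. psum p \<partial>ee) = 2"
proof -
  have i: "integrable ee (\<lambda>p. \<bar>fst p\<bar>)" "integrable ee (\<lambda>p. \<bar>snd p\<bar>)"
    using integrable_ee_fst[OF integrable_expm_ident(2)] integrable_ee_snd[OF integrable_expm_ident(2)] by auto
  then show "integrable ee psum" unfolding psum_def[abs_def] by (rule Bochner_Integration.integrable_add)
  show "(\<integral>p. psum p \<partial>ee) = 2" unfolding psum_def
    using integral_ee_fst[OF integrable_expm_ident(2)] integral_ee_snd[OF integrable_expm_ident(2)] i by simp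
qed

lemma psum_measurable [measurable]: "psum \<in> borel_measurable ee"
  using psum_integrable by (rule borel_measurable_integrable)

section \<open>Anticoncentration of one cycle and oscillation of the expected growth\<close>

locale switched_irreducible = switched +
  assumes no_common: "\<And>x c d. x \<noteq> 0 \<Longrightarrow> A 0 *v x = c *\<^sub>R x \<Longrightarrow> A 1 *v x = d *\<^sub>R x \<Longrightarrow> False"
begin

lemma not_both_eigen: "x \<noteq> 0 \<Longrightarrow> A i *v x = c *\<^sub>R x \<Longrightarrow> A (1 - i) *v x = d *\<^sub>R x \<Longrightarrow> False"
  using two_cases[of i] no_common by auto

text \<open>If \<open>x\<close> is an eigenvector of the first matrix, the first flow keeps its
  direction, which is not an eigendirection of the second matrix, so the second flow makes the zeros
  exceptional. Otherwise the first flow already leaves the line orthogonal to \<open>w\<close> for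
  almost every time, and a nonzero pairing before the second flow is enough. The disjunction in
  \<open>flow_zeros_countable\<close> serves these two cases.\<close>

lemma AE_cycle_nonzero:
  assumes "w \<noteq> 0" "x \<noteq> 0"
  shows "AE p in ee. inner w (cycle i x p) \<noteq> 0"
proof (rule ee.AE_pair_measure)
  show "{p \<in> space ee. inner w (cycle i x p) \<noteq> 0} \<in> sets ee" by measurable
  have key: "AE s' in expm. inner w (cycle i x (s, s')) \<noteq> 0"
    if "\<And>y. y = flow (A i) (\<bar>s\<bar> / rate i) *v x \<Longrightarrow> (\<nexists>c. A (1 - i) *v y = c *\<^sub>R y) \<or> inner w y \<noteq> 0" for s
  proof -
    have "\<bar>s\<bar> / rate i \<ge> 0" using rate_pos[of i] by simp
    from AE_flow_nonzero[OF assms(1) flow_nonzero[OF assms(2) this] that[OF refl] rate_pos]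
    show ?thesis by (simp add: cycle_def)
  qed
  show "AE s in expm. AE s' in expm. inner w (cycle i x (s, s')) \<noteq> 0"
  proof (cases "\<exists>c. A i *v x = c *\<^sub>R x")
    case True
    then obtain c where c: "A i *v x = c *\<^sub>R x" by blast
    have "AE s' in expm. inner w (cycle i x (s, s')) \<noteq> 0" for s
    proof (rule key)
      fix y assume "y = flow (A i) (\<bar>s\<bar> / rate i) *v x"
      then have y: "y = exp (c * (\<bar>s\<bar> / rate i)) *\<^sub>R x" using flow_eigenvector[OF c] rate_pos[of i] by simp
      have "\<nexists>d. A (1 - i) *v y = d *\<^sub>R y"
      proof
        assume "\<exists>d. A (1 - i) *v y = d *\<^sub>R y"
        then obtain d where "A (1 - i) *v y = d *\<^sub>R y" by blast
        then have "A (1 - i) *v x = d *\<^sub>R x"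
          unfolding y matrix_vector_mult_scaleR scaleR_left_commute[of d]
          by (simp only: scaleR_cancel_left exp_not_eq_zero simp_thms)
        then show False using not_both_eigen[OF assms(2) c] by blast
      qed
      then show "(\<nexists>c. A (1 - i) *v y = c *\<^sub>R y) \<or> inner w y \<noteq> 0" by blast
    qed
    then show ?thesis by simp
  next
    case False
    then have "AE s in expm. inner w (flow (A i) (\<bar>s\<bar> / rate i) *v x) \<noteq> 0"
      by (intro AE_flow_nonzero assms rate_pos) auto
    then show ?thesis by eventually_elim (rule key, auto)
  qed
qed

text \<open>If no \<delta> worked, there would be unit vectors for which thresholds 1/(n+1) still
  have probability above \<epsilon>. A limit point of them on the product of two circles has an
  almost surely nonzero pairing, and continuity of the cycle in the initial vector gives a
  contradiction.\<close>

lemma anticoncentration: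
  assumes "\<epsilon> > 0"
  shows "\<exists>\<delta>>0. \<delta> \<le> 1 \<and> (\<forall>w x. norm w = 1 \<longrightarrow> norm x = 1 \<longrightarrow>
    measure ee {p \<in> space ee. \<bar>inner w (cycle i x p)\<bar> < \<delta>} \<le> \<epsilon>)"
proof (rule ccontr)
  assume neg: "\<not> ?thesis"
  define bad where "bad n q \<longleftrightarrow> norm (fst q) = 1 \<and> norm (snd q) = 1 \<and>
    measure ee {p \<in> space ee. \<bar>inner (fst q) (cycle i (snd q) p)\<bar> < inverse (real (Suc n))} > \<epsilon>" for n q
  have "\<exists>q. bad n q" for n
  proof -
    have "inverse (real (Suc n)) > 0" "inverse (real (Suc n)) \<le> 1" by (auto simp: field_simps)
    with neg obtain w x where "norm w = 1" "norm x = 1"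
      "\<not> measure ee {p \<in> space ee. \<bar>inner w (cycle i x p)\<bar> < inverse (real (Suc n))} \<le> \<epsilon>" by blast
    then show ?thesis unfolding bad_def by (intro exI[of _ "(w, x)"]) auto
  qed
  then have "\<exists>q. \<forall>n. bad n (q n)" by (intro choice) blast
  then obtain q where "\<And>n. bad n (q n)" by blast
  then have q: "\<And>n. norm (fst (q n)) = 1" "\<And>n. norm (snd (q n)) = 1"
    "\<And>n. measure ee {p \<in> space ee. \<bar>inner (fst (q n)) (cycle i (snd (q n)) p)\<bar> < inverse (real (Suc n))} > \<epsilon>"
    unfolding bad_def by blast+
  have "compact (sphere (0::real^2) 1 \<times> sphere (0::real^2) 1)" by (intro compact_Times compact_sphere)
  moreover have "\<forall>n. q n \<in> sphere 0 1 \<times> sphere 0 1" using q by (auto simp: mem_Times_iff dist_norm)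
  ultimately obtain l r where l: "l \<in> sphere 0 1 \<times> sphere 0 1" and r: "strict_mono r" and lim: "(q \<circ> r) \<longlonglongrightarrow> l"
    unfolding compact_def by blast
  have l1: "fst l \<noteq> 0" "snd l \<noteq> 0" using l by (auto simp: mem_Times_iff dist_norm)
  have "(\<lambda>n. measure ee {p \<in> space ee. \<bar>inner (fst (q (r n))) (cycle i (snd (q (r n))) p)\<bar> < inverse (real (Suc (r n)))}) \<longlonglongrightarrow> 0"
  proof (rule ee.sublevel_tendsto_0)
    show "(\<lambda>n. inverse (real (Suc (r n)))) \<longlonglongrightarrow> 0"
      using LIMSEQ_subseq_LIMSEQ[OF LIMSEQ_inverse_real_of_nat r] by (simp add: o_def)
    show "AE p in ee. \<exists>c>0. \<forall>\<^sub>F n in sequentially. c \<le> \<bar>inner (fst (q (r n))) (cycle i (snd (q (r n))) p)\<bar>"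
      using AE_cycle_nonzero[OF l1, of i]
    proof eventually_elim
      case (elim p)
      have f: "(\<lambda>n. fst (q (r n))) \<longlonglongrightarrow> fst l" "(\<lambda>n. snd (q (r n))) \<longlonglongrightarrow> snd l"
        using lim by (auto simp: o_def intro: tendsto_fst tendsto_snd)
      have c: "isCont (\<lambda>q. cycle i (fst q) (snd q)) (snd l, p)"
        by (rule continuous_on_interior[OF continuous_cycle]) simp
      have "(\<lambda>n. cycle i (snd (q (r n))) p) \<longlonglongrightarrow> cycle i (snd l) p"
        using isCont_tendsto_compose[OF c tendsto_Pair[OF f(2) tendsto_const]] by simp
      then have "(\<lambda>n. \<bar>inner (fst (q (r n))) (cycle i (snd (q (r n))) p)\<bar>) \<longlonglongrightarrow> \<bar>inner (fst l) (cycle i (snd l) p)\<bar>"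
        by (intro tendsto_intros f)
      then have "\<forall>\<^sub>F n in sequentially. \<bar>inner (fst l) (cycle i (snd l) p)\<bar> / 2 < \<bar>inner (fst (q (r n))) (cycle i (snd (q (r n))) p)\<bar>"
        by (rule order_tendstoD(1)) (use elim in auto)
      then show ?case using elim
        by (intro exI[of _ "\<bar>inner (fst l) (cycle i (snd l) p)\<bar> / 2"]) (auto elim: eventually_mono)
    qed
  qed measurable
  then have "\<forall>\<^sub>F n in sequentially. measure ee {p \<in> space ee. \<bar>inner (fst (q (r n))) (cycle i (snd (q (r n))) p)\<bar> < inverse (real (Suc (r n)))} < \<epsilon>"
    using assms by (rule order_tendstoD(2))
  then obtain n where "measure ee {p \<in> space ee. \<bar>inner (fst (q (r n))) (cycle i (snd (q (r n))) p)\<bar> < inverse (real (Suc (r n)))} < \<epsilon>"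
    by (auto simp: eventually_sequentially)
  then show False using q(3)[of "r n"] by simp
qed

lemma growth_cycle_integrable:
  "integrable ee (\<lambda>p. growth (Suc (Suc n)) (x, i) (cons2 p e))"
proof (rule Bochner_Integration.integrable_bound)
  show "integrable ee (\<lambda>p. C * h * esum n e + C * h * psum p)" by simp
  show "AE p in ee. norm (growth (Suc (Suc n)) (x, i) (cons2 p e))
      \<le> norm (C * h * esum n e + C * h * psum p)"
    using growth_cycle_bound by (intro AE_I2) (auto intro: order_trans[OF _ abs_ge_self] simp: psum_def)
  have "linear (\<lambda>x. X n (x, i) e)" by (rule X_linear)
  then have "(\<lambda>x. X n (x, i) e) \<in> borel_measurable borel"
    by (intro borel_measurable_continuous_onI linear_continuous_on linear_linear[THEN iffD1]) 
       (auto simp: linear_conv_bounded_linear)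
  then have [measurable]: "(\<lambda>p. X n (cycle i x p, i) e) \<in> borel_measurable ee"
    by (rule measurable_compose[OF cycle_measurable])
  show "(\<lambda>p. growth (Suc (Suc n)) (x, i) (cons2 p e)) \<in> borel_measurable ee"
    unfolding growth_cycle by measurable
qed

text \<open>The tail contributes at most the logarithm of \<open>N\<close>, and the first cycle at
  most C h times \<open>psum\<close>, whose mean is 2.\<close>

lemma psi_cycle_upper:
  assumes "norm x = 1"
  shows "\<psi> (Suc (Suc n)) (x, i) \<le> (\<integral>e. ln (N n i e) \<partial>seqm) + 2 * (C * h)"
proof -
  have x: "x \<noteq> 0" using assms by auto
  have "\<psi> (Suc (Suc n)) (x, i) = (\<integral>e. \<integral>p. growth (Suc (Suc n)) (x, i) (cons2 p e) \<partial>ee \<partial>seqm)"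
    unfolding \<psi>_def by (rule integral_case_nat2) simp
  also have "\<dots> \<le> (\<integral>e. ln (N n i e) + 2 * (C * h) \<partial>seqm)"
  proof (rule integral_mono)
    show "integrable seqm (\<lambda>e. \<integral>p. growth (Suc (Suc n)) (x, i) (cons2 p e) \<partial>ee)"
      by (rule integrable_outer_case_nat2) simp
    fix e
    have "(\<integral>p. growth (Suc (Suc n)) (x, i) (cons2 p e) \<partial>ee)
        \<le> (\<integral>p. ln (N n i e) + C * h * psum p \<partial>ee)"
    proof (rule integral_mono[OF growth_cycle_integrable])
      fix p
      let ?y = "cycle i x p"
      have "growth 2 (x, i) (cons2 p e) = ln (norm ?y)"
        using growth_cycle[of 0 x i p e] assms by (simp add: numeral_2_eq_2)
      moreover have "\<bar>growth 2 (x, i) (cons2 p e)\<bar> \<le> C * h * psum p"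
        using growth_cycle_bound[of 0 x i p e] by (simp add: numeral_2_eq_2 psum_def esum_def)
      ultimately have y: "ln (norm ?y) \<le> C * h * psum p" by linarith
      have ynz: "?y \<noteq> 0" using step_nz[OF step_nz, of "(x, i)" "fst p" "snd p"] x by (simp add: step_step)
      have "ln (norm (X n (?y, i) e)) \<le> ln (N n i e * norm ?y)"
        using X_le_N[of n ?y i e] X_nonzero[of "(?y, i)" n e] ynz by (intro ln_mono) auto
      also have "\<dots> = ln (N n i e) + ln (norm ?y)"
        using N_pos[of n i e] ynz by (simp add: ln_mult)
      finally show "growth (Suc (Suc n)) (x, i) (cons2 p e) \<le> ln (N n i e) + C * h * psum p"
        using y unfolding growth_cycle by (simp add: assms)
    qed simp
    also have "\<dots> = ln (N n i e) + 2 * (C * h)" by (simp add: psum_integral ee.prob_space)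
    finally show "(\<integral>p. growth (Suc (Suc n)) (x, i) (cons2 p e) \<partial>ee) \<le> ln (N n i e) + 2 * (C * h)" .
  qed simp
  also have "\<dots> = (\<integral>e. ln (N n i e) \<partial>seqm) + 2 * (C * h)" by simp
  finally show ?thesis .
qed

text \<open>Off a small set of jump times of the first cycle, the first cycle moves the initial vector
  away from the kernel of the dominant row of the remaining product; on that set, the deterministic
  bound is used.\<close>

lemma psi_cycle_lower:
  assumes x: "norm x = 1" and d: "0 < \<delta>" "\<delta> \<le> 1"
    and anti: "\<And>w. norm w = 1 \<Longrightarrow> measure ee {p \<in> space ee. \<bar>inner w (cycle i x p)\<bar> < \<delta>} \<le> \<epsilon>"
  shows "(\<integral>e. ln (N n i e) \<partial>seqm) + ln (\<delta> / 4) - 2 * (C * h) * \<epsilon> * n - 2 * (C * h) \<le> \<psi> (Suc (Suc n)) (x, i)"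
proof -
  have "(\<integral>e. ln (N n i e) + ln (\<delta> / 4) - 2 * (C * h) * \<epsilon> * esum n e - 2 * (C * h) \<partial>seqm)
     \<le> (\<integral>e. \<integral>p. growth (Suc (Suc n)) (x, i) (cons2 p e) \<partial>ee \<partial>seqm)"
  proof (rule integral_mono)
    show "integrable seqm (\<lambda>e. \<integral>p. growth (Suc (Suc n)) (x, i) (cons2 p e) \<partial>ee)"
      by (rule integrable_outer_case_nat2) simp
    fix e
    define E where "E = C * h * esum n e"
    define L where "L = ln (N n i e) + ln (\<delta> / 4)"
    have E0: "E \<ge> 0" using C_pos h_pos by (simp add: E_def)
    obtain w where w: "norm w = 1" "\<And>y. N n i e / 4 * \<bar>inner w y\<bar> \<le> norm (X n (y, i) e)"
      using X_ge_N by blast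
    define B where "B = {p \<in> space ee. \<bar>inner w (cycle i x p)\<bar> < \<delta>}"
    have B: "B \<in> sets ee" unfolding B_def by measurable
    have iB: "integrable ee (indicator B :: _ \<Rightarrow> real)"
      by (rule integrable_real_indicator[OF B]) (simp add: ee.emeasure_eq_measure)
    \<comment> \<open>The term ln(\<delta>/4) is negative enough to cancel the ln 2 in the upper
      bound for ln N. Hence L <= E, and replacing L by - E on the bad set \<open>B\<close> costs at
      most 2 E.\<close>
    have "ln (\<delta> / 4) \<le> ln (1 / 4)" using d by simp
    also have "\<dots> = - ln 2 - ln 2" using ln_div[of 1 4] ln_mult[of 2 2] by simp
    finally have "ln (\<delta> / 4) \<le> - ln 2" using ln_gt_zero[of 2] by linarith
    then have LE: "L \<le> E" using ln_N_bounds(2)[of n i e] unfolding L_def E_def by linarith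
    have "(\<integral>p. L - 2 * E * indicator B p - C * h * psum p \<partial>ee)
       \<le> (\<integral>p. growth (Suc (Suc n)) (x, i) (cons2 p e) \<partial>ee)"
    proof (rule integral_mono[OF _ growth_cycle_integrable])
      show "integrable ee (\<lambda>p. L - 2 * E * indicator B p - C * h * psum p)"
        using iB by simp
      fix p assume p: "p \<in> space ee"
      show "L - 2 * E * indicator B p - C * h * psum p \<le> growth (Suc (Suc n)) (x, i) (cons2 p e)"
      proof (cases "p \<in> B")
        case True
        have "- (E + C * h * psum p) \<le> growth (Suc (Suc n)) (x, i) (cons2 p e)"
          using growth_cycle_bound[of n x i p e] by (simp add: E_def psum_def abs_le_iff)
        then show ?thesis using True LE by simp
      next
        case False
        then have "N n i e / 4 * \<delta> \<le> N n i e / 4 * \<bar>inner w (cycle i x p)\<bar>"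
          using p N_pos[of n i e] by (intro mult_left_mono) (auto simp: B_def)
        also have "\<dots> \<le> norm (X n (cycle i x p, i) e)" by (rule w(2))
        finally have le: "N n i e * (\<delta> / 4) \<le> norm (X n (cycle i x p, i) e)" by simp
        have "L = ln (N n i e * (\<delta> / 4))" unfolding L_def using N_pos[of n i e] d by (subst ln_mult) auto
        also have "\<dots> \<le> ln (norm (X n (cycle i x p, i) e))"
          using le N_pos[of n i e] d by (intro ln_mono) auto
        finally have "L \<le> growth (Suc (Suc n)) (x, i) (cons2 p e)"
          unfolding growth_cycle by (simp add: x)
        moreover have "0 \<le> C * h * psum p" using C_pos h_pos by simp
        ultimately show ?thesis using False by simp
      qed
    qed
    also have "(\<integral>p. L - 2 * E * indicator B p - C * h * psum p \<partial>ee) = L - 2 * E * measure ee B - 2 * (C * h)"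
      using iB sets.Int_space_eq2[OF B] by (simp add: psum_integral ee.prob_space)
    finally have "L - 2 * E * measure ee B - 2 * (C * h) \<le> (\<integral>p. growth (Suc (Suc n)) (x, i) (cons2 p e) \<partial>ee)" .
    moreover have "2 * E * measure ee B \<le> 2 * E * \<epsilon>"
      using anti[OF w(1)] E0 unfolding B_def by (intro mult_left_mono) auto
    ultimately show "ln (N n i e) + ln (\<delta> / 4) - 2 * (C * h) * \<epsilon> * esum n e - 2 * (C * h)
      \<le> (\<integral>p. growth (Suc (Suc n)) (x, i) (cons2 p e) \<partial>ee)"
      unfolding L_def E_def by (simp add: mult_ac)
  qed simp
  also have "\<dots> = \<psi> (Suc (Suc n)) (x, i)"
    unfolding \<psi>_def by (rule integral_case_nat2[symmetric]) simp
  finally show ?thesis by (simp add: integral_esum)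
qed

text \<open>One jump moves (x, i) into the opposite discrete state, where the comparison is known.
  Appending a jump at the end and dropping the one at the beginning change the expected growth by at
  most C h each.\<close>

lemma psi_other_state:
  assumes "\<And>x y. x \<noteq> 0 \<Longrightarrow> y \<noteq> 0 \<Longrightarrow> \<psi> n (x, 1 - i) \<le> \<psi> n (y, 1 - i) + B" "x \<noteq> 0" "y \<noteq> 0"
  shows "\<psi> n (x, i) \<le> \<psi> n (y, 1 - i) + B + 2 * (C * h)"
proof -
  have "\<psi> n (x, i) - C * h \<le> \<psi> (Suc n) (x, i)"
  proof -
    have "- (C * h) \<le> \<psi> 1 z" for z using psi_bound[of 1 z] by (simp add: abs_le_iff)
    then have "\<psi> n (x, i) + - (C * h) \<le> \<psi> (n + 1) (x, i)"
      by (intro psi_add_ge[of UNIV]) (use assms(2) in auto)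
    then show ?thesis by simp
  qed
  moreover have "(\<integral>s. inc (x, i) s \<partial>expm) \<le> C * h"
    using psi_bound[of 1 "(x, i)"] psi_Suc[of 0 "(x, i)"] by (simp add: abs_le_iff)
  moreover have "(\<integral>s. \<psi> n (step (x, i) s) \<partial>expm) \<le> (\<integral>s. \<psi> n (y, 1 - i) + B \<partial>expm)"
  proof (rule integral_mono)
    show "\<psi> n (step (x, i) s) \<le> \<psi> n (y, 1 - i) + B" for s
      using assms(1)[OF step_nz[of "(x, i)"] assms(3), of s] assms(2) by (simp add: step_def)
  qed simp_all
  ultimately show ?thesis using psi_Suc[of n "(x, i)"] by simp
qed

theorem psi_oscillation:
  fixes \<eta> :: real
  assumes "\<eta> > 0"
  shows "\<exists>m\<ge>1. \<forall>z z'. fst z \<noteq> 0 \<longrightarrow> fst z' \<noteq> 0 \<longrightarrow> \<psi> m z \<le> \<psi> m z' + \<eta> * m"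
proof -
  \<comment> \<open>This makes the loss 2 C h \<epsilon> n on the bad sets equal to half of the
    allowed \<eta> n; the other half absorbs the constants once n is large.\<close>
  define \<epsilon> where "\<epsilon> = \<eta> / (4 * (C * h))"
  have eps: "\<epsilon> > 0" using assms C_pos h_pos by (simp add: \<epsilon>_def)
  define good where "good i \<delta> \<longleftrightarrow> \<delta> > 0 \<and> \<delta> \<le> 1 \<and> (\<forall>w x. norm w = 1 \<longrightarrow> norm x = 1 \<longrightarrow>
    measure ee {p \<in> space ee. \<bar>inner w (cycle i x p)\<bar> < \<delta>} \<le> \<epsilon>)" for i \<delta>
  have "\<exists>\<delta>. good i \<delta>" for i using anticoncentration[OF eps, of i] unfolding good_def by blast
  then have "\<exists>\<delta>. \<forall>i. good i (\<delta> i)" by (intro choice) blast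
  then obtain \<delta> where "\<And>i. good i (\<delta> i)" by blast
  then have d: "\<And>i. \<delta> i > 0" "\<And>i. \<delta> i \<le> 1" "\<And>i w x. norm w = 1 \<Longrightarrow> norm x = 1 \<Longrightarrow>
    measure ee {p \<in> space ee. \<bar>inner w (cycle i x p)\<bar> < \<delta> i} \<le> \<epsilon>"
    unfolding good_def by blast+
  define K where "K = \<bar>ln (\<delta> 0 / 4)\<bar> + \<bar>ln (\<delta> 1 / 4)\<bar> + 4 * (C * h)"
  have K: "- ln (\<delta> i / 4) + 4 * (C * h) \<le> K" for i
    using two_cases[of i] unfolding K_def by (elim disjE) simp_all
  obtain n :: nat where n: "(K + 2 * (C * h)) / (\<eta> / 2) \<le> n" using real_arch_simple by blast
  have unit: "\<psi> (Suc (Suc n)) (x, i) \<le> \<psi> (Suc (Suc n)) (y, i) + (K + \<eta> / 2 * n)"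
    if "norm x = 1" "norm y = 1" for x y i
  proof -
    have "2 * (C * h) * \<epsilon> * n = \<eta> / 2 * n" using C_pos h_pos by (simp add: \<epsilon>_def)
    then show ?thesis
      using psi_cycle_upper[OF that(1), where n = n and i = i] K[of i]
        psi_cycle_lower[OF that(2) d(1)[of i] d(2)[of i] d(3)[OF _ that(2)], where n = n]
      by linarith
  qed
  have same: "\<psi> (Suc (Suc n)) (x, i) \<le> \<psi> (Suc (Suc n)) (y, i) + (K + \<eta> / 2 * n)"
    if "x \<noteq> 0" "y \<noteq> 0" for x y i
    using unit[of "x /\<^sub>R norm x" "y /\<^sub>R norm y" i] that by (simp add: psi_scale)
  have le: "\<psi> (Suc (Suc n)) z \<le> \<psi> (Suc (Suc n)) z' + (K + \<eta> / 2 * n + 2 * (C * h))"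
    if z: "fst z \<noteq> 0" "fst z' \<noteq> 0" for z z'
  proof (cases "snd z = snd z'")
    case True
    have "0 \<le> C * h" using C_pos h_pos by simp
    then show ?thesis using same[of "fst z" "fst z'" "snd z"] z True by (cases z; cases z') simp
  next
    case False
    then have "snd z' = 1 - snd z" using two_cases[of "snd z"] two_cases[of "snd z'"] by auto
    then show ?thesis using psi_other_state[of "Suc (Suc n)" "snd z" _ "fst z" "fst z'", OF same] z
      by (cases z; cases z') (simp add: add.assoc)
  qed
  have K': "K + \<eta> / 2 * n + 2 * (C * h) \<le> \<eta> * Suc (Suc n)"
    using n assms by (simp add: field_simps)
  show ?thesis
  proof (intro exI[of _ "Suc (Suc n)"] conjI allI impI)
    fix z z' :: "(real^2) \<times> 2" assume "fst z \<noteq> 0" "fst z' \<noteq> 0"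
    from le[OF this] K' show "\<psi> (Suc (Suc n)) z \<le> \<psi> (Suc (Suc n)) z' + \<eta> * Suc (Suc n)" by linarith
  qed simp
qed

corollary lyapunov_limit:
  "fst z \<noteq> 0 \<Longrightarrow> AE e in seqm. (\<lambda>n. ln (norm (X n z e)) / n) \<longlonglongrightarrow> \<gamma>"
  by (rule lyapunov_law[OF psi_oscillation])

end

section \<open>Slow and fast switching\<close>

text \<open>Pairing with the fixed vector \<open>f s\<close> reduces the claim to the mean value
  theorem for real functions.\<close>

lemma vector_mvt_bound:
  fixes f f' :: "real \<Rightarrow> real^2"
  assumes f: "\<And>t. (f has_vector_derivative f' t) (at t)" "f 0 = 0"
    and B: "\<And>t. 0 \<le> t \<Longrightarrow> t \<le> s \<Longrightarrow> norm (f' t) \<le> B" and s: "s \<ge> 0"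
  shows "norm (f s) \<le> B * s"
proof (cases "s = 0")
  case False
  then have s': "s > 0" using s by simp
  define w where "w = f s"
  have d: "((\<lambda>t. inner w (f t)) has_real_derivative inner w (f' t)) (at t)" for t
    using bounded_linear.has_vector_derivative[OF bounded_linear_inner_right f(1)]
    by (simp add: has_real_derivative_iff_has_vector_derivative)
  obtain t where t: "t > 0" "t < s" "inner w (f s) - inner w (f 0) = (s - 0) * inner w (f' t)"
    using MVT2[OF s', of "\<lambda>t. inner w (f t)" "\<lambda>t. inner w (f' t)"] d by blast
  have "norm w * norm w = s * inner w (f' t)"
    using t f(2) by (simp add: w_def dot_square_norm power2_eq_square)
  also have "\<dots> \<le> s * (norm w * B)"
  proof (intro mult_left_mono s)
    have "inner w (f' t) \<le> norm w * norm (f' t)" by (rule norm_cauchy_schwarz)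
    also have "\<dots> \<le> norm w * B" using t by (intro mult_left_mono B) auto
    finally show "inner w (f' t) \<le> norm w * B" .
  qed
  finally have le: "norm w * norm w \<le> norm w * (B * s)" by (simp add: mult_ac)
  have "0 \<le> B" using B[of 0] s norm_ge_zero[of "f' 0"] by linarith
  then have "norm w \<le> B * s" using le s
    by (cases "norm w = 0") (auto simp: mult_le_cancel_left)
  then show ?thesis by (simp add: w_def)
qed (use f in simp)

text \<open>The bound \<open>K\<close> on the flow is uniform in time, so the remainders are
  polynomial in \<open>s\<close>; their moments under the exponential law are then available for
  every switching rate.\<close>

lemma flow_taylor:
  assumes C: "C \<ge> 0" "\<And>x. norm (A *v x) \<le> C * norm x"
    and K: "\<And>s x. s \<ge> 0 \<Longrightarrow> norm (flow A s *v x) \<le> K * norm x" and s: "s \<ge> 0"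
  shows "norm (flow A s *v x - x) \<le> K * C * s * norm x"
    and "norm (flow A s *v x - x - s *\<^sub>R (A *v x)) \<le> K * C\<^sup>2 * s\<^sup>2 * norm x"
proof -
  have one: "norm (flow A s *v x - x) \<le> K * C * s * norm x" if s: "s \<ge> 0" for s
  proof -
    have "norm (flow A s *v x - x) \<le> (C * (K * norm x)) * s"
    proof (rule vector_mvt_bound[OF _ _ _ s])
      show "((\<lambda>s. flow A s *v x - x) has_vector_derivative A *v (flow A t *v x)) (at t)" for t
        using flow_vec_deriv[of A x t UNIV] by (auto intro!: derivative_eq_intros)
      show "norm (A *v (flow A t *v x)) \<le> C * (K * norm x)" if "0 \<le> t" for t
        using order_trans[OF C(2) mult_left_mono[OF K[OF that] C(1)]] .
    qed simp
    then show ?thesis by (simp add: mult_ac)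
  qed
  show "norm (flow A s *v x - x) \<le> K * C * s * norm x" by (rule one[OF s])
  have "norm x \<le> K * norm x" using K[of 0 x] by simp
  then have K0: "K * norm x \<ge> 0" using norm_ge_zero[of x] by linarith
  have "norm (flow A s *v x - x - s *\<^sub>R (A *v x)) \<le> (C * (K * C * s * norm x)) * s"
  proof (rule vector_mvt_bound[OF _ _ _ s])
    show "((\<lambda>s. flow A s *v x - x - s *\<^sub>R (A *v x)) has_vector_derivative A *v (flow A t *v x - x)) (at t)" for t
      using flow_vec_deriv[of A x t UNIV]
      by (auto intro!: derivative_eq_intros simp: matrix_vector_mult_diff_distrib)
    show "norm (A *v (flow A t *v x - x)) \<le> C * (K * C * s * norm x)" if t: "0 \<le> t" "t \<le> s" for t
    proof -
      have "norm (flow A t *v x - x) \<le> K * C * t * norm x" by (rule one[OF t(1)])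
      also have "\<dots> = (K * norm x) * C * t" by simp
      also have "\<dots> \<le> (K * norm x) * C * s" using t K0 C by (intro mult_left_mono) auto
      also have "\<dots> = K * C * s * norm x" by simp
      finally show ?thesis by (rule order_trans[OF C(2) mult_left_mono[OF _ C(1)]])
    qed
  qed simp
  then show "norm (flow A s *v x - x - s *\<^sub>R (A *v x)) \<le> K * C\<^sup>2 * s\<^sup>2 * norm x"
    by (simp add: mult_ac power2_eq_square)
qed

lemma psum_sq_integrable [simp]: "integrable ee (\<lambda>p. (psum p)\<^sup>2)"
  and psum_sq_integral: "(\<integral>p. (psum p)\<^sup>2 \<partial>ee) \<le> 8"
proof -
  have i: "integrable ee (\<lambda>p. 2 * (fst p)\<^sup>2 + 2 * (snd p)\<^sup>2)"
    using integrable_ee_fst[OF integrable_expm_power[of 2]] integrable_ee_snd[OF integrable_expm_power[of 2]] by simp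
  have le: "(psum p)\<^sup>2 \<le> 2 * (fst p)\<^sup>2 + 2 * (snd p)\<^sup>2" for p
    using sum_squares_bound[of "\<bar>fst p\<bar>" "\<bar>snd p\<bar>"] by (simp add: psum_def power2_sum)
  show j: "integrable ee (\<lambda>p. (psum p)\<^sup>2)"
    by (rule Bochner_Integration.integrable_bound[OF i])
       (use le in \<open>auto intro: order_trans[OF _ abs_ge_self]\<close>)
  have "(\<integral>p. (psum p)\<^sup>2 \<partial>ee) \<le> (\<integral>p. 2 * (fst p)\<^sup>2 + 2 * (snd p)\<^sup>2 \<partial>ee)"
    by (rule integral_mono[OF j i le])
  also have "\<dots> = 8"
    using integrable_ee_fst[OF integrable_expm_power[of 2]] integrable_ee_snd[OF integrable_expm_power[of 2]]
      integral_ee_fst[OF integrable_expm_power[of 2]] integral_ee_snd[OF integrable_expm_power[of 2]] by simp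
  finally show "(\<integral>p. (psum p)\<^sup>2 \<partial>ee) \<le> 8" .
qed

text \<open>A block of one jump suffices: the factor K is lost at most once per jump, while the mean
  holding time in either state is at least 1/\<beta> because both switching weights are at most
  1.\<close>

lemma (in switched) gamma_slow_switching:
  assumes K: "K \<ge> 1" "a > 0" and decay: "\<And>i s x. s \<ge> 0 \<Longrightarrow> norm (flow (A i) s *v x) \<le> K * exp (- a * s) * norm x"
  shows "\<gamma> \<le> ln K - a / \<beta>"
proof -
  have "\<psi> 1 z \<le> ln K - a / \<beta>" if z: "fst z \<noteq> 0" for z
  proof -
    have r: "1 / \<beta> \<le> 1 / rate i" for i
      using lam beta rate_pos[of i] by (intro divide_left_mono) (auto simp: rate_def switch_weight_def mult_left_le)
    have "inc z s \<le> ln K - a * (1 / rate (snd z)) * \<bar>s\<bar>" for s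
    proof -
      let ?t = "\<bar>s\<bar> / rate (snd z)"
      have "norm (fst (step z s)) \<le> K * exp (- a * ?t) * norm (fst z)"
        unfolding step_def fst_conv by (rule decay) (use rate_pos[of "snd z"] in simp)
      then have "ln (norm (fst (step z s))) \<le> ln (K * exp (- a * ?t) * norm (fst z))"
        using step_nz[OF z] by (intro ln_mono) auto
      also have "\<dots> = ln K - a * ?t + ln (norm (fst z))" using z K by (simp add: ln_mult)
      finally show ?thesis by (simp add: inc_def)
    qed
    then have "(\<integral>s. inc z s \<partial>expm) \<le> (\<integral>s. ln K - a * (1 / rate (snd z)) * \<bar>s\<bar> \<partial>expm)"
      by (intro integral_mono) auto
    also have "\<dots> = ln K - a * (1 / rate (snd z))" by simp
    also have "\<dots> \<le> ln K - a * (1 / \<beta>)" using mult_left_mono[OF r, of a "snd z"] K by simp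
    finally show ?thesis using psi_Suc[of 0 z] by simp
  qed
  from gamma_upper[OF this] show ?thesis by simp
qed

text \<open>\<open>lp\<close> is a left eigenvector of the averaged matrix for the positive
  eigenvalue, and \<open>rp\<close>, \<open>rm\<close> are right eigenvectors for both. The
  assumption \<open>dual\<close> expresses that the latter form a basis. The constant
  \<open>M\<close> gathers every bound, so that the error terms depend on \<beta> only through
  \<open>h\<close>; the locale is instantiated for all \<beta> with the same parameters.\<close>

locale saddle = switched_irreducible A lam \<beta> C for A :: "2 \<Rightarrow> real^2^2" and lam \<beta> C :: real +
  fixes lp rp rm :: "real^2" and K lamp lamm M :: real
  assumes flow_K: "\<And>i s x. s \<ge> 0 \<Longrightarrow> norm (flow (A i) s *v x) \<le> K * norm x"
    and left: "\<And>y. inner lp (((1 - lam) *\<^sub>R A 0 + lam *\<^sub>R A 1) *v y) = lamp * inner lp y"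
    and right: "((1 - lam) *\<^sub>R A 0 + lam *\<^sub>R A 1) *v rp = lamp *\<^sub>R rp"
      "((1 - lam) *\<^sub>R A 0 + lam *\<^sub>R A 1) *v rm = (- lamm) *\<^sub>R rm"
    and lamp: "lamp > 0" and lamm: "lamm > 0" and lp: "lp \<noteq> 0"
    and dual: "\<And>w. (norm w)\<^sup>2 \<le> M * ((inner w rp)\<^sup>2 + (inner w rm)\<^sup>2)"
    and M: "M \<ge> 1" "norm lp \<le> M" "norm rp \<le> M" "norm rm \<le> M" "lamp \<le> M" "K * K * C \<le> M" "K * K * C\<^sup>2 \<le> M"
begin

abbreviation Alam :: "real^2^2" where "Alam \<equiv> (1 - lam) *\<^sub>R A 0 + lam *\<^sub>R A 1"

lemma K_ge_1: "K \<ge> 1"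
  using flow_K[of 0 0 "axis 1 1"] by simp

lemma t_bounds: "0 \<le> \<bar>s\<bar> / rate i" "\<bar>fst p\<bar> / rate i + \<bar>snd p\<bar> / rate j \<le> h * psum p"
proof -
  show "0 \<le> \<bar>s\<bar> / rate i" using rate_pos[of i] by simp
  show "\<bar>fst p\<bar> / rate i + \<bar>snd p\<bar> / rate j \<le> h * psum p"
    using mult_right_mono[OF rate_le_h[of i], of "\<bar>fst p\<bar>"] mult_right_mono[OF rate_le_h[of j], of "\<bar>snd p\<bar>"]
    by (simp add: psum_def distrib_left)
qed

lemma cycle_first: "norm (cycle 0 y p - y) \<le> M * h * psum p * norm y"
proof -
  define t0 t1 where "t0 = \<bar>fst p\<bar> / rate 0" and "t1 = \<bar>snd p\<bar> / rate 1"
  have t: "t0 \<ge> 0" "t1 \<ge> 0" "t0 + t1 \<le> h * psum p" using t_bounds by (auto simp: t0_def t1_def)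
  define z where "z = flow (A 0) t0 *v y"
  have c: "cycle 0 y p = flow (A 1) t1 *v z" by (simp add: cycle_def z_def t0_def t1_def)
  have z: "norm z \<le> K * norm y" unfolding z_def by (rule flow_K[OF t(1)])
  have 1: "norm (z - y) \<le> K * C * t0 * norm y"
    unfolding z_def using C_pos t by (intro flow_taylor(1) C_bound flow_K) auto
  have "norm (flow (A 1) t1 *v z - z) \<le> K * C * t1 * norm z"
    using C_pos t by (intro flow_taylor(1) C_bound flow_K) auto
  also have "\<dots> \<le> K * C * t1 * (K * norm y)" using z C_pos K_ge_1 t by (intro mult_left_mono) auto
  finally have 2: "norm (flow (A 1) t1 *v z - z) \<le> K * K * C * t1 * norm y" by (simp add: mult_ac)
  have 3: "K * C * t0 * norm y \<le> K * K * C * t0 * norm y"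
    using K_ge_1 C_pos t by (intro mult_right_mono) auto
  have "norm (cycle 0 y p - y) \<le> K * K * C * t1 * norm y + K * K * C * t0 * norm y"
    unfolding c using norm_triangle_ineq[of "flow (A 1) t1 *v z - z" "z - y"] 1 2 3 by simp
  also have "\<dots> = (K * K * C) * (t0 + t1) * norm y" by (simp add: algebra_simps)
  also have "\<dots> \<le> M * (h * psum p) * norm y"
    using M t K_ge_1 C_pos by (intro mult_right_mono mult_mono) auto
  finally show ?thesis by (simp add: mult.assoc)
qed

lemma cycle_second:
  "norm (cycle 0 y p - y - (\<bar>fst p\<bar> / rate 0) *\<^sub>R (A 0 *v y) - (\<bar>snd p\<bar> / rate 1) *\<^sub>R (A 1 *v y))
    \<le> M * h\<^sup>2 * (psum p)\<^sup>2 * norm y"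
proof -
  define t0 t1 where "t0 = \<bar>fst p\<bar> / rate 0" and "t1 = \<bar>snd p\<bar> / rate 1"
  have t: "t0 \<ge> 0" "t1 \<ge> 0" "t0 + t1 \<le> h * psum p" using t_bounds by (auto simp: t0_def t1_def)
  define z where "z = flow (A 0) t0 *v y"
  have c: "cycle 0 y p = flow (A 1) t1 *v z" by (simp add: cycle_def z_def t0_def t1_def)
  have z: "norm z \<le> K * norm y" unfolding z_def by (rule flow_K[OF t(1)])
  have KK: "K \<le> K * K" using K_ge_1 by simp
  have "norm (flow (A 1) t1 *v z - z - t1 *\<^sub>R (A 1 *v z)) \<le> K * C\<^sup>2 * t1\<^sup>2 * norm z"
    using C_pos t by (intro flow_taylor(2) C_bound flow_K) auto
  also have "\<dots> \<le> K * C\<^sup>2 * t1\<^sup>2 * (K * norm y)" using z C_pos K_ge_1 t by (intro mult_left_mono) auto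
  finally have 1: "norm (flow (A 1) t1 *v z - z - t1 *\<^sub>R (A 1 *v z)) \<le> K * K * C\<^sup>2 * t1\<^sup>2 * norm y"
    by (simp add: mult_ac)
  have "norm (z - y) \<le> K * C * t0 * norm y"
    unfolding z_def using C_pos t by (intro flow_taylor(1) C_bound flow_K) auto
  then have "norm (A 1 *v (z - y)) \<le> C * (K * C * t0 * norm y)"
    using order_trans[OF C_bound mult_left_mono] C_pos by simp
  then have "t1 * norm (A 1 *v (z - y)) \<le> t1 * (C * (K * C * t0 * norm y))" using t by (intro mult_left_mono) auto
  also have "\<dots> = K * (C\<^sup>2 * t0 * t1 * norm y)" by (simp add: power2_eq_square mult_ac)
  also have "\<dots> \<le> K * K * (C\<^sup>2 * t0 * t1 * norm y)" using KK t by (intro mult_right_mono) auto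
  finally have 2: "norm (t1 *\<^sub>R (A 1 *v (z - y))) \<le> K * K * C\<^sup>2 * (t0 * t1) * norm y"
    using t by (simp add: mult_ac)
  have "norm (z - y - t0 *\<^sub>R (A 0 *v y)) \<le> K * C\<^sup>2 * t0\<^sup>2 * norm y"
    unfolding z_def using C_pos t by (intro flow_taylor(2) C_bound flow_K) auto
  also have "\<dots> \<le> K * K * C\<^sup>2 * t0\<^sup>2 * norm y" using KK by (intro mult_right_mono) auto
  finally have 3: "norm (z - y - t0 *\<^sub>R (A 0 *v y)) \<le> K * K * C\<^sup>2 * t0\<^sup>2 * norm y" .
  \<comment> \<open>The three remainders are the second-order error of the second flow, the effect
    of evaluating its generator at z instead of y, and the second-order error of the first flow. All
    are quadratic in the two holding times.\<close>
  have e: "cycle 0 y p - y - t0 *\<^sub>R (A 0 *v y) - t1 *\<^sub>R (A 1 *v y) =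
      (flow (A 1) t1 *v z - z - t1 *\<^sub>R (A 1 *v z)) + t1 *\<^sub>R (A 1 *v (z - y)) + (z - y - t0 *\<^sub>R (A 0 *v y))"
    unfolding c by (simp add: matrix_vector_mult_diff_distrib algebra_simps)
  have "norm (cycle 0 y p - y - t0 *\<^sub>R (A 0 *v y) - t1 *\<^sub>R (A 1 *v y))
      \<le> K * K * C\<^sup>2 * t1\<^sup>2 * norm y + K * K * C\<^sup>2 * (t0 * t1) * norm y + K * K * C\<^sup>2 * t0\<^sup>2 * norm y"
    unfolding e by (rule norm_triangle_le[OF add_mono[OF norm_triangle_le[OF add_mono[OF 1 2]] 3]])
  also have "\<dots> = (K * K * C\<^sup>2) * (t1\<^sup>2 + t0 * t1 + t0\<^sup>2) * norm y" by (simp add: algebra_simps)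
  also have "\<dots> \<le> M * (h * psum p)\<^sup>2 * norm y"
  proof (intro mult_right_mono mult_mono)
    have "t1\<^sup>2 + t0 * t1 + t0\<^sup>2 \<le> (t0 + t1)\<^sup>2" using t by (simp add: power2_sum)
    also have "\<dots> \<le> (h * psum p)\<^sup>2" using t by (intro power_mono) auto
    finally show "t1\<^sup>2 + t0 * t1 + t0\<^sup>2 \<le> (h * psum p)\<^sup>2" .
  qed (use M t in auto)
  finally show ?thesis unfolding t0_def t1_def by (simp add: power_mult_distrib mult.assoc)
qed

lemma inner_cycle_integrable [simp]: "integrable ee (\<lambda>p. inner w (cycle 0 y p))"
proof (rule ee.integrable_const_bound)
  have "norm (cycle 0 y p) \<le> K * (K * norm y)" for p
    unfolding cycle_def
    by (rule order_trans[OF flow_K[OF t_bounds(1)] mult_left_mono[OF flow_K[OF t_bounds(1)]]]) (use K_ge_1 in simp)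
  then show "AE p in ee. norm (inner w (cycle 0 y p)) \<le> norm w * (K * (K * norm y))"
    by (intro AE_I2) (metis Cauchy_Schwarz_ineq2 mult_left_mono norm_ge_zero order_trans real_norm_def)
qed measurable

text \<open>The mean holding times are h (1 - \<lambda>) and h \<lambda>, so the linear part of a
  cycle averages to h times the averaged matrix. The remainder is quadratic, and 8 bounds the second
  moment of \<open>psum\<close>.\<close>

lemma cycle_drift:
  "\<bar>(\<integral>p. inner w (cycle 0 y p - y) \<partial>ee) - h * inner w (Alam *v y)\<bar> \<le> 8 * M * h\<^sup>2 * norm w * norm y"
proof -
  define f where "f p = inner w (cycle 0 y p - y - (\<bar>fst p\<bar> / rate 0) *\<^sub>R (A 0 *v y) - (\<bar>snd p\<bar> / rate 1) *\<^sub>R (A 1 *v y))" for p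
  have i: "integrable ee (\<lambda>p. \<bar>fst p\<bar>)" "integrable ee (\<lambda>p. \<bar>snd p\<bar>)"
    using integrable_ee_fst[OF integrable_expm_ident(2)] integrable_ee_snd[OF integrable_expm_ident(2)] by auto
  have f: "f p = inner w (cycle 0 y p - y) - \<bar>fst p\<bar> * (inner w (A 0 *v y) / rate 0) - \<bar>snd p\<bar> * (inner w (A 1 *v y) / rate 1)" for p
    by (simp add: f_def inner_diff_right)
  have "(\<integral>p. f p \<partial>ee) = (\<integral>p. inner w (cycle 0 y p - y) \<partial>ee) - inner w (A 0 *v y) / rate 0 - inner w (A 1 *v y) / rate 1"
    unfolding f using i integral_ee_fst[OF integrable_expm_ident(2)] integral_ee_snd[OF integrable_expm_ident(2)]
    by (simp add: inner_diff_right)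
  moreover have "inner w (A 0 *v y) / rate 0 + inner w (A 1 *v y) / rate 1 = h * inner w (Alam *v y)"
  proof -
    have "inner w (A 0 *v y) / rate 0 + inner w (A 1 *v y) / rate 1
        = (1 / rate 0) * inner w (A 0 *v y) + (1 / rate 1) * inner w (A 1 *v y)" by simp
    also have "\<dots> = h * inner w (Alam *v y)" unfolding rate_0 rate_1
      by (simp add: matrix_vector_mult_add_rdistrib scaleR_matrix_vector_assoc[symmetric] inner_add_right algebra_simps)
    finally show ?thesis .
  qed
  moreover have "\<bar>\<integral>p. f p \<partial>ee\<bar> \<le> 8 * M * h\<^sup>2 * norm w * norm y"
  proof -
    have b: "\<bar>f p\<bar> \<le> M * h\<^sup>2 * norm w * norm y * (psum p)\<^sup>2" for p
    proof -
      have "\<bar>f p\<bar> \<le> norm w * (M * h\<^sup>2 * (psum p)\<^sup>2 * norm y)"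
        unfolding f_def by (rule order_trans[OF Cauchy_Schwarz_ineq2 mult_left_mono[OF cycle_second]]) simp
      then show ?thesis by (simp add: mult_ac)
    qed
    have fi: "integrable ee f" unfolding f using i by (simp add: inner_diff_right)
    have "\<bar>\<integral>p. f p \<partial>ee\<bar> \<le> (\<integral>p. \<bar>f p\<bar> \<partial>ee)" by (rule integral_abs_bound)
    also have "\<dots> \<le> (\<integral>p. M * h\<^sup>2 * norm w * norm y * (psum p)\<^sup>2 \<partial>ee)"
      using fi by (intro integral_mono b) auto
    also have "\<dots> = M * h\<^sup>2 * norm w * norm y * (\<integral>p. (psum p)\<^sup>2 \<partial>ee)" by simp
    also have "\<dots> \<le> M * h\<^sup>2 * norm w * norm y * 8"
      using M by (intro mult_left_mono psum_sq_integral) auto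
    finally show ?thesis by (simp add: mult_ac)
  qed
  ultimately show ?thesis by (simp add: algebra_simps)
qed

text \<open>For \<open>w = 0\<close>, this bounds the deviation of a row close to the left eigenvector \<open>lp\<close> over one
  cycle; the deviation \<open>w\<close> already present grows at most by the factor \<open>1 + 2 h lamp\<close> in mean square.\<close>

lemma cycle_second_moment:
  assumes y: "Alam *v y = \<nu> *\<^sub>R y" "\<nu> \<le> lamp" "norm y \<le> M"
  shows "integrable ee (\<lambda>p. (inner w (cycle 0 y p) + \<kappa> * (inner lp (cycle 0 y p) - (1 + h * lamp) * inner lp y))\<^sup>2)"
    and "(\<integral>p. (inner w (cycle 0 y p) + \<kappa> * (inner lp (cycle 0 y p) - (1 + h * lamp) * inner lp y))\<^sup>2 \<partial>ee)
      \<le> (1 + 2 * h * lamp) * (inner w y)\<^sup>2 + 60 * M ^ 6 * h\<^sup>2 * ((norm w)\<^sup>2 + \<kappa>\<^sup>2)"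
proof -
  define b where "b p = inner w (cycle 0 y p - y) + \<kappa> * (inner lp (cycle 0 y p - y) - h * lamp * inner lp y)" for p
  define a where "a = inner w y"
  define B where "B = norm w + \<bar>\<kappa>\<bar>"
  have B0: "B \<ge> 0" "norm w \<le> B" by (auto simp: B_def)
  have M0: "M \<ge> 0" using M by simp
  have lpy: "\<bar>inner lp y\<bar> \<le> M * M"
    by (rule order_trans[OF Cauchy_Schwarz_ineq2 mult_mono[OF M(2) y(3) M0]]) simp
  have ab: "inner w (cycle 0 y p) + \<kappa> * (inner lp (cycle 0 y p) - (1 + h * lamp) * inner lp y) = a + b p" for p
    by (simp add: a_def b_def inner_diff_right algebra_simps)
  have bi [simp]: "integrable ee b" unfolding b_def inner_diff_right by simp
  have bb: "\<bar>b p\<bar> \<le> M ^ 3 * h * B * (psum p + 1)" for p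
  proof -
    have Y: "norm (cycle 0 y p - y) \<le> M * h * psum p * M"
      by (rule order_trans[OF cycle_first mult_left_mono[OF y(3)]]) (use M0 h_pos in simp)
    have 1: "\<bar>inner w (cycle 0 y p - y)\<bar> \<le> norm w * (M * h * psum p * M)"
      by (rule order_trans[OF Cauchy_Schwarz_ineq2 mult_left_mono[OF Y]]) simp
    have 2: "\<bar>inner lp (cycle 0 y p - y)\<bar> \<le> M * (M * h * psum p * M)"
      by (rule order_trans[OF Cauchy_Schwarz_ineq2 mult_mono[OF M(2) Y]]) (use M0 in auto)
    have 3: "\<bar>h * lamp * inner lp y\<bar> \<le> h * M * (M * M)"
      unfolding abs_mult using h_pos lamp lpy M by (intro mult_mono) auto
    have "\<bar>b p\<bar> \<le> \<bar>inner w (cycle 0 y p - y)\<bar> + \<bar>\<kappa>\<bar> * (\<bar>inner lp (cycle 0 y p - y)\<bar> + \<bar>h * lamp * inner lp y\<bar>)"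
      unfolding b_def
      by (rule order_trans[OF abs_triangle_ineq add_left_mono], subst abs_mult)
         (intro mult_left_mono abs_triangle_ineq4 abs_ge_zero)
    also have "\<dots> \<le> norm w * (M * h * psum p * M) + \<bar>\<kappa>\<bar> * (M * (M * h * psum p * M) + h * M * (M * M))"
      using 1 2 3 by (intro add_mono mult_left_mono) auto
    also have "\<dots> \<le> norm w * (M ^ 3 * h * (psum p + 1)) + \<bar>\<kappa>\<bar> * (M ^ 3 * h * (psum p + 1))"
    proof (intro add_mono mult_left_mono)
      have "M * M \<le> M ^ 3" using M M0 by (simp add: power3_eq_cube mult_le_cancel_left1)
      then have "M * M * (h * psum p) \<le> M ^ 3 * (h * (psum p + 1))"
        using h_pos M0 by (intro mult_mono) auto
      then show "M * h * psum p * M \<le> M ^ 3 * h * (psum p + 1)" by (simp add: mult_ac)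
      show "M * (M * h * psum p * M) + h * M * (M * M) \<le> M ^ 3 * h * (psum p + 1)"
        by (simp add: power3_eq_cube algebra_simps)
    qed auto
    finally show ?thesis by (simp add: B_def algebra_simps)
  qed
  have b2: "(b p)\<^sup>2 \<le> M ^ 6 * h\<^sup>2 * B\<^sup>2 * ((psum p)\<^sup>2 + 2 * psum p + 1)" for p
  proof -
    have "(b p)\<^sup>2 \<le> (M ^ 3 * h * B * (psum p + 1))\<^sup>2"
      using bb[of p] by (metis abs_le_square_iff abs_ge_self order_trans)
    also have "\<dots> = M ^ 6 * h\<^sup>2 * B\<^sup>2 * ((psum p)\<^sup>2 + 2 * psum p + 1)"
      by (simp add: power_mult_distrib power2_sum power_mult[symmetric])
    finally show ?thesis .
  qed
  have b2i: "integrable ee (\<lambda>p. (b p)\<^sup>2)"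
  proof (rule Bochner_Integration.integrable_bound)
    show "integrable ee (\<lambda>p. M ^ 6 * h\<^sup>2 * B\<^sup>2 * ((psum p)\<^sup>2 + 2 * psum p + 1))" by simp
    show "AE p in ee. norm ((b p)\<^sup>2) \<le> norm (M ^ 6 * h\<^sup>2 * B\<^sup>2 * ((psum p)\<^sup>2 + 2 * psum p + 1))"
      using b2 by (intro AE_I2) (auto intro: order_trans[OF _ abs_ge_self])
  qed (use borel_measurable_integrable[OF bi] in measurable)
  have sq: "(a + b p)\<^sup>2 = a\<^sup>2 + 2 * a * b p + (b p)\<^sup>2" for p by (simp add: power2_sum algebra_simps)
  show "integrable ee (\<lambda>p. (inner w (cycle 0 y p) + \<kappa> * (inner lp (cycle 0 y p) - (1 + h * lamp) * inner lp y))\<^sup>2)"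
    unfolding ab sq using b2i by simp
  have int: "(\<integral>p. (a + b p)\<^sup>2 \<partial>ee) = a\<^sup>2 + 2 * a * (\<integral>p. b p \<partial>ee) + (\<integral>p. (b p)\<^sup>2 \<partial>ee)"
    unfolding sq using b2i by (simp add: ee.prob_space)
  have Ib2: "(\<integral>p. (b p)\<^sup>2 \<partial>ee) \<le> 13 * (M ^ 6 * h\<^sup>2 * B\<^sup>2)"
  proof -
    have "(\<integral>p. (b p)\<^sup>2 \<partial>ee) \<le> (\<integral>p. M ^ 6 * h\<^sup>2 * B\<^sup>2 * ((psum p)\<^sup>2 + 2 * psum p + 1) \<partial>ee)"
      by (intro integral_mono b2 b2i) simp
    also have "\<dots> = M ^ 6 * h\<^sup>2 * B\<^sup>2 * ((\<integral>p. (psum p)\<^sup>2 \<partial>ee) + 5)"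
      by (simp add: psum_integral ee.prob_space)
    also have "\<dots> \<le> M ^ 6 * h\<^sup>2 * B\<^sup>2 * (8 + 5)"
      using M0 by (intro mult_left_mono add_right_mono psum_sq_integral) auto
    finally show ?thesis by simp
  qed
  \<comment> \<open>To first order in h, the new contribution along \<open>lp\<close> has mean zero
    because \<open>lp\<close> is a left eigenvector for \<open>lamp\<close>, and the old deviation
    \<open>w\<close> contributes h \<nu> a because y is a right eigenvector. Only errors of order
    h^2 remain.\<close>
  have Ib: "\<bar>(\<integral>p. b p \<partial>ee) - h * \<nu> * a\<bar> \<le> 8 * M ^ 3 * h\<^sup>2 * B"
  proof -
    define R where "R w = (\<integral>p. inner w (cycle 0 y p - y) \<partial>ee) - h * inner w (Alam *v y)" for w
    define I where "I w = (\<integral>p. inner w (cycle 0 y p - y) \<partial>ee)" for w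
    have i: "integrable ee (\<lambda>p. inner w (cycle 0 y p - y))" for w unfolding inner_diff_right by simp
    have "(\<integral>p. b p \<partial>ee) = I w + \<kappa> * (I lp - h * lamp * inner lp y)"
      unfolding b_def I_def using i by (simp add: ee.prob_space)
    moreover have "inner w (Alam *v y) = \<nu> * a" unfolding y(1) a_def by simp
    ultimately have "(\<integral>p. b p \<partial>ee) - h * \<nu> * a = R w + \<kappa> * R lp"
      unfolding R_def left I_def[symmetric] by (simp add: algebra_simps)
    moreover have "\<bar>R w\<bar> \<le> 8 * M ^ 3 * h\<^sup>2 * norm w"
    proof -
      have "\<bar>R w\<bar> \<le> 8 * M * h\<^sup>2 * norm w * norm y" unfolding R_def by (rule cycle_drift)
      also have "\<dots> \<le> 8 * M * h\<^sup>2 * norm w * (M * M)"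
        using M0 M y(3) by (intro mult_left_mono) (auto intro: order_trans[of _ M] simp: mult_le_cancel_left1)
      finally show ?thesis by (simp add: power3_eq_cube mult_ac)
    qed
    moreover have "\<bar>\<kappa> * R lp\<bar> \<le> 8 * M ^ 3 * h\<^sup>2 * \<bar>\<kappa>\<bar>"
    proof -
      have "\<bar>R lp\<bar> \<le> 8 * M * h\<^sup>2 * norm lp * norm y" unfolding R_def by (rule cycle_drift)
      also have "\<dots> \<le> 8 * M * h\<^sup>2 * M * M"
        using M0 M y(3) by (intro mult_mono) auto
      finally have "\<bar>\<kappa>\<bar> * \<bar>R lp\<bar> \<le> \<bar>\<kappa>\<bar> * (8 * M * h\<^sup>2 * M * M)" by (intro mult_left_mono) auto
      then show ?thesis by (simp add: abs_mult power3_eq_cube mult_ac)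
    qed
    ultimately show ?thesis unfolding B_def distrib_left by linarith
  qed
  have aB: "\<bar>a\<bar> \<le> B * M" unfolding a_def
    by (rule order_trans[OF Cauchy_Schwarz_ineq2 mult_mono]) (use B0 y(3) M0 in auto)
  have "a * (\<integral>p. b p \<partial>ee) = h * \<nu> * a\<^sup>2 + a * ((\<integral>p. b p \<partial>ee) - h * \<nu> * a)"
    by (simp add: power2_eq_square algebra_simps)
  also have "\<dots> \<le> h * lamp * a\<^sup>2 + \<bar>a\<bar> * \<bar>(\<integral>p. b p \<partial>ee) - h * \<nu> * a\<bar>"
  proof (rule add_mono)
    show "h * \<nu> * a\<^sup>2 \<le> h * lamp * a\<^sup>2" using y(2) h_pos by (intro mult_right_mono mult_left_mono) auto
    show "a * ((\<integral>p. b p \<partial>ee) - h * \<nu> * a) \<le> \<bar>a\<bar> * \<bar>(\<integral>p. b p \<partial>ee) - h * \<nu> * a\<bar>"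
      by (metis abs_ge_self abs_mult)
  qed
  also have "\<dots> \<le> h * lamp * a\<^sup>2 + (B * M) * (8 * M ^ 3 * h\<^sup>2 * B)"
    using aB Ib B0 M0 by (intro add_left_mono mult_mono) auto
  also have "(B * M) * (8 * M ^ 3 * h\<^sup>2 * B) = 8 * (M ^ 4 * (h\<^sup>2 * B\<^sup>2))"
    by (simp add: power2_eq_square power3_eq_cube power4_eq_xxxx mult_ac)
  also have "\<dots> \<le> 8 * (M ^ 6 * (h\<^sup>2 * B\<^sup>2))"
    using M(1) by (intro mult_left_mono mult_right_mono power_increasing) auto
  finally have aI: "2 * a * (\<integral>p. b p \<partial>ee) \<le> 2 * h * lamp * a\<^sup>2 + 12 * (M ^ 6 * h\<^sup>2 * B\<^sup>2) + 4 * (M ^ 6 * h\<^sup>2 * B\<^sup>2)"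
    by (simp add: mult_ac)
  have B2: "B\<^sup>2 \<le> 2 * ((norm w)\<^sup>2 + \<kappa>\<^sup>2)"
    using sum_squares_bound[of "norm w" "\<bar>\<kappa>\<bar>"] by (simp add: B_def power2_sum)
  \<comment> \<open>The constant 29 is 13 from the square of \<open>b\<close> plus 16 from the mixed
    term; the factor 2 in \<open>B2\<close> doubles it to 58, rounded up to 60.\<close>
  have "(\<integral>p. (a + b p)\<^sup>2 \<partial>ee) \<le> (1 + 2 * h * lamp) * a\<^sup>2 + 29 * (M ^ 6 * h\<^sup>2 * B\<^sup>2)"
  proof -
    have "(1 + 2 * h * lamp) * a\<^sup>2 = a\<^sup>2 + 2 * h * lamp * a\<^sup>2" by (simp add: distrib_right)
    then show ?thesis unfolding int using Ib2 aI by linarith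
  qed
  also have "29 * (M ^ 6 * h\<^sup>2 * B\<^sup>2) \<le> 29 * (M ^ 6 * h\<^sup>2 * (2 * ((norm w)\<^sup>2 + \<kappa>\<^sup>2)))"
    using B2 M0 by (intro mult_left_mono) auto
  also have "\<dots> = 58 * (M ^ 6 * h\<^sup>2 * ((norm w)\<^sup>2 + \<kappa>\<^sup>2))" by simp
  also have "\<dots> \<le> 60 * (M ^ 6 * h\<^sup>2 * ((norm w)\<^sup>2 + \<kappa>\<^sup>2))"
    using M0 by (intro mult_right_mono) auto
  also have "\<dots> = 60 * M ^ 6 * h\<^sup>2 * ((norm w)\<^sup>2 + \<kappa>\<^sup>2)" by simp
  finally show "(\<integral>p. (inner w (cycle 0 y p) + \<kappa> * (inner lp (cycle 0 y p) - (1 + h * lamp) * inner lp y))\<^sup>2 \<partial>ee)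
      \<le> (1 + 2 * h * lamp) * (inner w y)\<^sup>2 + 60 * M ^ 6 * h\<^sup>2 * ((norm w)\<^sup>2 + \<kappa>\<^sup>2)"
    unfolding ab a_def by simp
qed

section \<open>Second-moment recursion for the row started from the left eigenvector\<close>

definition growth_factor :: real where "growth_factor = 1 + h * lamp"

text \<open>Deviation of the row vector \<open>lp\<close> times the product of n cycles from its
  first-order prediction. Keeping the whole row, not its pairing with one vector, controls all
  initial vectors at once, in particular the random vector produced by a preceding cycle.\<close>

definition dev :: "nat \<Rightarrow> (nat \<Rightarrow> real) \<Rightarrow> real^2" where
  "dev n e = (\<chi> j. inner lp (X (2 * n) (axis j 1, 0) e) - growth_factor ^ n * lp $ j)"

text \<open>In the coordinates given by pairing with \<open>rp\<close> and \<open>rm\<close>, the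
  averaged cycle acts diagonally to first order, with factors 1 + h \<open>lamp\<close> and 1 - h
  \<open>lamm\<close>. This avoids constants that would accumulate over n cycles.\<close>

definition dev_sq :: "nat \<Rightarrow> (nat \<Rightarrow> real) \<Rightarrow> real" where
  "dev_sq n e = (inner (dev n e) rp)\<^sup>2 + (inner (dev n e) rm)\<^sup>2"

lemma inner_dev: "inner (dev n e) y = inner lp (X (2 * n) (y, 0) e) - growth_factor ^ n * inner lp y"
proof -
  have y: "y = y$1 *\<^sub>R axis 1 1 + y$2 *\<^sub>R axis 2 1"
    by (simp add: vec2_eq_iff axis_def)
  have "X (2 * n) (y, 0) e = y$1 *\<^sub>R X (2 * n) (axis 1 1, 0) e + y$2 *\<^sub>R X (2 * n) (axis 2 1, 0) e"
    by (subst y) (simp add: linear_add[OF X_linear] linear_scale[OF X_linear])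
  then show ?thesis
    by (simp add: dev_def inner_vec2[of _ y] inner_add_right) (simp add: algebra_simps)
qed

text \<open>The new cycle is put in front. It acts first on \<open>y\<close>, hence multiplies the
  row from the right, and is independent of the old deviation.\<close>

lemma inner_dev_case_nat:
  "inner (dev (Suc n) (cons2 p e)) y =
    inner (dev n e) (cycle 0 y p) + growth_factor ^ n * (inner lp (cycle 0 y p) - (1 + h * lamp) * inner lp y)"
  by (simp add: inner_dev X_case_nat step_step growth_factor_def algebra_simps)

lemma X_bounded: "norm (X n z e) \<le> K ^ n * norm (fst z)"
proof (induction n)
  case (Suc n)
  have "norm (X (Suc n) z e) \<le> K * norm (X n z e)"
    unfolding X_Suc by (intro flow_K) (use rate_pos in \<open>simp add: less_imp_le\<close>)
  also have "\<dots> \<le> K * (K ^ n * norm (fst z))" using Suc K_ge_1 by (intro mult_left_mono) auto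
  finally show ?case by simp
qed simp

lemma dev_sq_measurable [measurable]: "dev_sq n \<in> borel_measurable seqm"
  unfolding dev_sq_def[abs_def] inner_dev by measurable

lemma dev_sq_integrable [simp]: "integrable seqm (dev_sq n)"
proof -
  have b: "\<bar>inner (dev n e) y\<bar> \<le> norm lp * (K ^ (2 * n) * norm y) + \<bar>growth_factor ^ n * inner lp y\<bar>" for y e
  proof -
    have "\<bar>inner lp (X (2 * n) (y, 0) e)\<bar> \<le> norm lp * (K ^ (2 * n) * norm y)"
      using order_trans[OF Cauchy_Schwarz_ineq2 mult_left_mono[OF X_bounded[of "2 * n" "(y, 0)"]]] by simp
    then show ?thesis unfolding inner_dev by linarith
  qed
  have "integrable seqm (\<lambda>e. (inner (dev n e) y)\<^sup>2)" for y
  proof (rule seqm.integrable_const_bound)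
    show "AE e in seqm. norm ((inner (dev n e) y)\<^sup>2) \<le> (norm lp * (K ^ (2 * n) * norm y) + \<bar>growth_factor ^ n * inner lp y\<bar>)\<^sup>2"
    proof (rule AE_I2)
      fix e
      have "\<bar>inner (dev n e) y\<bar>\<^sup>2 \<le> (norm lp * (K ^ (2 * n) * norm y) + \<bar>growth_factor ^ n * inner lp y\<bar>)\<^sup>2"
        by (rule power_mono[OF b]) simp
      then show "norm ((inner (dev n e) y)\<^sup>2) \<le> (norm lp * (K ^ (2 * n) * norm y) + \<bar>growth_factor ^ n * inner lp y\<bar>)\<^sup>2" by simp
    qed
    show "(\<lambda>e. (inner (dev n e) y)\<^sup>2) \<in> borel_measurable seqm" unfolding inner_dev by measurable
  qed
  then show ?thesis unfolding dev_sq_def[abs_def] by simp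
qed

lemma growth_factor_ge_1: "growth_factor \<ge> 1"
  using h_pos lamp by (simp add: growth_factor_def)

text \<open>The second-moment bound is used for \<open>rp\<close> and for \<open>rm\<close>, whence
  120 = 2 * 60. The squared norm of the deviation is turned back into \<open>dev_sq\<close> by
  \<open>dual\<close>, which costs one more factor M.\<close>

lemma dev_sq_step:
  "(\<integral>e. dev_sq (Suc n) e \<partial>seqm) \<le>
    (growth_factor\<^sup>2 + 120 * M ^ 7 * h\<^sup>2) * (\<integral>e. dev_sq n e \<partial>seqm) + 120 * M ^ 7 * h\<^sup>2 * growth_factor ^ (2 * n)"
proof -
  define \<kappa> where "\<kappa> = growth_factor ^ n"
  have M0: "M \<ge> 0" using M by simp
  have rm: "Alam *v rm = (- lamm) *\<^sub>R rm" "- lamm \<le> lamp" using right lamp lamm by auto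
  have "(\<integral>e. dev_sq (Suc n) e \<partial>seqm) = (\<integral>e. \<integral>p. dev_sq (Suc n) (cons2 p e) \<partial>ee \<partial>seqm)"
    by (rule integral_case_nat2) simp
  also have "\<dots> \<le> (\<integral>e. (growth_factor\<^sup>2 + 120 * M ^ 7 * h\<^sup>2) * dev_sq n e + 120 * M ^ 7 * h\<^sup>2 * \<kappa>\<^sup>2 \<partial>seqm)"
  proof (rule integral_mono)
    show "integrable seqm (\<lambda>e. \<integral>p. dev_sq (Suc n) (cons2 p e) \<partial>ee)"
      by (rule integrable_outer_case_nat2) simp
    fix e
    let ?w = "dev n e"
    have "(\<integral>p. dev_sq (Suc n) (cons2 p e) \<partial>ee)
      \<le> ((1 + 2 * h * lamp) * (inner ?w rp)\<^sup>2 + 60 * M ^ 6 * h\<^sup>2 * ((norm ?w)\<^sup>2 + \<kappa>\<^sup>2))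
       + ((1 + 2 * h * lamp) * (inner ?w rm)\<^sup>2 + 60 * M ^ 6 * h\<^sup>2 * ((norm ?w)\<^sup>2 + \<kappa>\<^sup>2))"
      unfolding dev_sq_def inner_dev_case_nat \<kappa>_def
      by (subst Bochner_Integration.integral_add)
         (intro add_mono cycle_second_moment[OF right(1) order_refl M(3)] cycle_second_moment[OF rm M(4)])+
    also have "\<dots> = (1 + 2 * h * lamp) * dev_sq n e + 120 * M ^ 6 * h\<^sup>2 * (norm ?w)\<^sup>2 + 120 * M ^ 6 * h\<^sup>2 * \<kappa>\<^sup>2"
      by (simp add: dev_sq_def algebra_simps)
    also have "\<dots> \<le> growth_factor\<^sup>2 * dev_sq n e + 120 * M ^ 7 * h\<^sup>2 * dev_sq n e + 120 * M ^ 7 * h\<^sup>2 * \<kappa>\<^sup>2"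
    proof (intro add_mono mult_right_mono)
      show "1 + 2 * h * lamp \<le> growth_factor\<^sup>2" by (simp add: growth_factor_def power2_sum)
      show "0 \<le> dev_sq n e" by (simp add: dev_sq_def)
      have "120 * M ^ 6 * h\<^sup>2 * (norm ?w)\<^sup>2 \<le> 120 * M ^ 6 * h\<^sup>2 * (M * dev_sq n e)"
        unfolding dev_sq_def using M0 by (intro mult_left_mono dual) auto
      also have "\<dots> = 120 * M ^ 7 * h\<^sup>2 * dev_sq n e" by (simp add: power_numeral_reduce)
      finally show "120 * M ^ 6 * h\<^sup>2 * (norm ?w)\<^sup>2 \<le> 120 * M ^ 7 * h\<^sup>2 * dev_sq n e" .
      show "120 * M ^ 6 \<le> 120 * M ^ 7" using M by (intro mult_left_mono power_increasing) auto
    qed auto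
    finally show "(\<integral>p. dev_sq (Suc n) (cons2 p e) \<partial>ee)
        \<le> (growth_factor\<^sup>2 + 120 * M ^ 7 * h\<^sup>2) * dev_sq n e + 120 * M ^ 7 * h\<^sup>2 * \<kappa>\<^sup>2"
      by (simp add: distrib_right)
  qed simp
  also have "\<dots> = (growth_factor\<^sup>2 + 120 * M ^ 7 * h\<^sup>2) * (\<integral>e. dev_sq n e \<partial>seqm) + 120 * M ^ 7 * h\<^sup>2 * \<kappa>\<^sup>2"
    by simp
  also have "\<kappa>\<^sup>2 = growth_factor ^ (2 * n)" by (simp add: \<kappa>_def power_mult[symmetric] mult.commute)
  finally show ?thesis .
qed

text \<open>The recursion v' = (g^2 + c) v + c g^(2n) with v = 0 at the start is dominated, since
  g^2 >= 1, by g^2 ((1 + c) v + c g^(2n)), whose solution is g^(2n) ((1 + c)^n - 1).\<close>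

lemma dev_sq_integral:
  "(\<integral>e. dev_sq n e \<partial>seqm) \<le> growth_factor ^ (2 * n) * ((1 + 120 * M ^ 7 * h\<^sup>2) ^ n - 1)"
proof (induction n)
  case 0
  show ?case by (simp add: dev_sq_def inner_dev)
next
  case (Suc n)
  define c where "c = 120 * M ^ 7 * h\<^sup>2"
  define g where "g = growth_factor"
  have c: "c \<ge> 0" using M by (simp add: c_def)
  have g: "g\<^sup>2 \<ge> 1" using growth_factor_ge_1 by (simp add: g_def)
  have p: "1 \<le> (1 + c) ^ n" using c by simp
  have "(\<integral>e. dev_sq (Suc n) e \<partial>seqm) \<le> (g\<^sup>2 + c) * (\<integral>e. dev_sq n e \<partial>seqm) + c * g ^ (2 * n)"
    unfolding c_def g_def by (rule dev_sq_step)
  also have "\<dots> \<le> (g\<^sup>2 + c) * (g ^ (2 * n) * ((1 + c) ^ n - 1)) + c * g ^ (2 * n)"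
    using Suc c g unfolding c_def[symmetric] g_def[symmetric] by (intro add_right_mono mult_left_mono) auto
  also have "\<dots> = g ^ (2 * n) * ((g\<^sup>2 + c) * ((1 + c) ^ n - 1) + c)" by (simp add: algebra_simps)
  also have "\<dots> \<le> g ^ (2 * n) * (g\<^sup>2 * ((1 + c) * ((1 + c) ^ n - 1) + c))"
  proof (rule mult_left_mono)
    have "c * ((1 + c) ^ n - 1) + c \<le> g\<^sup>2 * (c * ((1 + c) ^ n - 1) + c)"
    proof -
      have "0 \<le> c * ((1 + c) ^ n - 1) + c" using c p by simp
      from mult_right_mono[OF g this] show ?thesis by simp
    qed
    then show "(g\<^sup>2 + c) * ((1 + c) ^ n - 1) + c \<le> g\<^sup>2 * ((1 + c) * ((1 + c) ^ n - 1) + c)"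
      by (simp add: algebra_simps)
  qed (simp add: power_mult)
  also have "\<dots> = g ^ (2 * Suc n) * ((1 + c) ^ Suc n - 1)"
    by (simp add: algebra_simps power2_eq_square)
  finally show ?case unfolding c_def g_def .
qed

lemma dev_tail:
  assumes "\<eta> > 0"
  shows "measure seqm {e \<in> space seqm. dev_sq n e \<ge> \<eta> * growth_factor ^ (2 * n)}
    \<le> ((1 + 120 * M ^ 7 * h\<^sup>2) ^ n - 1) / \<eta>"
proof -
  have g: "growth_factor ^ (2 * n) > 0" using growth_factor_ge_1 by simp
  have "measure seqm {e \<in> space seqm. dev_sq n e \<ge> \<eta> * growth_factor ^ (2 * n)}
      \<le> (\<integral>e. dev_sq n e \<partial>seqm) / (\<eta> * growth_factor ^ (2 * n))"
  proof (rule integral_Markov_inequality_measure[where A = "{}"])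
    show "AE e in seqm. 0 \<le> dev_sq n e" by (simp add: dev_sq_def)
  qed (use assms g in simp_all)
  also have "\<dots> \<le> growth_factor ^ (2 * n) * ((1 + 120 * M ^ 7 * h\<^sup>2) ^ n - 1) / (\<eta> * growth_factor ^ (2 * n))"
    using assms g by (intro divide_right_mono dev_sq_integral) auto
  also have "\<dots> = ((1 + 120 * M ^ 7 * h\<^sup>2) ^ n - 1) / \<eta>"
    using growth_factor_ge_1 by simp
  finally show ?thesis .
qed

end

text \<open>The guaranteed growth is n h \<nu> / 2. Half of it pays for the logarithm of \<kappa> h,
  which is possible because n h is at least h to the power -1/2; the exponent c n h^2 of the error
  stays below 2 c times the square root of h.\<close>

lemma averaging_scale:
  fixes c \<nu> \<kappa> \<epsilon> N :: real
  assumes "c > 0" "\<nu> > 0" "\<kappa> > 0" "\<epsilon> > 0"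
  shows "\<exists>h0>0. \<forall>h::real. 0 < h \<and> h < h0 \<longrightarrow> (\<exists>n::nat. n \<ge> 1 \<and> real n \<ge> N \<and> (1 + c * h\<^sup>2) ^ n - 1 \<le> \<epsilon> \<and>
      n * h * \<nu> / 4 \<le> n * ln (1 + h * \<nu>) + ln (\<kappa> * h))"
proof -
  have "((\<lambda>h. exp (2 * c * sqrt h) - 1) \<longlongrightarrow> 0) (at_right 0)" using assms by real_asymp
  then have 1: "\<forall>\<^sub>F h in at_right 0. exp (2 * c * sqrt h) - 1 < \<epsilon>" using assms by (intro order_tendstoD(2)) auto
  have "((\<lambda>h. h * \<nu>) \<longlongrightarrow> 0) (at_right 0)" using assms by real_asymp
  then have 2: "\<forall>\<^sub>F h in at_right 0. h * \<nu> < 1 / 2" by (intro order_tendstoD(2)) auto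
  have "filterlim (\<lambda>h. \<nu> / (4 * sqrt h) + ln (\<kappa> * h)) at_top (at_right 0)" using assms by real_asymp
  then have 3: "\<forall>\<^sub>F h in at_right 0. 0 \<le> \<nu> / (4 * sqrt h) + ln (\<kappa> * h)" unfolding filterlim_at_top by blast
  have "filterlim (\<lambda>h::real. 1 / (h * sqrt h)) at_top (at_right 0)" by real_asymp
  then have 4: "\<forall>\<^sub>F h in at_right 0. max N 1 \<le> 1 / (h * sqrt h)" unfolding filterlim_at_top by blast
  have "\<forall>\<^sub>F h in at_right (0::real). exp (2 * c * sqrt h) - 1 < \<epsilon> \<and> h * \<nu> < 1 / 2 \<and>
      0 \<le> \<nu> / (4 * sqrt h) + ln (\<kappa> * h) \<and> max N 1 \<le> 1 / (h * sqrt h)"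
    using 1 2 3 4 by eventually_elim auto
  then obtain h0 where "h0 > 0" and h0: "\<And>h. 0 < h \<Longrightarrow> h < h0 \<Longrightarrow> exp (2 * c * sqrt h) - 1 < \<epsilon> \<and> h * \<nu> < 1 / 2 \<and>
      0 \<le> \<nu> / (4 * sqrt h) + ln (\<kappa> * h) \<and> max N 1 \<le> 1 / (h * sqrt h)"
    unfolding eventually_at_right_field by auto
  show ?thesis
  proof (intro exI[of _ h0] conjI allI impI)
    fix h assume h: "0 < h \<and> h < h0"
    define v where "v = 1 / (h * sqrt h)"
    \<comment> \<open>Rounding up at most doubles the value, because v >= 1.\<close>
    define n where "n = nat \<lceil>v\<rceil>"
    note * = h0[of h, folded v_def]
    have v: "v \<ge> 1" "v \<ge> N" using * h by auto
    have n: "v \<le> n" "real n \<le> 2 * v" using v unfolding n_def by linarith+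
    have nh2: "n * h\<^sup>2 \<le> 2 * sqrt h"
    proof -
      have "n * h\<^sup>2 \<le> 2 * v * h\<^sup>2" using n by (intro mult_right_mono) auto
      also have "\<dots> = 2 * sqrt h" using h by (simp add: v_def power2_eq_square real_div_sqrt field_simps)
      finally show ?thesis .
    qed
    have nh: "1 / sqrt h \<le> n * h"
    proof -
      have "1 / sqrt h = v * h" using h by (simp add: v_def)
      also have "\<dots> \<le> n * h" using n h by (intro mult_right_mono) auto
      finally show ?thesis .
    qed
    have "(1 + c * h\<^sup>2) ^ n \<le> exp (c * h\<^sup>2) ^ n"
      using assms by (intro power_mono exp_ge_add_one_self) auto
    also have "\<dots> = exp (c * (n * h\<^sup>2))" by (simp add: exp_of_nat_mult[symmetric] mult_ac)
    also have "\<dots> \<le> exp (c * (2 * sqrt h))" using nh2 assms by simp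
    finally have a: "(1 + c * h\<^sup>2) ^ n - 1 \<le> \<epsilon>" using * h by (simp add: mult_ac)
    \<comment> \<open>With y = h \<nu> < 1/2, this feeds ln(1 + y) >= y - y^2 >= y/2.\<close>
    have "h * \<nu> / 2 \<le> h * \<nu> - (h * \<nu>)\<^sup>2"
    proof -
      have "(h * \<nu>) * (h * \<nu>) \<le> (h * \<nu>) * (1 / 2)" using * h assms by (intro mult_left_mono) auto
      then show ?thesis unfolding power2_eq_square by linarith
    qed
    also have "\<dots> \<le> ln (1 + h * \<nu>)" using * h assms by (intro ln_one_plus_pos_lower_bound) auto
    finally have "n * (h * \<nu> / 2) \<le> n * ln (1 + h * \<nu>)" by (intro mult_left_mono) auto
    moreover have "- ln (\<kappa> * h) \<le> n * h * \<nu> / 4"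
    proof -
      have "- ln (\<kappa> * h) \<le> 1 / sqrt h * (\<nu> / 4)" using * h by (simp add: field_simps)
      also have "\<dots> \<le> n * h * (\<nu> / 4)" using nh assms by (intro mult_right_mono) auto
      finally show ?thesis by simp
    qed
    ultimately have b: "n * h * \<nu> / 4 \<le> n * ln (1 + h * \<nu>) + ln (\<kappa> * h)" by simp
    have "n \<ge> 1" "real n \<ge> N" using n v by auto
    with a b show "\<exists>n::nat. n \<ge> 1 \<and> real n \<ge> N \<and> (1 + c * h\<^sup>2) ^ n - 1 \<le> \<epsilon> \<and>
      n * h * \<nu> / 4 \<le> n * ln (1 + h * \<nu>) + ln (\<kappa> * h)" by blast
  qed (rule \<open>h0 > 0\<close>)
qed

text \<open>The expression is the limit of the pairing divided by h, in homogeneous coordinates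
  \<open>u\<close> for the ratio of inner w x to h. At the infinite ratio only the second coordinate
  remains. At a finite ratio \<open>x\<close> is orthogonal to \<open>lp\<close>, the two linear
  coefficients sum to 0 since \<open>lp\<close> is a left eigenvector, and if one vanished,
  \<open>x\<close> would be a common eigenvector; so the expression depends properly on the second
  holding time.\<close>

lemma (in saddle) first_order_nonzero:
  assumes x: "norm x = 1" and u: "(fst u)\<^sup>2 + (snd u)\<^sup>2 = 1" and lx: "fst u \<noteq> 0 \<Longrightarrow> inner lp x = 0"
  shows "AE p in ee. snd u + fst u * ((1 - lam) * \<bar>fst p\<bar> * inner lp (A 0 *v x) + lam * \<bar>snd p\<bar> * inner lp (A 1 *v x)) \<noteq> 0"
proof (cases "fst u = 0")
  case True
  then show ?thesis using u by auto
next
  case False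
  have lx: "inner lp x = 0" by (rule lx[OF False])
  have x0: "x \<noteq> 0" using x by auto
  define b0 b1 where "b0 = (1 - lam) * inner lp (A 0 *v x)" and "b1 = lam * inner lp (A 1 *v x)"
  have sum: "b0 + b1 = 0"
    using left[of x] lx
    by (simp add: b0_def b1_def matrix_vector_mult_add_rdistrib scaleR_matrix_vector_assoc[symmetric] inner_add_right)
  have b1: "b1 \<noteq> 0"
  proof
    assume b1: "b1 = 0"
    then have "inner lp (A 1 *v x) = 0" "inner lp (A 0 *v x) = 0"
      using sum lam by (auto simp: b0_def b1_def)
    then show False
      using parallel_2[OF lp x0 lx] no_common[OF x0] by metis
  qed
  have "AE p in ee. snd u + fst u * (b0 * \<bar>fst p\<bar> + b1 * \<bar>snd p\<bar>) \<noteq> 0"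
  proof (rule ee.AE_pair_measure)
    show "{p \<in> space ee. snd u + fst u * (b0 * \<bar>fst p\<bar> + b1 * \<bar>snd p\<bar>) \<noteq> 0} \<in> sets ee" by measurable
    have "AE s' in expm. snd u + fst u * (b0 * \<bar>s\<bar> + b1 * \<bar>s'\<bar>) \<noteq> 0" for s
    proof -
      define r where "r = (- snd u / fst u - b0 * \<bar>s\<bar>) / b1"
      have "AE s' in expm. s' \<notin> {r, - r}" by (rule AE_expm_countable) simp
      then show ?thesis
      proof eventually_elim
        case (elim s')
        show ?case
        proof
          assume "snd u + fst u * (b0 * \<bar>s\<bar> + b1 * \<bar>s'\<bar>) = 0"
          then have "\<bar>s'\<bar> = r" using False b1 by (simp add: r_def field_simps) 
          then show False using elim by (auto simp: abs_if split: if_splits)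
        qed
      qed
    qed
    then show "AE s in expm. AE s' in expm. snd u + fst u * (b0 * \<bar>fst (s, s')\<bar> + b1 * \<bar>snd (s, s')\<bar>) \<noteq> 0" by simp
  qed
  then show ?thesis by (simp add: b0_def b1_def mult_ac)
qed

lemma (in saddle) cycle_expansion:
  "\<bar>inner w (cycle 0 y p) / h - (inner w y / h + (1 - lam) * \<bar>fst p\<bar> * inner w (A 0 *v y) + lam * \<bar>snd p\<bar> * inner w (A 1 *v y))\<bar>
    \<le> norm w * (M * h * (psum p)\<^sup>2 * norm y)"
proof -
  let ?r = "cycle 0 y p - y - (\<bar>fst p\<bar> / rate 0) *\<^sub>R (A 0 *v y) - (\<bar>snd p\<bar> / rate 1) *\<^sub>R (A 1 *v y)"
  have "\<bar>inner w ?r\<bar> \<le> norm w * (M * h\<^sup>2 * (psum p)\<^sup>2 * norm y)"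
    by (rule order_trans[OF Cauchy_Schwarz_ineq2 mult_left_mono[OF cycle_second]]) simp
  then have "\<bar>inner w ?r / h\<bar> \<le> norm w * (M * h * (psum p)\<^sup>2 * norm y)"
    using h_pos by (simp add: abs_divide field_simps power2_eq_square)
  moreover have r: "\<bar>fst p\<bar> / rate 0 = h * (1 - lam) * \<bar>fst p\<bar>" "\<bar>snd p\<bar> / rate 1 = h * lam * \<bar>snd p\<bar>"
    using rate_0 rate_1 by (metis mult.commute times_divide_eq_right mult_1_right)+
  have "inner w ?r / h = inner w (cycle 0 y p) / h - (inner w y / h + (1 - lam) * \<bar>fst p\<bar> * inner w (A 0 *v y) + lam * \<bar>snd p\<bar> * inner w (A 1 *v y))"
    unfolding r inner_diff_right inner_scaleR_right using h_pos by (simp add: field_simps)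
  ultimately show ?thesis by simp
qed

text \<open>Compactness is applied to sequences with h tending to 0, rows tending to
  \<open>lp\<close> and unit vectors x. If x is nearly orthogonal to \<open>lp\<close>, a cycle
  creates a pairing only of order h, so h is the correct scale of the threshold, and the limiting
  object is the first-order expansion of the cycle instead of the cycle itself.\<close>

lemma row_anticoncentration:
  assumes sad: "\<And>\<beta>. \<beta> > 0 \<Longrightarrow> saddle A lam \<beta> C lp rp rm K lamp lamm M" and eps: "\<epsilon> > 0"
  shows "\<exists>\<delta>>0. \<forall>\<beta>>0. switched.h lam \<beta> < \<delta> \<longrightarrow> (\<forall>w x. norm (w - lp) \<le> \<delta> \<longrightarrow> norm x = 1 \<longrightarrow>
    measure ee {p \<in> space ee. \<bar>inner w (switched.cycle A lam \<beta> 0 x p)\<bar> < \<delta> * switched.h lam \<beta>} \<le> \<epsilon>)"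
proof (rule ccontr)
  assume neg: "\<not> ?thesis"
  define bad where "bad n t \<longleftrightarrow> (case t of (\<beta>, w, x) \<Rightarrow> \<beta> > 0 \<and> switched.h lam \<beta> < inverse (real (Suc n)) \<and>
     norm (w - lp) \<le> inverse (real (Suc n)) \<and> norm x = 1 \<and>
     measure ee {p \<in> space ee. \<bar>inner w (switched.cycle A lam \<beta> 0 x p)\<bar> < inverse (real (Suc n)) * switched.h lam \<beta>} > \<epsilon>)" for n t
  have "\<exists>t. bad n t" for n
  proof -
    have "inverse (real (Suc n)) > 0" by simp
    with neg obtain \<beta> w x where "\<beta> > 0" "switched.h lam \<beta> < inverse (real (Suc n))" "norm (w - lp) \<le> inverse (real (Suc n))" "norm x = 1"
      "\<not> measure ee {p \<in> space ee. \<bar>inner w (switched.cycle A lam \<beta> 0 x p)\<bar> < inverse (real (Suc n)) * switched.h lam \<beta>} \<le> \<epsilon>"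
      by blast
    then show ?thesis unfolding bad_def by (intro exI[of _ "(\<beta>, w, x)"]) auto
  qed
  then have "\<exists>t. \<forall>n. bad n (t n)" by (intro choice) blast
  then obtain t where t: "\<And>n. bad n (t n)" by blast
  define be w x where "be n = fst (t n)" and "w n = fst (snd (t n))" and "x n = snd (snd (t n))" for n
  define hh where "hh n = switched.h lam (be n)" for n
  have be: "be n > 0" and hh: "hh n < inverse (real (Suc n))" and w: "norm (w n - lp) \<le> inverse (real (Suc n))"
    and x: "norm (x n) = 1"
    and big: "measure ee {p \<in> space ee. \<bar>inner (w n) (switched.cycle A lam (be n) 0 (x n) p)\<bar> < inverse (real (Suc n)) * hh n} > \<epsilon>" for n
    using t[of n] by (auto simp: bad_def be_def w_def x_def hh_def split: prod.splits)
  interpret one: saddle A lam 1 C lp rp rm K lamp lamm M by (rule sad) simp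
  have sadn: "saddle A lam (be n) C lp rp rm K lamp lamm M" for n by (rule sad[OF be])
  have hpos: "hh n > 0" for n
    using switched.h_pos[of A lam "be n" C] sadn[of n] unfolding hh_def saddle_def switched_irreducible_def by blast
  have inv0: "(\<lambda>n. inverse (real (Suc n))) \<longlonglongrightarrow> 0" by (rule LIMSEQ_inverse_real_of_nat)
  have hh0: "hh \<longlonglongrightarrow> 0"
    by (rule tendsto_sandwich[OF _ _ tendsto_const inv0]) (use hh hpos in \<open>auto intro!: always_eventually less_imp_le\<close>)
  have wl: "w \<longlonglongrightarrow> lp"
    unfolding LIM_zero_iff[symmetric, of w] tendsto_norm_zero_iff[symmetric, of "\<lambda>n. w n - lp"]
    by (rule tendsto_sandwich[OF _ _ tendsto_const inv0]) (use w in \<open>auto intro!: always_eventually\<close>)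
  define a where "a n = inner (w n) (x n) / hh n" for n
  \<comment> \<open>The ratios \<open>a n\<close> may be unbounded; placing them on the unit circle
    restores compactness.\<close>
  define u where "u n = (1 / sqrt (1 + (a n)\<^sup>2), a n / sqrt (1 + (a n)\<^sup>2))" for n
  have pos: "1 + (a n)\<^sup>2 > 0" for n by (simp add: add_pos_nonneg)
  have u: "(fst (u n))\<^sup>2 + (snd (u n))\<^sup>2 = 1" "0 < fst (u n)" "fst (u n) \<le> 1" "snd (u n) = a n * fst (u n)" for n
    using pos[of n] by (simp_all add: u_def power_divide add_divide_distrib[symmetric])
  have cpt: "compact (sphere (0::real^2) 1 \<times> sphere (0::real \<times> real) 1)" by (intro compact_Times compact_sphere)
  have mem: "\<forall>n. (x n, u n) \<in> sphere 0 1 \<times> sphere 0 1"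
    using x u(1) by (auto simp: mem_Times_iff dist_norm norm_prod_def)
  obtain l r where l: "l \<in> sphere 0 1 \<times> sphere 0 1" and r: "strict_mono r"
    and lim: "((\<lambda>n. (x n, u n)) \<circ> r) \<longlonglongrightarrow> l"
    using mp[OF spec[OF iffD1[OF compact_def cpt]] mem] by auto
  define x' u' where "x' = fst l" and "u' = snd l"
  have xl: "(\<lambda>n. x (r n)) \<longlonglongrightarrow> x'" and ul: "(\<lambda>n. u (r n)) \<longlonglongrightarrow> u'"
    using tendsto_fst[OF lim] tendsto_snd[OF lim] by (simp_all add: o_def x'_def u'_def)
  have x': "norm x' = 1" using l by (auto simp: x'_def mem_Times_iff dist_norm)
  have u': "(fst u')\<^sup>2 + (snd u')\<^sup>2 = 1" using l by (auto simp: u'_def mem_Times_iff dist_norm norm_prod_def)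
  have wr: "(\<lambda>n. w (r n)) \<longlonglongrightarrow> lp" and hr: "(\<lambda>n. hh (r n)) \<longlonglongrightarrow> 0"
    using LIMSEQ_subseq_LIMSEQ[OF wl r] LIMSEQ_subseq_LIMSEQ[OF hh0 r] by (simp_all add: o_def)
  \<comment> \<open>A finite limit of the ratios means that the pairing of w and x is of order h,
    hence vanishes in the limit.\<close>
  have lx: "inner lp x' = 0" if "fst u' \<noteq> 0"
  proof -
    have e: "snd (u (r n)) / fst (u (r n)) * hh (r n) = inner (w (r n)) (x (r n))" for n
      using u(2)[of "r n"] u(4)[of "r n"] hpos[of "r n"] by (simp add: a_def)
    have "(\<lambda>n. snd (u (r n)) / fst (u (r n)) * hh (r n)) \<longlonglongrightarrow> snd u' / fst u' * 0"
      by (intro tendsto_intros ul hr that)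
    moreover have "(\<lambda>n. inner (w (r n)) (x (r n))) \<longlonglongrightarrow> inner lp x'" by (intro tendsto_intros wr xl)
    ultimately show ?thesis unfolding e using LIMSEQ_unique by fastforce
  qed
  have nz: "AE p in ee. snd u' + fst u' * ((1 - lam) * \<bar>fst p\<bar> * inner lp (A 0 *v x') + lam * \<bar>snd p\<bar> * inner lp (A 1 *v x')) \<noteq> 0"
    by (rule one.first_order_nonzero[OF x' u']) (rule lx)
  define f where "f n p = inner (w n) (switched.cycle A lam (be n) 0 (x n) p) / hh n" for n p
  have "(\<lambda>n. measure ee {p \<in> space ee. \<bar>f (r n) p\<bar> < inverse (real (Suc (r n)))}) \<longlonglongrightarrow> 0"
  proof (rule ee.sublevel_tendsto_0)
    show "(\<lambda>n. inverse (real (Suc (r n)))) \<longlonglongrightarrow> 0"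
      using LIMSEQ_subseq_LIMSEQ[OF inv0 r] by (simp add: o_def)
    show "f (r n) \<in> borel_measurable ee" for n
    proof -
      interpret saddle A lam "be (r n)" C lp rp rm K lamp lamm M by (rule sadn)
      show ?thesis unfolding f_def[abs_def] by measurable
    qed
    show "AE p in ee. \<exists>c>0. \<forall>\<^sub>F n in sequentially. c \<le> \<bar>f (r n) p\<bar>"
      using nz
    proof eventually_elim
      case (elim p)
      define G where "G n = (1 - lam) * \<bar>fst p\<bar> * inner (w n) (A 0 *v x n) + lam * \<bar>snd p\<bar> * inner (w n) (A 1 *v x n)" for n
      define L where "L = snd u' + fst u' * ((1 - lam) * \<bar>fst p\<bar> * inner lp (A 0 *v x') + lam * \<bar>snd p\<bar> * inner lp (A 1 *v x'))"
      have L0: "L \<noteq> 0" using elim by (simp add: L_def)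
      have err: "\<bar>f n p - (a n + G n)\<bar> \<le> norm (w n) * (M * hh n * (psum p)\<^sup>2)" for n
      proof -
        interpret saddle A lam "be n" C lp rp rm K lamp lamm M by (rule sadn)
        show ?thesis using cycle_expansion[of "w n" "x n" p] by (simp add: f_def a_def G_def hh_def x add.assoc)
      qed
      have "(\<lambda>n. norm (w (r n)) * (M * hh (r n) * (psum p)\<^sup>2)) \<longlonglongrightarrow> norm lp * (M * 0 * (psum p)\<^sup>2)"
        by (intro tendsto_intros wr hr)
      then have b0: "(\<lambda>n. norm (w (r n)) * (M * hh (r n) * (psum p)\<^sup>2)) \<longlonglongrightarrow> 0" by simp
      have e0: "(\<lambda>n. f (r n) p - (a (r n) + G (r n))) \<longlonglongrightarrow> 0"
        by (rule Lim_null_comparison[OF always_eventually b0]) (unfold real_norm_def, intro allI err)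
      have mv: "(\<lambda>n. A i *v x (r n)) \<longlonglongrightarrow> A i *v x'" for i
        by (rule bounded_linear.tendsto[OF matrix_vector_mul_bounded_linear xl])
      \<comment> \<open>The weight \<open>fst (u (r n))\<close> turns the possibly divergent ratio
        into the bounded coordinate \<open>snd (u (r n))\<close>. Since the weight is at most 1, a
        lower bound for the weighted pairing is one for \<open>f\<close>.\<close>
      have "(\<lambda>n. fst (u (r n)) * (f (r n) p - (a (r n) + G (r n))) + (snd (u (r n)) + fst (u (r n)) * G (r n)))
          \<longlonglongrightarrow> fst u' * 0 + L"
        unfolding L_def G_def by (intro tendsto_intros ul e0[unfolded G_def] wr mv)
      moreover have "fst (u (r n)) * (f (r n) p - (a (r n) + G (r n))) + (snd (u (r n)) + fst (u (r n)) * G (r n))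
          = fst (u (r n)) * f (r n) p" for n
        using u(4)[of "r n"] by (simp add: algebra_simps)
      ultimately have "(\<lambda>n. \<bar>fst (u (r n)) * f (r n) p\<bar>) \<longlonglongrightarrow> \<bar>L\<bar>" by (simp add: tendsto_rabs)
      then have "\<forall>\<^sub>F n in sequentially. \<bar>L\<bar> / 2 < \<bar>fst (u (r n)) * f (r n) p\<bar>"
        by (rule order_tendstoD(1)) (use L0 in auto)
      moreover have "\<bar>fst (u (r n)) * f (r n) p\<bar> \<le> \<bar>f (r n) p\<bar>" for n
        using u(2,3)[of "r n"] by (simp add: abs_mult mult_left_le_one_le)
      ultimately have "\<forall>\<^sub>F n in sequentially. \<bar>L\<bar> / 2 \<le> \<bar>f (r n) p\<bar>"
        by (auto elim!: eventually_mono intro: order_trans[OF less_imp_le])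
      then show ?case using L0 by (intro exI[of _ "\<bar>L\<bar> / 2"]) auto
    qed
  qed
  then have "\<forall>\<^sub>F n in sequentially. measure ee {p \<in> space ee. \<bar>f (r n) p\<bar> < inverse (real (Suc (r n)))} < \<epsilon>"
    using eps by (rule order_tendstoD(2))
  then obtain n where n: "measure ee {p \<in> space ee. \<bar>f (r n) p\<bar> < inverse (real (Suc (r n)))} < \<epsilon>"
    by (auto simp: eventually_sequentially)
  have "(\<bar>f (r n) p\<bar> < inverse (real (Suc (r n)))) =
      (\<bar>inner (w (r n)) (switched.cycle A lam (be (r n)) 0 (x (r n)) p)\<bar> < inverse (real (Suc (r n))) * hh (r n))" for p
    unfolding f_def abs_divide using hpos[of "r n"] by (simp only: abs_of_pos pos_divide_less_eq)
  then show False using n big[of "r n"] by simp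
qed

context saddle
begin

lemma dev_norm: "dev_sq n e < \<eta>\<^sup>2 / M * growth_factor ^ (2 * n) \<Longrightarrow> \<eta> > 0 \<Longrightarrow> norm (dev n e) \<le> \<eta> * growth_factor ^ n"
proof -
  assume a: "dev_sq n e < \<eta>\<^sup>2 / M * growth_factor ^ (2 * n)" and e: "\<eta> > 0"
  have "(norm (dev n e))\<^sup>2 \<le> M * dev_sq n e" unfolding dev_sq_def by (rule dual)
  also have "\<dots> \<le> M * (\<eta>\<^sup>2 / M * growth_factor ^ (2 * n))" using a M by (intro mult_left_mono) auto
  also have "\<dots> = (\<eta> * growth_factor ^ n)\<^sup>2" using M by (simp add: power_mult_distrib power_mult[symmetric] mult.commute[of n 2])
  finally show ?thesis by (rule power2_le_imp_le) (use e growth_factor_ge_1 in simp)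
qed

text \<open>The component of the product along \<open>lp\<close> is controlled with high probability by \<open>dev_tail\<close>,
  whatever the first cycle is. The first cycle prevents a cancellation with the initial vector.\<close>

lemma psi_fast_lower:
  assumes x: "norm x = 1" and \<eta>: "\<eta> > 0" and \<delta>: "\<delta> > 0" and eps: "\<epsilon> \<ge> 0" and \<theta>: "\<theta> > 0" and n: "n \<ge> 1"
    and anti: "\<And>w. norm (w - lp) \<le> \<eta> \<Longrightarrow> measure ee {p \<in> space ee. \<bar>inner w (cycle 0 x p)\<bar> < \<delta> * h} \<le> \<epsilon>"
    and L: "L = n * ln (1 + h * lamp) + ln (\<delta> / norm lp * h)" "L \<ge> 0"
    and P: "P = ((1 + 120 * M ^ 7 * h\<^sup>2) ^ n - 1) / (\<eta>\<^sup>2 / M)"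
  shows "(1 - \<epsilon> - P) * L - C * h * n * (2 * \<epsilon> + 8 * \<theta> + P / (4 * \<theta>)) - 2 * (C * h) \<le> \<psi> (Suc (Suc (2 * n))) (x, 0)"
proof -
  \<comment> \<open>The exceptional event concerns the tail only, so it is independent of the first
    cycle. On it nothing but the bound by \<open>esum\<close> is used.\<close>
  define G where "G = {e \<in> space seqm. dev_sq n e \<ge> \<eta>\<^sup>2 / M * growth_factor ^ (2 * n)}"
  have G [measurable]: "G \<in> sets seqm" unfolding G_def by measurable
  have GP: "measure seqm G \<le> P" unfolding G_def P by (rule dev_tail) (use \<eta> M in auto)
  have iG: "integrable seqm (indicator G :: _ \<Rightarrow> real)"
    by (rule integrable_real_indicator[OF G]) (simp add: seqm.emeasure_eq_measure)
  have Ch: "C * h > 0" using C_pos h_pos by simp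
  have "(\<integral>e. (1 - \<epsilon>) * L - C * h * \<epsilon> * esum (2 * n) e - 2 * (C * h) - L * indicator G e
      - C * h * (\<theta> * (esum (2 * n) e)\<^sup>2 / n + n / (4 * \<theta>) * indicator G e) \<partial>seqm)
     \<le> (\<integral>e. \<integral>p. growth (Suc (Suc (2 * n))) (x, 0) (cons2 p e) \<partial>ee \<partial>seqm)"
  proof (rule integral_mono)
    show "integrable seqm (\<lambda>e. \<integral>p. growth (Suc (Suc (2 * n))) (x, 0) (cons2 p e) \<partial>ee)"
      by (rule integrable_outer_case_nat2) simp
    show "integrable seqm (\<lambda>e. (1 - \<epsilon>) * L - C * h * \<epsilon> * esum (2 * n) e - 2 * (C * h) - L * indicator G e
      - C * h * (\<theta> * (esum (2 * n) e)\<^sup>2 / n + n / (4 * \<theta>) * indicator G e))"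
      using iG by simp
    fix e
    define E where "E = esum (2 * n) e"
    have E0: "E \<ge> 0" by (simp add: E_def)
    let ?g = "\<lambda>p. growth (Suc (Suc (2 * n))) (x, 0) (cons2 p e)"
    have lower: "- (C * h * E) - C * h * psum p \<le> ?g p" for p
      using growth_cycle_bound[of "2 * n" x 0 p e] by (simp add: E_def psum_def abs_le_iff)
    show "(1 - \<epsilon>) * L - C * h * \<epsilon> * esum (2 * n) e - 2 * (C * h) - L * indicator G e
      - C * h * (\<theta> * (esum (2 * n) e)\<^sup>2 / n + n / (4 * \<theta>) * indicator G e) \<le> (\<integral>p. ?g p \<partial>ee)"
    proof (cases "e \<in> G")
      case True
      have "(\<integral>p. - (C * h * E) - C * h * psum p \<partial>ee) \<le> (\<integral>p. ?g p \<partial>ee)"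
        by (intro integral_mono growth_cycle_integrable lower) simp
      then have "- (C * h * E) - 2 * (C * h) \<le> (\<integral>p. ?g p \<partial>ee)" by (simp add: psum_integral ee.prob_space)
      \<comment> \<open>On the exceptional event \<open>esum\<close> may be large. Young's
        inequality separates it from the indicator, so that only the unrestricted second moment, of
        order n^2, and the probability of \<open>G\<close> enter.\<close>
      moreover have "E \<le> \<theta> * E\<^sup>2 / n + n / (4 * \<theta>)"
      proof -
        have "0 \<le> (2 * \<theta> * E - n)\<^sup>2 / (4 * \<theta> * n)" using \<theta> by simp
        also have "\<dots> = \<theta> * E\<^sup>2 / n + n / (4 * \<theta>) - E" using \<theta> n by (simp add: power2_diff field_simps power2_eq_square)
        finally show ?thesis by simp
      qed
      then have "C * h * E \<le> C * h * (\<theta> * E\<^sup>2 / n + n / (4 * \<theta>))" using Ch by (intro mult_left_mono) auto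
      moreover have "0 \<le> \<epsilon> * L" "0 \<le> C * h * \<epsilon> * E" using eps L Ch E0 by auto
      moreover have "(1 - \<epsilon>) * L = L - \<epsilon> * L" by (simp add: algebra_simps)
      ultimately show ?thesis using True unfolding E_def[symmetric] by simp
    next
      case False
      \<comment> \<open>The normalised row of the tail. Outside \<open>G\<close> it is within \<eta>
        of \<open>lp\<close>, as the anticoncentration hypothesis asks, and by \<open>wy\<close> its
        pairing with the vector after the first cycle gives the \<open>lp\<close> component after
        all cycles.\<close>
      define w where "w = lp + dev n e /\<^sub>R growth_factor ^ n"
      have g: "growth_factor ^ n > 0" using growth_factor_ge_1 by simp
      have "norm (dev n e) \<le> \<eta> * growth_factor ^ n"
        using False \<eta> by (intro dev_norm) (auto simp: G_def)
      then have "norm (w - lp) \<le> \<eta>" using g by (simp add: w_def field_simps)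
      note an = anti[OF this]
      define B where "B = {p \<in> space ee. \<bar>inner w (cycle 0 x p)\<bar> < \<delta> * h}"
      have B: "B \<in> sets ee" unfolding B_def by measurable
      have iB: "integrable ee (indicator B :: _ \<Rightarrow> real)"
        by (rule integrable_real_indicator[OF B]) (simp add: ee.emeasure_eq_measure)
      have wy: "growth_factor ^ n * inner w y = inner lp (X (2 * n) (y, 0) e)" for y
      proof -
        have "q * (b + inverse q * (c - q * b)) = c" if "q > 0" for q b c :: real
          using that by (simp add: field_simps)
        from this[OF g] show ?thesis unfolding w_def inner_add_left inner_scaleR_left inner_dev .
      qed
      have "(\<integral>p. L - (L + C * h * E) * indicator B p - C * h * psum p \<partial>ee) \<le> (\<integral>p. ?g p \<partial>ee)"
      proof (rule integral_mono[OF _ growth_cycle_integrable])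
        show "integrable ee (\<lambda>p. L - (L + C * h * E) * indicator B p - C * h * psum p)" using iB by simp
        fix p assume p: "p \<in> space ee"
        show "L - (L + C * h * E) * indicator B p - C * h * psum p \<le> ?g p"
        proof (cases "p \<in> B")
          case True
          then show ?thesis using lower[of p] by simp
        next
          case False
          let ?X = "X (2 * n) (cycle 0 x p, 0) e"
          have lp0: "norm lp > 0" using lp by simp
          have "growth_factor ^ n * (\<delta> * h) \<le> growth_factor ^ n * \<bar>inner w (cycle 0 x p)\<bar>"
            using False p g by (intro mult_left_mono) (auto simp: B_def)
          also have "\<dots> = \<bar>inner lp ?X\<bar>" using g by (simp add: wy[symmetric] abs_mult)
          also have "\<dots> \<le> norm lp * norm ?X" by (rule Cauchy_Schwarz_ineq2)
          finally have le: "growth_factor ^ n * (\<delta> / norm lp * h) \<le> norm ?X" using lp0 by (simp add: field_simps)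
          have "L = ln (growth_factor ^ n * (\<delta> / norm lp * h))"
            unfolding L(1) using g \<delta> lp0 h_pos growth_factor_ge_1
            by (subst ln_mult) (auto simp: ln_realpow growth_factor_def)
          also have "\<dots> \<le> ln (norm ?X)" using le g \<delta> lp0 h_pos by (intro ln_mono) auto
          finally have "L \<le> ?g p" unfolding growth_cycle by (simp add: x)
          moreover have "0 \<le> C * h * psum p" using Ch by simp
          ultimately show ?thesis using False by simp
        qed
      qed
      also have "(\<integral>p. L - (L + C * h * E) * indicator B p - C * h * psum p \<partial>ee) = L - (L + C * h * E) * measure ee B - 2 * (C * h)"
        using iB sets.Int_space_eq2[OF B] by (simp add: psum_integral ee.prob_space)
      finally have "L - (L + C * h * E) * measure ee B - 2 * (C * h) \<le> (\<integral>p. ?g p \<partial>ee)" .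
      moreover have "(L + C * h * E) * measure ee B \<le> (L + C * h * E) * \<epsilon>"
        using an L Ch E0 unfolding B_def by (intro mult_left_mono) auto
      moreover have "0 \<le> C * h * (\<theta> * E\<^sup>2 / n)" using Ch \<theta> by simp
      ultimately show ?thesis using False unfolding E_def[symmetric] by (simp add: algebra_simps)
    qed
  qed
  also have "\<dots> = \<psi> (Suc (Suc (2 * n))) (x, 0)"
    unfolding \<psi>_def by (rule integral_case_nat2[symmetric]) simp
  finally have le: "(\<integral>e. (1 - \<epsilon>) * L - C * h * \<epsilon> * esum (2 * n) e - 2 * (C * h) - L * indicator G e
      - C * h * (\<theta> * (esum (2 * n) e)\<^sup>2 / n + n / (4 * \<theta>) * indicator G e) \<partial>seqm) \<le> \<psi> (Suc (Suc (2 * n))) (x, 0)" .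
  have int: "(\<integral>e. (1 - \<epsilon>) * L - C * h * \<epsilon> * esum (2 * n) e - 2 * (C * h) - L * indicator G e
      - C * h * (\<theta> * (esum (2 * n) e)\<^sup>2 / n + n / (4 * \<theta>) * indicator G e) \<partial>seqm)
    = (1 - \<epsilon>) * L - C * h * \<epsilon> * (2 * n) - 2 * (C * h) - L * measure seqm G
      - C * h * (\<theta> * (\<integral>e. (esum (2 * n) e)\<^sup>2 \<partial>seqm) / n + n / (4 * \<theta>) * measure seqm G)"
    using iG sets.Int_space_eq2[OF G] by (simp add: integral_esum)
  have LP: "L * measure seqm G \<le> L * P" using L GP by (intro mult_left_mono) auto
  have EP: "C * h * (\<theta> * (\<integral>e. (esum (2 * n) e)\<^sup>2 \<partial>seqm) / n + n / (4 * \<theta>) * measure seqm G)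
    \<le> C * h * (8 * \<theta> * n + n / (4 * \<theta>) * P)"
  proof (intro mult_left_mono add_mono)
    have "\<theta> * (\<integral>e. (esum (2 * n) e)\<^sup>2 \<partial>seqm) / n \<le> \<theta> * (2 * (real (2 * n))\<^sup>2) / n"
      using \<theta> by (intro divide_right_mono mult_left_mono integral_esum_sq) auto
    also have "\<dots> = 8 * \<theta> * n" using n by (simp add: power2_eq_square)
    finally show "\<theta> * (\<integral>e. (esum (2 * n) e)\<^sup>2 \<partial>seqm) / n \<le> 8 * \<theta> * n" .
  qed (use GP \<theta> Ch in auto)
  have "(1 - \<epsilon> - P) * L - C * h * n * (2 * \<epsilon> + 8 * \<theta> + P / (4 * \<theta>)) - 2 * (C * h)
    = (1 - \<epsilon>) * L - C * h * \<epsilon> * (2 * n) - 2 * (C * h) - L * P - C * h * (8 * \<theta> * n + n / (4 * \<theta>) * P)"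
    by (simp add: algebra_simps)
  also have "\<dots> \<le> (1 - \<epsilon>) * L - C * h * \<epsilon> * (2 * n) - 2 * (C * h) - L * measure seqm G
      - C * h * (\<theta> * (\<integral>e. (esum (2 * n) e)\<^sup>2 \<partial>seqm) / n + n / (4 * \<theta>) * measure seqm G)"
    by (intro diff_mono order_refl LP EP)
  also have "\<dots> \<le> \<psi> (Suc (Suc (2 * n))) (x, 0)" using le unfolding int .
  finally show ?thesis .
qed

end

theorem gamma_fast_switching:
  assumes sad: "\<And>\<beta>. \<beta> > 0 \<Longrightarrow> saddle A lam \<beta> C lp rp rm K lamp lamm M"
  shows "\<exists>\<beta>2>0. \<forall>\<beta>>\<beta>2. switched.\<gamma> A lam \<beta> > 0"
proof -
  interpret one: saddle A lam 1 C lp rp rm K lamp lamm M by (rule sad) simp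
  have C: "C > 0" and lamp: "lamp > 0" and lp: "lp \<noteq> 0" and M: "M \<ge> 1" and lam: "0 < lam" "lam < 1"
    using one.C_pos one.lamp one.lp one.M one.lam by auto
  \<comment> \<open>Measured in units of n h \<open>lamp\<close>, half of L gives at least 1/8. The
    terms with \<epsilon>, \<theta> and P and the first-cycle term 2 C h are each at most 1/64, the
    last because n >= 128 C / \<open>lamp\<close>. The caps 1/4 keep 1 - \<epsilon> - P at least
    1/2.\<close>
  define \<epsilon> where "\<epsilon> = min (1/4) (lamp / (128 * C))"
  define \<theta> where "\<theta> = lamp / (512 * C)"
  define P1 where "P1 = min (1/4) (lamp * \<theta> / (16 * C))"
  have eps: "\<epsilon> > 0" "\<epsilon> \<le> 1/4" "\<epsilon> \<le> lamp / (128 * C)" using C lamp by (auto simp: \<epsilon>_def)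
  have \<theta>: "\<theta> > 0" using C lamp by (simp add: \<theta>_def)
  have P1: "P1 > 0" "P1 \<le> 1/4" "P1 \<le> lamp * \<theta> / (16 * C)" using C lamp \<theta> by (auto simp: P1_def)
  obtain \<delta> where \<delta>: "\<delta> > 0" and anti: "\<And>\<beta> w x. \<beta> > 0 \<Longrightarrow> switched.h lam \<beta> < \<delta> \<Longrightarrow> norm (w - lp) \<le> \<delta> \<Longrightarrow> norm x = 1 \<Longrightarrow>
    measure ee {p \<in> space ee. \<bar>inner w (switched.cycle A lam \<beta> 0 x p)\<bar> < \<delta> * switched.h lam \<beta>} \<le> \<epsilon>"
    using row_anticoncentration[OF sad eps(1)] by blast
  obtain h0 :: real where h0: "h0 > 0" and scale: "\<And>h::real. 0 < h \<Longrightarrow> h < h0 \<Longrightarrow> (\<exists>n::nat. n \<ge> 1 \<and> real n \<ge> 128 * C / lamp \<and>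
      (1 + (120 * M ^ 7) * h\<^sup>2) ^ n - 1 \<le> P1 * (\<delta>\<^sup>2 / M) \<and>
      n * h * lamp / 4 \<le> n * ln (1 + h * lamp) + ln (\<delta> / norm lp * h))"
    using averaging_scale[of "120 * M ^ 7" lamp "\<delta> / norm lp" "P1 * (\<delta>\<^sup>2 / M)" "128 * C / lamp"] M lamp \<delta> lp P1 by auto
  \<comment> \<open>This is the value of \<beta> at which h equals the smaller of the two
    thresholds.\<close>
  define \<beta>2 where "\<beta>2 = 1 / (min h0 \<delta> * lam * (1 - lam))"
  have "\<beta>2 > 0" using h0 \<delta> lam by (simp add: \<beta>2_def)
  moreover have "switched.\<gamma> A lam \<beta> > 0" if b: "\<beta> > \<beta>2" for \<beta>
  proof -
    have b0: "\<beta> > 0" using b \<open>\<beta>2 > 0\<close> by simp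
    interpret saddle A lam \<beta> C lp rp rm K lamp lamm M by (rule sad[OF b0])
    have hl: "h < min h0 \<delta>"
    proof -
      have "1 < \<beta> * (min h0 \<delta> * lam * (1 - lam))" using b h0 \<delta> lam unfolding \<beta>2_def by (simp add: divide_less_eq)
      moreover have "\<beta> * lam * (1 - lam) > 0" using b0 lam by simp
      ultimately show ?thesis unfolding h_def by (simp only: pos_divide_less_eq mult_ac)
    qed
    obtain n :: nat where n: "n \<ge> 1" "real n \<ge> 128 * C / lamp" "(1 + 120 * M ^ 7 * h\<^sup>2) ^ n - 1 \<le> P1 * (\<delta>\<^sup>2 / M)"
      and nL: "n * h * lamp / 4 \<le> n * ln (1 + h * lamp) + ln (\<delta> / norm lp * h)"
      using scale[OF h_pos] hl by auto
    define P where "P = ((1 + 120 * M ^ 7 * h\<^sup>2) ^ n - 1) / (\<delta>\<^sup>2 / M)"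
    define L where "L = n * ln (1 + h * lamp) + ln (\<delta> / norm lp * h)"
    have nh: "n * h > 0" using n h_pos by simp
    have L: "L \<ge> n * h * (lamp / 4)" using nL by (simp add: L_def)
    have L0: "L \<ge> 0" using order_trans[OF _ L, of 0] nh lamp by simp
    have "\<delta>\<^sup>2 / M > 0" using \<delta> M by simp
    then have P: "P \<le> P1" using n(3) unfolding P_def by (simp only: pos_divide_le_eq)
    define V where "V = (1 - \<epsilon> - P) * L - C * h * n * (2 * \<epsilon> + 8 * \<theta> + P / (4 * \<theta>)) - 2 * (C * h)"
    have V: "V > 0"
    proof -
      have "(1/2) * (n * h * (lamp / 4)) \<le> (1 - \<epsilon> - P) * L"
        using L L0 eps P P1 nh lamp by (intro mult_mono) auto
      moreover have "C * h * n * (2 * \<epsilon> + 8 * \<theta> + P / (4 * \<theta>)) \<le> n * h * (3 * lamp / 64)"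
      proof -
        have "C * (2 * \<epsilon>) \<le> lamp / 64" using eps(3) C by (simp add: field_simps)
        moreover have "C * (8 * \<theta>) = lamp / 64" using C by (simp add: \<theta>_def)
        moreover have "C * (P / (4 * \<theta>)) \<le> lamp / 64"
        proof -
          have "P \<le> lamp * \<theta> / (16 * C)" using P P1(3) by simp
          then show ?thesis using C \<theta> by (simp add: field_simps)
        qed
        ultimately have "C * (2 * \<epsilon> + 8 * \<theta> + P / (4 * \<theta>)) \<le> 3 * lamp / 64" by (simp add: distrib_left)
        then have "n * h * (C * (2 * \<epsilon> + 8 * \<theta> + P / (4 * \<theta>))) \<le> n * h * (3 * lamp / 64)"
          using nh by (intro mult_left_mono) auto
        then show ?thesis by (simp add: mult_ac)
      qed
      moreover have "2 * (C * h) \<le> n * h * (lamp / 64)"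
      proof -
        have "128 * C \<le> n * lamp" using n(2) lamp by (simp add: field_simps)
        then have "h * (128 * C) \<le> h * (n * lamp)" using h_pos by (intro mult_left_mono) auto
        then show ?thesis by (simp add: mult_ac)
      qed
      moreover have "n * h * lamp > 0" using nh lamp by simp
      ultimately show ?thesis unfolding V_def by simp
    qed
    \<comment> \<open>Blocks have even length, so every block starts again in state 0, the only
      state for which the bound was proved.\<close>
    have "V / (Suc (Suc (2 * n))) \<le> \<gamma>"
    proof (rule gamma_lower[of "{0}"])
      fix z :: "(real^2) \<times> 2" assume z: "fst z \<noteq> 0" "snd z \<in> {0}"
      let ?x = "fst z /\<^sub>R norm (fst z)"
      have x: "norm ?x = 1" using z by simp
      have "V \<le> \<psi> (Suc (Suc (2 * n))) (?x, 0)" unfolding V_def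
        by (rule psi_fast_lower[OF x \<delta> \<delta> less_imp_le[OF eps(1)] \<theta> n(1) anti[OF b0 _ _ x] L_def L0 P_def]) (use hl in auto)
      also have "\<dots> = \<psi> (Suc (Suc (2 * n))) z" using z psi_scale[of "inverse (norm (fst z))" _ "fst z" 0] by (cases z) simp
      finally show "V \<le> \<psi> (Suc (Suc (2 * n))) z" .
    next
      fix i :: 2 and k assume "i \<in> {0}"
      then show "jump_chain i (k * Suc (Suc (2 * n))) \<in> {0}"
        using jump_chain_double[of i "k * Suc n"] by (simp add: algebra_simps)
    qed auto
    then show ?thesis using V by (smt (verit) divide_pos_pos of_nat_0_less_iff zero_less_Suc)
  qed
  ultimately show ?thesis by blast
qed

section \<open>The process in continuous time\<close>

text \<open>One fixed sample point outside a null event. The passage from jumps to continuous time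
  is deterministic and is carried out for such a point, without any measurability.\<close>

locale switched_sample = switched +
  fixes x0 :: "real^2" and i0 :: 2 and e :: "nat \<Rightarrow> real"
  assumes e_pos: "\<And>k. e k > 0" and T_unbounded: "\<And>t. \<exists>n. t < jump_time lam \<beta> i0 e n"
begin

abbreviation T :: "nat \<Rightarrow> real" where "T \<equiv> jump_time lam \<beta> i0 e"

abbreviation I :: "nat \<Rightarrow> 2" where "I \<equiv> jump_chain i0"

definition Xn :: "nat \<Rightarrow> real^2" where "Xn n = X n (x0, i0) e"

definition idx :: "real \<Rightarrow> nat" where "idx t = (LEAST n. t < T (Suc n))"

lemma T_0 [simp]: "T 0 = 0" by (simp add: jump_time_def)

lemma T_Suc: "T (Suc n) = T n + e n / rate (I n)"
  by (simp add: jump_time_def rate_def)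

lemma T_less: "T n < T (Suc n)"
  using e_pos[of n] rate_pos[of "I n"] by (simp add: T_Suc)

lemma T_mono: "m \<le> n \<Longrightarrow> T m \<le> T n"
  by (rule lift_Suc_mono_le[of T]) (rule less_imp_le[OF T_less])

lemma Xn_0 [simp]: "Xn 0 = x0" by (simp add: Xn_def)

lemma Xn_Suc: "Xn (Suc n) = flow (A (I n)) (T (Suc n) - T n) *v Xn n"
  using e_pos[of n] by (simp add: Xn_def X_Suc T_Suc)

lemma idx_eq: "T n \<le> t \<Longrightarrow> t < T (Suc n) \<Longrightarrow> idx t = n"
  unfolding idx_def
proof (rule Least_equality)
  fix m assume "T n \<le> t" "t < T (Suc m)"
  then show "n \<le> m" using T_mono[of "Suc m" n] by (meson leD le_less_trans not_less_eq_eq)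
qed

lemma idx_bounds: "t \<ge> 0 \<Longrightarrow> T (idx t) \<le> t \<and> t < T (Suc (idx t))"
proof -
  assume t: "t \<ge> 0"
  obtain n where n: "t < T n" using T_unbounded by blast
  then have "n \<noteq> 0" using t by (metis T_0 not_le)
  then have ex: "\<exists>n. t < T (Suc n)" using n by (metis not0_implies_Suc)
  have u: "t < T (Suc (idx t))" unfolding idx_def by (rule LeastI_ex[OF ex])
  have "T (idx t) \<le> t"
  proof (cases "idx t")
    case (Suc m)
    then have "\<not> t < T (Suc m)" unfolding idx_def by (metis lessI not_less_Least)
    then show ?thesis using Suc by simp
  qed (use t in simp)
  with u show ?thesis by blast
qed

abbreviation \<iota> :: "real \<Rightarrow> 2" where "\<iota> \<equiv> switch_path lam \<beta> i0 e"

lemma iota_eq: "T n \<le> t \<Longrightarrow> t < T (Suc n) \<Longrightarrow> \<iota> t = I n"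
  using idx_eq[of n t] by (simp add: switch_path_def idx_def)

text \<open>The glued flows provide a solution, which is what makes the choice in
  \<open>switched_X\<close> meaningful.\<close>

definition Y :: "real \<Rightarrow> real^2" where
  "Y t = flow (A (I (idx t))) (t - T (idx t)) *v Xn (idx t)"

lemma Y_eq: "T n \<le> t \<Longrightarrow> t < T (Suc n) \<Longrightarrow> Y t = flow (A (I n)) (t - T n) *v Xn n"
  using idx_eq[of n t] by (simp add: Y_def)

lemma shifted_flow_deriv:
  "((\<lambda>s. flow M (s - a) *v x) has_vector_derivative M *v (flow M (t - a) *v x)) (at t within S)"
proof -
  have "((\<lambda>s. s - a) has_vector_derivative 1) (at t within S)" by (auto intro!: derivative_eq_intros)
  from vector_diff_chain_within[OF this flow_vec_deriv] show ?thesis by (simp add: o_def)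
qed

lemma Y_integral_piece:
  assumes "T n \<le> t" "t \<le> T (Suc n)"
  shows "((\<lambda>s. A (\<iota> s) *v Y s) has_integral (flow (A (I n)) (t - T n) *v Xn n - Xn n)) {T n..t}"
\<comment> \<open>At the right end point the path already follows the next piece; a single point
  does not change the integral.\<close>
proof (rule has_integral_spike_finite[of "{T (Suc n)}"])
  show "((\<lambda>s. A (I n) *v (flow (A (I n)) (s - T n) *v Xn n)) has_integral (flow (A (I n)) (t - T n) *v Xn n - Xn n)) {T n..t}"
    using fundamental_theorem_of_calculus[OF assms(1) shifted_flow_deriv, of "A (I n)" "T n" "Xn n"] by simp
  show "A (\<iota> s) *v Y s = A (I n) *v (flow (A (I n)) (s - T n) *v Xn n)" if "s \<in> {T n..t} - {T (Suc n)}" for s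
    using that assms by (auto simp: iota_eq[of n] Y_eq[of n])
qed simp

lemma Y_integral_jump: "((\<lambda>s. A (\<iota> s) *v Y s) has_integral (Xn n - x0)) {0..T n}"
proof (induction n)
  case (Suc n)
  have "((\<lambda>s. A (\<iota> s) *v Y s) has_integral (Xn n - x0) + (Xn (Suc n) - Xn n)) {0..T (Suc n)}"
    using T_mono[of 0 n] T_less[of n] Y_integral_piece[of n "T (Suc n)"]
    by (intro has_integral_combine[OF _ _ Suc]) (auto simp: Xn_Suc)
  then show ?case by simp
qed (auto simp: has_integral_refl)

lemma Y_solves: "solves_switched A \<iota> x0 Y"
  unfolding solves_switched_def
proof (intro conjI allI impI)
  have "Y 0 = flow (A (I 0)) (0 - T 0) *v Xn 0" using T_less[of 0] by (intro Y_eq) auto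
  then show "Y 0 = x0" by simp
  fix t :: real assume t: "t \<ge> 0"
  define n where "n = idx t"
  have n: "T n \<le> t" "t < T (Suc n)" using idx_bounds[OF t] by (auto simp: n_def)
  have "((\<lambda>s. A (\<iota> s) *v Y s) has_integral (Xn n - x0) + (Y t - Xn n)) {0..t}"
    using T_mono[of 0 n] n Y_integral_piece[of n t] Y_eq[OF n]
    by (intro has_integral_combine[OF _ _ Y_integral_jump]) auto
  then show "((\<lambda>s. A (\<iota> s) *v Y s) has_integral Y t - x0) {0..t}" by simp
qed

text \<open>The integral equation makes any solution continuous; between two jumps the integrand is
  then continuous up to one point, so the solution is differentiable there and uniqueness for the
  linear equation applies. Hence the arbitrary choice in \<open>switched_X\<close> does not affect
  its values at nonnegative times.\<close>

lemma solution_piece: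
  assumes sol: "solves_switched A \<iota> x0 W" and t: "T n \<le> t" "t \<le> T (Suc n)"
  shows "W t = flow (A (I n)) (t - T n) *v W (T n)"
proof -
  let ?f = "\<lambda>s. A (\<iota> s) *v W s"
  let ?g = "\<lambda>s. A (I n) *v W s"
  have T0: "0 \<le> T n" using T_mono[of 0 n] by simp
  have hi: "(?f has_integral (W s - x0)) {0..s}" if "s \<ge> 0" for s
    using sol that unfolding solves_switched_def by blast
  have Zs: "W s = x0 + integral {0..s} ?f" if "s \<ge> 0" for s
    using integral_unique[OF hi[OF that]] by simp
  have int: "?f integrable_on {0..t}" using hi[of t] T0 t by (auto simp: integrable_on_def)
  have "continuous_on {0..t} (\<lambda>s. x0 + integral {0..s} ?f)"
    by (intro continuous_intros indefinite_integral_continuous_1 int)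
  then have c0: "continuous_on {0..t} W"
    by (rule continuous_on_eq) (simp add: Zs)
  then have c: "continuous_on {T n..t} W" by (rule continuous_on_subset) (use T0 in auto)
  then have cg: "continuous_on {T n..t} ?g"
    by (rule bounded_linear.continuous_on[OF matrix_vector_mul_bounded_linear])
  have Zg: "W s = W (T n) + integral {T n..s} ?g" if s: "T n \<le> s" "s \<le> t" for s
  proof -
    have "?f integrable_on {0..s}" by (rule integrable_subinterval_real[OF int]) (use s T0 in auto)
    then have "integral {0..T n} ?f + integral {T n..s} ?f = integral {0..s} ?f"
      by (rule Henstock_Kurzweil_Integration.integral_combine[OF T0 s(1)])
    moreover have "integral {T n..s} ?f = integral {T n..s} ?g"
    proof (rule integral_spike[of "{T (Suc n)}"])
      show "?g r = ?f r" if "r \<in> {T n..s} - {T (Suc n)}" for r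
        using that s t by (auto simp: iota_eq[of n])
    qed simp
    ultimately show ?thesis using Zs[of s] Zs[OF T0] s T0 by simp
  qed
  show ?thesis
  proof (rule linear_ode_unique[OF t(1) c])
    fix s assume s: "T n < s" "s < t"
    have "((\<lambda>s. integral {T n..s} ?g) has_vector_derivative ?g s) (at s within {T n..t})"
      by (rule integral_has_vector_derivative[OF cg]) (use s in auto)
    then have "((\<lambda>s. W (T n) + integral {T n..s} ?g) has_vector_derivative ?g s) (at s within {T n..t})"
      by (auto intro!: derivative_eq_intros)
    moreover have "at s within {T n..t} = at s" by (rule at_within_interior) (use s in auto)
    ultimately have "((\<lambda>s. W (T n) + integral {T n..s} ?g) has_vector_derivative ?g s) (at s)" by simp
    then show "(W has_vector_derivative ?g s) (at s)"
    proof (rule has_vector_derivative_transform_within_open[where S = "{T n<..<t}"])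
      show "W (T n) + integral {T n..y} ?g = W y" if "y \<in> {T n<..<t}" for y
        by (rule Zg[symmetric]) (use that in auto)
    qed (use s in auto)
  qed
qed

lemma solution_at_jumps: "solves_switched A \<iota> x0 W \<Longrightarrow> W (T n) = Xn n"
proof (induction n)
  case 0
  then show ?case by (simp add: solves_switched_def)
next
  case (Suc n)
  then show ?case using solution_piece[OF Suc.prems, of n "T (Suc n)"] T_less[of n] by (simp add: Xn_Suc)
qed

lemma switched_X_eq:
  assumes "T n \<le> t" "t < T (Suc n)"
  shows "switched_X A lam \<beta> t ((x0, i0), e) = flow (A (I n)) (t - T n) *v Xn n"
proof -
  define W where "W = (SOME W. solves_switched A \<iota> x0 W)"
  have W: "solves_switched A \<iota> x0 W" unfolding W_def by (rule someI[of _ Y]) (rule Y_solves)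
  have "switched_X A lam \<beta> t ((x0, i0), e) = W t"
    by (simp add: switched_X_def switched_I_def W_def)
  then show ?thesis using solution_piece[OF W assms(1)] assms(2) solution_at_jumps[OF W, of n] by simp
qed

lemma ln_norm_between_jumps:
  assumes "x0 \<noteq> 0" "T n \<le> t" "t < T (Suc n)"
  shows "\<bar>ln (norm (switched_X A lam \<beta> t ((x0, i0), e))) - ln (norm (Xn n))\<bar> \<le> C * (T (Suc n) - T n)"
proof -
  have "Xn n \<noteq> 0" unfolding Xn_def by (rule X_nonzero) (use assms in simp)
  then have "\<bar>ln (norm (switched_X A lam \<beta> t ((x0, i0), e))) - ln (norm (Xn n))\<bar> \<le> C * (t - T n)"
    unfolding switched_X_eq[OF assms(2,3)] by (rule flow_ln(2)) (use assms in simp)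
  also have "\<dots> \<le> C * (T (Suc n) - T n)" using assms C_pos by (intro mult_left_mono) auto
  finally show ?thesis .
qed

text \<open>The number of jumps before t is asymptotic to t/\<tau>, since t lies between two
  consecutive jump times whose quotients by the index have the same limit. Between jumps the
  logarithm of the norm changes by at most C times the gap, which is negligible for the same
  reason.\<close>

lemma continuous_time_limit:
  assumes x0: "x0 \<noteq> 0" and L: "(\<lambda>n. ln (norm (Xn n)) / n) \<longlonglongrightarrow> g" and \<tau>: "(\<lambda>n. T n / n) \<longlonglongrightarrow> \<tau>" "\<tau> > 0"
  shows "((\<lambda>t. 1 / t * ln (norm (switched_X A lam \<beta> t ((x0, i0), e)))) \<longlongrightarrow> g / \<tau>) at_top"
proof -
  define F where "F t = ln (norm (switched_X A lam \<beta> t ((x0, i0), e)))" for t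
  have idx_ge: "idx t \<ge> n" if t: "t \<ge> T n" for t n
  proof (rule ccontr)
    assume "\<not> idx t \<ge> n"
    then have "T (Suc (idx t)) \<le> T n" by (intro T_mono) simp
    moreover have "t \<ge> 0" using t T_mono[of 0 n] by simp
    ultimately show False using idx_bounds t by (meson leD order_trans)
  qed
  have idx_top: "filterlim idx sequentially at_top"
    unfolding filterlim_at_top eventually_at_top_linorder using idx_ge by meson
  have "(\<lambda>n. T (Suc n) / Suc n * (Suc n / n)) \<longlonglongrightarrow> \<tau> * 1"
  proof (rule tendsto_mult)
    show "(\<lambda>n. T (Suc n) / Suc n) \<longlonglongrightarrow> \<tau>" using \<tau>(1) by (rule LIMSEQ_Suc)
    show "(\<lambda>n. real (Suc n) / real n) \<longlonglongrightarrow> 1" by real_asymp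
  qed
  then have \<tau>': "(\<lambda>n. T (Suc n) / n) \<longlonglongrightarrow> \<tau>" by simp
  have a: "((\<lambda>t. T (idx t) / idx t) \<longlongrightarrow> \<tau>) at_top" and b: "((\<lambda>t. T (Suc (idx t)) / idx t) \<longlongrightarrow> \<tau>) at_top"
    and c: "((\<lambda>t. ln (norm (Xn (idx t))) / idx t) \<longlongrightarrow> g) at_top"
    using filterlim_compose[OF \<tau>(1) idx_top] filterlim_compose[OF \<tau>' idx_top] filterlim_compose[OF L idx_top] by auto
  have d: "((\<lambda>t. t / idx t) \<longlongrightarrow> \<tau>) at_top"
  proof (rule tendsto_sandwich[OF _ _ a b])
    show "\<forall>\<^sub>F t in at_top. T (idx t) / idx t \<le> t / idx t"
      using eventually_ge_at_top[of 0] by eventually_elim (rule divide_right_mono, use idx_bounds in auto)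
    show "\<forall>\<^sub>F t in at_top. t / idx t \<le> T (Suc (idx t)) / idx t"
      using eventually_ge_at_top[of 0]
      by eventually_elim (rule divide_right_mono, use idx_bounds in \<open>auto intro: less_imp_le\<close>)
  qed
  have z: "((\<lambda>t. (F t - ln (norm (Xn (idx t)))) / idx t) \<longlongrightarrow> 0) at_top"
  proof (rule Lim_null_comparison)
    have "((\<lambda>t. C * (T (Suc (idx t)) / idx t - T (idx t) / idx t)) \<longlongrightarrow> C * (\<tau> - \<tau>)) at_top"
      by (intro tendsto_intros a b)
    then show "((\<lambda>t. C * (T (Suc (idx t)) / idx t - T (idx t) / idx t)) \<longlongrightarrow> 0) at_top" by simp
    show "\<forall>\<^sub>F t in at_top. norm ((F t - ln (norm (Xn (idx t)))) / idx t) \<le> C * (T (Suc (idx t)) / idx t - T (idx t) / idx t)"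
      using eventually_ge_at_top[of 0]
    proof eventually_elim
      case (elim t)
      have "\<bar>F t - ln (norm (Xn (idx t)))\<bar> \<le> C * (T (Suc (idx t)) - T (idx t))"
        unfolding F_def using ln_norm_between_jumps[OF x0] idx_bounds[OF elim] by blast
      then show ?case by (simp add: abs_divide divide_right_mono diff_divide_distrib[symmetric])
    qed
  qed
  have "((\<lambda>t. ((F t - ln (norm (Xn (idx t)))) / idx t + ln (norm (Xn (idx t))) / idx t) / (t / idx t)) \<longlongrightarrow> (0 + g) / \<tau>) at_top"
    by (intro tendsto_intros z c d) (use \<tau> in simp)
  moreover have "\<forall>\<^sub>F t in at_top. ((F t - ln (norm (Xn (idx t)))) / idx t + ln (norm (Xn (idx t))) / idx t) / (t / idx t) = 1 / t * F t"
    using eventually_ge_at_top[of "T 1"]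
  proof eventually_elim
    case (elim t)
    have "idx t \<ge> 1" using idx_ge[OF elim] .
    moreover have "t > 0" using elim T_less[of 0] by simp
    ultimately show ?case by (simp add: add_divide_distrib[symmetric])
  qed
  ultimately have "((\<lambda>t. 1 / t * F t) \<longlongrightarrow> (0 + g) / \<tau>) at_top" by (rule Lim_transform_eventually)
  then show ?thesis by (simp add: F_def)
qed

end

section \<open>Law of large numbers for the jump times and the almost sure growth rate\<close>

context switched
begin

text \<open>Mean time per jump, averaged over the two alternating states; it is half the mean length
  of a cycle.\<close>

definition \<tau> :: real where "\<tau> = (1 / rate 0 + 1 / rate 1) / 2"

lemma tau_pos: "\<tau> > 0"
  using rate_pos[of 0] rate_pos[of 1] by (simp add: \<tau>_def add_pos_pos)

lemma jump_time_law: "AE e in seqm. (\<lambda>n. jump_time lam \<beta> i0 e n / n) \<longlonglongrightarrow> \<tau>"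
proof -
  define F :: "2 \<Rightarrow> real \<Rightarrow> 2" where "F i s = 1 - i" for i s
  \<comment> \<open>An exact bounded corrector for the alternation: the mean holding time in state i
    minus \<tau> equals g i - g (1 - i).\<close>
  define g where "g i = 1 / rate i / 2" for i
  define D where "D i s = \<bar>s\<bar> / rate i - \<tau> + g (1 - i) - g i" for i s
  have r: "0 \<le> 1 / rate i" "1 / rate i \<le> h" for i using rate_pos[of i] rate_le_h[of i] by (auto intro: less_imp_le)
  have g1: "0 \<le> g i" for i using rate_pos[of i] by (simp add: g_def)
  have g2: "g i \<le> h" for i
    using order_trans[OF _ r(2)[of i], of "1 / rate i / 2"] rate_pos[of i] by (simp add: g_def field_simps)
  note g = g1 g2
  have \<tau>h: "\<tau> \<le> h" using r(2)[of 0] r(2)[of 1] by (simp add: \<tau>_def)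
  interpret martingale_increment F "count_space UNIV" D "2 * h"
  proof
    show "(\<lambda>(z, s). F z s) \<in> count_space UNIV \<Otimes>\<^sub>M borel \<rightarrow>\<^sub>M count_space UNIV"
      unfolding F_def by measurable
    show "(\<lambda>(z, s). D z s) \<in> borel_measurable (count_space UNIV \<Otimes>\<^sub>M borel)"
      unfolding D_def by measurable
    show "0 \<le> 2 * h" using h_pos by simp
    show "\<bar>D z s\<bar> \<le> 2 * h * (1 + \<bar>s\<bar>)" for z s
    proof -
      have "\<bar>s\<bar> / rate z \<le> h * \<bar>s\<bar>" using mult_right_mono[OF r(2)[of z], of "\<bar>s\<bar>"] by simp
      moreover have "0 \<le> \<bar>s\<bar> / rate z" using rate_pos[of z] by simp
      moreover have "0 \<le> h * \<bar>s\<bar>" using h_pos by simp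
      ultimately have "\<bar>D z s\<bar> \<le> 2 * h + 2 * (h * \<bar>s\<bar>)"
        unfolding D_def using g[of z] g[of "1 - z"] \<tau>h tau_pos by linarith
      then show ?thesis by (simp add: distrib_left)
    qed
    show "(\<integral>s. D z s \<partial>expm) = 0" for z
      using two_cases[of z] unfolding D_def by (auto simp: g_def \<tau>_def expm.prob_space field_simps)
  qed simp
  have st: "state F n i0 e = jump_chain i0 n" for n e
    by (induction n) (simp_all add: F_def jump_chain_Suc')
  show ?thesis using strong_law[of i0] AE_seqm_pos
  proof eventually_elim
    case (elim e)
    define R where "R n = (\<Sum>k<n. D (state F k i0 e) (e k))" for n
    have R: "R n = jump_time lam \<beta> i0 e n - n * \<tau> + g (jump_chain i0 n) - g i0" for n
    proof (induction n)
      case (Suc n)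
      have "\<bar>e n\<bar> = e n" using elim(2) by (simp add: less_imp_le)
      then show ?case using Suc by (simp add: R_def st D_def jump_time_def rate_def jump_chain_Suc' algebra_simps)
    qed (simp add: R_def jump_time_def)
    have "(\<lambda>n. (g i0 - g (jump_chain i0 n)) / n) \<longlonglongrightarrow> 0"
    proof (rule Lim_null_comparison[OF always_eventually lim_const_over_n[of h]], intro allI)
      fix n
      have "\<bar>g i0 - g (jump_chain i0 n)\<bar> \<le> h" using g[of i0] g[of "jump_chain i0 n"] by linarith
      then show "norm ((g i0 - g (jump_chain i0 n)) / real n) \<le> h / real n" by (simp add: abs_divide divide_right_mono)
    qed
    from tendsto_add[OF tendsto_add[OF elim(1)[folded R_def] this] tendsto_const[of \<tau>]]
    have lim: "(\<lambda>n. R n / n + (g i0 - g (jump_chain i0 n)) / n + \<tau>) \<longlonglongrightarrow> \<tau>" by simp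
    have "\<forall>\<^sub>F n in sequentially. R n / n + (g i0 - g (jump_chain i0 n)) / n + \<tau> = jump_time lam \<beta> i0 e n / n"
      using eventually_gt_at_top[of 0] by eventually_elim (simp add: R field_simps)
    with lim show ?case by (rule Lim_transform_eventually)
  qed
qed

end

text \<open>Convergence is written with countable quantifiers only. It is needed to lift almost sure
  statements for each fixed initial value to the product space.\<close>

lemma pred_LIMSEQ:
  fixes f :: "nat \<Rightarrow> 'a \<Rightarrow> real"
  assumes [measurable]: "\<And>n. f n \<in> borel_measurable M"
  shows "Measurable.pred M (\<lambda>x. (\<lambda>n. f n x) \<longlonglongrightarrow> c)"
proof -
  have "(\<lambda>n. f n x) \<longlonglongrightarrow> c \<longleftrightarrow> (\<forall>j. \<exists>N. \<forall>n\<ge>N. \<bar>f n x - c\<bar> < inverse (real (Suc j)))" for x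
  proof
    assume "(\<lambda>n. f n x) \<longlonglongrightarrow> c"
    then have "\<forall>r>0. \<exists>N. \<forall>n\<ge>N. \<bar>f n x - c\<bar> < r" by (simp add: LIMSEQ_iff)
    then show "\<forall>j. \<exists>N. \<forall>n\<ge>N. \<bar>f n x - c\<bar> < inverse (real (Suc j))" by simp
  next
    assume a: "\<forall>j. \<exists>N. \<forall>n\<ge>N. \<bar>f n x - c\<bar> < inverse (real (Suc j))"
    show "(\<lambda>n. f n x) \<longlonglongrightarrow> c"
    proof (rule LIMSEQ_I)
      fix r :: real assume "r > 0"
      then obtain j where "inverse (real (Suc j)) < r" using reals_Archimedean by blast
      then show "\<exists>N. \<forall>n\<ge>N. norm (f n x - c) < r" using a[rule_format, of j] by (auto intro: less_trans)
    qed
  qed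
  then show ?thesis by (simp add: pred_def)
qed

lemma switched_space_eq: "switched_space \<nu> = \<nu> \<Otimes>\<^sub>M seqm"
  by (simp add: switched_space_def seqm_def expm_def)

theorem (in switched_irreducible) almost_sure_growth:
  assumes "initial_law \<nu>"
  shows "AE \<omega> in switched_space \<nu>.
    ((\<lambda>t. 1 / t * ln (norm (switched_X A lam \<beta> t \<omega>))) \<longlongrightarrow> \<gamma> / \<tau>) at_top"
proof -
  interpret nu: prob_space \<nu> using assms by (simp add: initial_law_def)
  interpret nus: pair_prob_space \<nu> seqm by unfold_locales
  have sets_nu [measurable_cong]: "sets \<nu> = sets Z" using assms by (simp add: initial_law_def)
  have sets_pair: "sets (\<nu> \<Otimes>\<^sub>M seqm) = sets (Z \<Otimes>\<^sub>M seqm)" by (rule sets_pair_measure_cong[OF sets_nu refl])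
  define E where "E \<omega> \<longleftrightarrow> fst (fst \<omega>) \<noteq> 0 \<and> (\<lambda>n. ln (norm (X n (fst \<omega>) (snd \<omega>))) / n) \<longlonglongrightarrow> \<gamma> \<and>
      (\<lambda>n. jump_time lam \<beta> (snd (fst \<omega>)) (snd \<omega>) n / n) \<longlonglongrightarrow> \<tau> \<and> (\<forall>k. snd \<omega> k > 0)" for \<omega> :: sample
  have [measurable]: "(\<lambda>p. X n (fst p) (snd p)) \<in> borel_measurable (Z \<Otimes>\<^sub>M seqm)" for n
    using X_measurable_pair by (simp add: case_prod_beta')
  have [measurable]: "(\<lambda>p::sample. snd p k) \<in> borel_measurable (Z \<Otimes>\<^sub>M seqm)" for k
    using measurable_compose[OF measurable_snd measurable_component_seqm, of k]
    by (simp add: measurable_cong_sets[OF refl sets_expm])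
  have [measurable]: "(\<lambda>p::sample. switch_weight lam (jump_chain (snd (fst p)) k)) \<in> borel_measurable (Z \<Otimes>\<^sub>M seqm)" for k
    by (rule measurable_compose[of "\<lambda>p. snd (fst p)" _ "count_space UNIV"]) measurable
  have [measurable]: "Measurable.pred (Z \<Otimes>\<^sub>M seqm) (\<lambda>\<omega>. (\<lambda>n. ln (norm (X n (fst \<omega>) (snd \<omega>))) / n) \<longlonglongrightarrow> \<gamma>)"
    by (rule pred_LIMSEQ) measurable
  have [measurable]: "Measurable.pred (Z \<Otimes>\<^sub>M seqm) (\<lambda>\<omega>. (\<lambda>n. jump_time lam \<beta> (snd (fst \<omega>)) (snd \<omega>) n / n) \<longlonglongrightarrow> \<tau>)"
    unfolding jump_time_def by (rule pred_LIMSEQ) measurable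
  have E_pred: "Measurable.pred (Z \<Otimes>\<^sub>M seqm) E"
    unfolding E_def by measurable
  have "AE z in \<nu>. AE e in seqm. E (z, e)"
  proof -
    have "{0} \<times> UNIV \<in> null_sets \<nu>"
      using assms by (auto simp: initial_law_def null_sets_def)
    then have "AE z in \<nu>. z \<notin> {0} \<times> UNIV" by (rule AE_not_in)
    then show ?thesis
    proof eventually_elim
      case (elim z)
      then have z: "fst z \<noteq> 0" by (cases z) auto
      show ?case using lyapunov_limit[OF z] jump_time_law[of "snd z"] AE_seqm_pos
        by eventually_elim (simp add: E_def z)
    qed
  qed
  then have "AE \<omega> in \<nu> \<Otimes>\<^sub>M seqm. E \<omega>"
  proof (rule nus.AE_pair_measure[rotated])
    have "{\<omega> \<in> space (Z \<Otimes>\<^sub>M seqm). E \<omega>} \<in> sets (Z \<Otimes>\<^sub>M seqm)" using E_pred by (simp add: pred_def)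
    then show "{\<omega> \<in> space (\<nu> \<Otimes>\<^sub>M seqm). E \<omega>} \<in> sets (\<nu> \<Otimes>\<^sub>M seqm)"
      using sets_eq_imp_space_eq[OF sets_pair] sets_pair by simp
  qed
  then show ?thesis unfolding switched_space_eq
  proof eventually_elim
    case (elim \<omega>)
    obtain x0 i0 e where \<omega>: "\<omega> = ((x0, i0), e)" by (metis prod.collapse)
    have E: "x0 \<noteq> 0" "(\<lambda>n. ln (norm (X n (x0, i0) e)) / n) \<longlonglongrightarrow> \<gamma>"
      "(\<lambda>n. jump_time lam \<beta> i0 e n / n) \<longlonglongrightarrow> \<tau>" "\<And>k. e k > 0"
      using elim by (auto simp: E_def \<omega>)
    have unb: "\<exists>n. t < jump_time lam \<beta> i0 e n" for t
    proof -
      have "filterlim (\<lambda>n. jump_time lam \<beta> i0 e n / n * real n) at_top sequentially"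
        by (rule filterlim_tendsto_pos_mult_at_top[OF E(3) tau_pos filterlim_real_sequentially])
      then have "\<forall>\<^sub>F n in sequentially. t + 1 \<le> jump_time lam \<beta> i0 e n / n * real n" by (simp add: filterlim_at_top)
      then have "\<forall>\<^sub>F n in sequentially. t < jump_time lam \<beta> i0 e n"
        using eventually_gt_at_top[of 0] by eventually_elim simp
      then show ?thesis by (auto simp: eventually_sequentially)
    qed
    interpret switched_sample A lam \<beta> C x0 i0 e by unfold_locales (use E unb in auto)
    show ?case unfolding \<omega> by (rule continuous_time_limit) (use E tau_pos in \<open>auto simp: Xn_def\<close>)
  qed
qed

section \<open>Choice of the constants and conclusion\<close>

lemma real_eigenvector:
  fixes A :: "real^2^2"
  assumes "c\<^sup>2 - trace A * c + det A = 0"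
  obtains v where "v \<noteq> 0" "A *v v = c *\<^sub>R v"
  using assms eigenvector_iff_char_poly[of A c] by (auto simp: scalar_mult_eq_scaleR)

text \<open>Cramer's rule recovers \<open>w\<close> from its two pairings up to the factor d, and
  the Cauchy-Schwarz inequality in the plane bounds each coordinate.\<close>

lemma independent_pair_norm:
  fixes r s :: "real^2"
  assumes "r$1 * s$2 - r$2 * s$1 \<noteq> 0"
  shows "\<exists>M. \<forall>w. (norm w)\<^sup>2 \<le> M * ((inner w r)\<^sup>2 + (inner w s)\<^sup>2)"
proof -
  define d where "d = r$1 * s$2 - r$2 * s$1"
  define N where "N = (norm r)\<^sup>2 + (norm s)\<^sup>2"
  have d: "d\<^sup>2 > 0" using assms by (simp add: d_def)
  have sq: "(x * b - y * a)\<^sup>2 \<le> (x\<^sup>2 + y\<^sup>2) * (a\<^sup>2 + b\<^sup>2)" for x y a b :: real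
  proof -
    have "(x\<^sup>2 + y\<^sup>2) * (a\<^sup>2 + b\<^sup>2) = (x * b - y * a)\<^sup>2 + (x * a + y * b)\<^sup>2"
      by (simp add: power2_eq_square algebra_simps)
    then show ?thesis by simp
  qed
  have "(norm w)\<^sup>2 \<le> (N / d\<^sup>2) * ((inner w r)\<^sup>2 + (inner w s)\<^sup>2)" for w
  proof -
    let ?a = "inner w r" and ?b = "inner w s"
    have 1: "w$1 * d = ?a * s$2 - ?b * r$2" and 2: "w$2 * d = ?b * r$1 - ?a * s$1"
      by (simp_all add: inner_vec2 d_def algebra_simps)
    have nn: "(norm x)\<^sup>2 = (x$1)\<^sup>2 + (x$2)\<^sup>2" for x :: "real^2"
      unfolding power2_norm_eq_inner inner_vec2 by (simp add: power2_eq_square)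
    have "(norm w)\<^sup>2 * d\<^sup>2 = (w$1 * d)\<^sup>2 + (w$2 * d)\<^sup>2" by (simp add: nn power_mult_distrib distrib_right)
    also have "\<dots> \<le> (?a\<^sup>2 + ?b\<^sup>2) * ((r$2)\<^sup>2 + (s$2)\<^sup>2) + (?b\<^sup>2 + ?a\<^sup>2) * ((s$1)\<^sup>2 + (r$1)\<^sup>2)"
      unfolding 1 2 by (intro add_mono sq)
    also have "\<dots> = N * (?a\<^sup>2 + ?b\<^sup>2)" by (simp add: N_def nn algebra_simps)
    finally show ?thesis using d by (simp add: field_simps)
  qed
  then show ?thesis by blast
qed

text \<open>The order of quantifiers is the point: all constants come from the two matrices and
  \<lambda>, before \<beta> is chosen.\<close>

lemma saddle_ex:
  fixes A :: "2 \<Rightarrow> real^2^2"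
  assumes hur: "hurwitz (A 0)" "hurwitz (A 1)" and lam: "0 < lam" "lam < 1"
    and pm: "0 < lamm" "0 < lamp"
    and ev: "is_eigenvalue ((1 - lam) *\<^sub>R A 0 + lam *\<^sub>R A 1) (complex_of_real (- lamm))"
      "is_eigenvalue ((1 - lam) *\<^sub>R A 0 + lam *\<^sub>R A 1) (complex_of_real lamp)"
  shows "\<exists>C lp rp rm K M a. a > 0 \<and> K \<ge> 1 \<and>
    (\<forall>i s x. s \<ge> 0 \<longrightarrow> norm (flow (A i) s *v x) \<le> K * exp (- a * s) * norm x) \<and>
    (\<forall>\<beta>>0. saddle A lam \<beta> C lp rp rm K lamp lamm M)"
proof -
  define Al where "Al = (1 - lam) *\<^sub>R A 0 + lam *\<^sub>R A 1"
  obtain C0 C1 where C: "C0 > 0" "\<And>x. norm (A 0 *v x) \<le> C0 * norm x" "C1 > 0" "\<And>x. norm (A 1 *v x) \<le> C1 * norm x"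
    using matrix_bound_ex[of "A 0"] matrix_bound_ex[of "A 1"] by blast
  define C where "C = max C0 C1"
  have Cb: "norm (A i *v x) \<le> C * norm x" for i x
  proof -
    have "C0 * norm x \<le> C * norm x" "C1 * norm x \<le> C * norm x" by (intro mult_right_mono; simp add: C_def)+
    then show ?thesis using two_cases[of i] C(2,4)[of x] by (auto intro: order_trans)
  qed
  have C_pos: "C > 0" using C by (simp add: C_def)
  obtain K0 a0 K1 a1 where K0: "K0 \<ge> 1" "a0 > 0" "\<And>s x. s \<ge> 0 \<Longrightarrow> norm (flow (A 0) s *v x) \<le> K0 * exp (- a0 * s) * norm x"
    and K1: "K1 \<ge> 1" "a1 > 0" "\<And>s x. s \<ge> 0 \<Longrightarrow> norm (flow (A 1) s *v x) \<le> K1 * exp (- a1 * s) * norm x"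
    using hurwitz_flow_decay[OF hur(1)] hurwitz_flow_decay[OF hur(2)] by blast
  define K where "K = max K0 K1"
  define a where "a = min a0 a1"
  have K: "K \<ge> 1" and a: "a > 0" using K0 K1 by (auto simp: K_def a_def)
  have decay: "norm (flow (A i) s *v x) \<le> K * exp (- a * s) * norm x" if s: "s \<ge> 0" for i s x
  proof -
    have "K0 * exp (- a0 * s) * norm x \<le> K * exp (- a * s) * norm x"
      using K0 K1 s by (intro mult_right_mono mult_mono) (auto simp: K_def a_def mult_right_mono)
    moreover have "K1 * exp (- a1 * s) * norm x \<le> K * exp (- a * s) * norm x"
      using K0 K1 s by (intro mult_right_mono mult_mono) (auto simp: K_def a_def mult_right_mono)
    ultimately show ?thesis using two_cases[of i] K0(3)[OF s, of x] K1(3)[OF s, of x] by (auto intro: order_trans)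
  qed
  have flow_K: "norm (flow (A i) s *v x) \<le> K * norm x" if s: "s \<ge> 0" for i s x
  proof -
    have "K * exp (- a * s) * norm x \<le> K * 1 * norm x"
      using K a s by (intro mult_right_mono mult_left_mono) auto
    then show ?thesis using decay[OF s, of i x] by simp
  qed
  have cp: "(- lamm)\<^sup>2 - trace Al * (- lamm) + det Al = 0" "lamp\<^sup>2 - trace Al * lamp + det Al = 0"
    using ev unfolding Al_def[symmetric] by (auto dest!: real_eigenvalue_char_poly simp del: of_real_minus)
  have det_neg: "det Al < 0"
    using opposite_eigenvalues_trace_det(2)[OF pm ev] pm unfolding Al_def[symmetric] by simp
  obtain rp where rp: "rp \<noteq> 0" "Al *v rp = lamp *\<^sub>R rp" by (rule real_eigenvector[OF cp(2)])
  obtain rm where rm: "rm \<noteq> 0" "Al *v rm = (- lamm) *\<^sub>R rm" by (rule real_eigenvector[OF cp(1)])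
  have "lamp\<^sup>2 - trace (transpose Al) * lamp + det (transpose Al) = 0"
    using cp(2) by (simp add: trace_2 transpose_def det_2 mult.commute)
  then obtain lp where lp: "lp \<noteq> 0" "transpose Al *v lp = lamp *\<^sub>R lp" by (rule real_eigenvector)
  have left: "inner lp (Al *v y) = lamp * inner lp y" for y
  proof -
    have "inner lp (Al *v y) = inner (transpose Al *v lp) y"
      by (simp add: inner_vec2 matrix_vector_2 transpose_def algebra_simps del: transpose_matrix_vector)
    then show ?thesis by (simp only: lp(2) inner_scaleR_left)
  qed
  have indep: "rp$1 * rm$2 - rp$2 * rm$1 \<noteq> 0"
  proof
    assume d: "rp$1 * rm$2 - rp$2 * rm$1 = 0"
    let ?w = "vector [- (rp$2), rp$1] :: real^2"
    have "?w \<noteq> 0" using rp(1) by (auto simp: vec2_eq_iff)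
    moreover have "inner ?w rp = 0" "inner ?w rm = 0" using d by (simp_all add: inner_vec2)
    ultimately obtain c where c: "rm = c *\<^sub>R rp" using parallel_2 rp(1) by blast
    have "Al *v rm = lamp *\<^sub>R rm" unfolding c by (simp add: matrix_vector_mult_scaleR rp(2))
    then have "lamp *\<^sub>R rm = (- lamm) *\<^sub>R rm" using rm(2) by simp
    then have "(lamp - (- lamm)) *\<^sub>R rm = 0" unfolding scaleR_diff_left by simp
    then show False using rm(1) pm by simp
  qed
  obtain M0 where M0: "\<And>w. (norm w)\<^sup>2 \<le> M0 * ((inner w rp)\<^sup>2 + (inner w rm)\<^sup>2)"
    using independent_pair_norm[OF indep] by blast
  define M where "M = 1 + \<bar>M0\<bar> + norm lp + norm rp + norm rm + lamp + K * K * C + K * K * C\<^sup>2"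
  have pos: "K * K * C \<ge> 0" "K * K * C\<^sup>2 \<ge> 0" using K C_pos by auto
  have M: "M \<ge> 1" "norm lp \<le> M" "norm rp \<le> M" "norm rm \<le> M" "lamp \<le> M" "K * K * C \<le> M" "K * K * C\<^sup>2 \<le> M" "M0 \<le> M"
    using pos pm norm_ge_zero[of lp] norm_ge_zero[of rp] norm_ge_zero[of rm] unfolding M_def by linarith+
  have dual: "(norm w)\<^sup>2 \<le> M * ((inner w rp)\<^sup>2 + (inner w rm)\<^sup>2)" for w
    by (rule order_trans[OF M0 mult_right_mono[OF M(8)]]) simp
  have nc: False if "x \<noteq> 0" "A 0 *v x = c *\<^sub>R x" "A 1 *v x = d *\<^sub>R x" for x c d
    using no_common_eigenvector[OF hur lam that(1) _ that(2,3)] det_neg by (simp add: Al_def)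
  have "saddle A lam \<beta> C lp rp rm K lamp lamm M" if "\<beta> > 0" for \<beta>
    by unfold_locales (fact lam that C_pos Cb flow_K left[unfolded Al_def] rp(2)[unfolded Al_def] rm(2)[unfolded Al_def]
        pm lp(1) dual M nc)+
  then show ?thesis using a K decay by blast
qed

lemma norm_limit_of_exponent:
  fixes f :: "real \<Rightarrow> 'a::real_normed_vector"
  assumes "((\<lambda>t. 1 / t * ln (norm (f t))) \<longlongrightarrow> c) at_top"
  shows "c < 0 \<Longrightarrow> ((\<lambda>t. norm (f t)) \<longlongrightarrow> 0) at_top"
    and "c > 0 \<Longrightarrow> filterlim (\<lambda>t. norm (f t)) at_top at_top"
proof -
  assume c: "c < 0"
  have "\<forall>\<^sub>F t in at_top. 1 / t * ln (norm (f t)) < c / 2" using c by (intro order_tendstoD(2)[OF assms]) auto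
  then have le: "\<forall>\<^sub>F t in at_top. norm (norm (f t)) \<le> exp (c / 2 * t)"
    using eventually_gt_at_top[of 0]
  proof eventually_elim
    case (elim t)
    then have l: "ln (norm (f t)) \<le> c / 2 * t" by (simp add: field_simps)
    show ?case
    \<comment> \<open>The logarithm of 0 is 0 by convention, so the exponential of the logarithm
      recovers the norm only when it is nonzero.\<close>
    proof (cases "norm (f t) = 0")
      case False
      then have "norm (f t) = exp (ln (norm (f t)))" by simp
      also have "\<dots> \<le> exp (c / 2 * t)" using l by (simp only: exp_le_cancel_iff)
      finally show ?thesis by simp
    qed simp
  qed
  have "((\<lambda>t. exp (c / 2 * t)) \<longlongrightarrow> 0) at_top" using c by real_asymp
  then show "((\<lambda>t. norm (f t)) \<longlongrightarrow> 0) at_top" by (rule Lim_null_comparison[OF le])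
next
  assume c: "c > 0"
  have "\<forall>\<^sub>F t in at_top. c / 2 < 1 / t * ln (norm (f t))" using c by (intro order_tendstoD(1)[OF assms]) auto
  then have le: "\<forall>\<^sub>F t in at_top. exp (c / 2 * t) \<le> norm (f t)"
    using eventually_gt_at_top[of 0]
  proof eventually_elim
    case (elim t)
    then have l: "c / 2 * t < ln (norm (f t))" by (simp add: field_simps)
    then have "norm (f t) \<noteq> 0" using mult_pos_pos[of "c / 2" t] c elim by auto
    then have e: "exp (ln (norm (f t))) = norm (f t)" by simp
    have "exp (c / 2 * t) \<le> exp (ln (norm (f t)))" using l by (simp only: exp_le_cancel_iff less_imp_le)
    then show ?case unfolding e .
  qed
  have "filterlim (\<lambda>t. exp (c / 2 * t)) at_top at_top" using c by real_asymp
  then show "filterlim (\<lambda>t. norm (f t)) at_top at_top" by (rule filterlim_at_top_mono[OF _ le])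
qed

theorem theorem1p6:
  fixes A :: "2 \<Rightarrow> real ^ 2 ^ 2" and lam lam_minus lam_plus :: real
  assumes "hurwitz (A 0)" and "hurwitz (A 1)"
    and "0 < lam" and "lam < 1"
    and "0 < lam_minus" and "0 < lam_plus"
    and "is_eigenvalue ((1 - lam) *\<^sub>R A 0 + lam *\<^sub>R A 1) (complex_of_real (- lam_minus))"
    and "is_eigenvalue ((1 - lam) *\<^sub>R A 0 + lam *\<^sub>R A 1) (complex_of_real lam_plus)"
  shows "\<exists>chi :: real \<Rightarrow> real.
    (\<forall>\<beta>>0. \<forall>\<nu>. initial_law \<nu> \<longrightarrow>
       (AE \<omega> in switched_space \<nu>.
          ((\<lambda>t. 1 / t * ln (norm (switched_X A lam \<beta> t \<omega>))) \<longlongrightarrow> chi \<beta>) at_top)) \<and>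
    (\<exists>\<beta>1 \<beta>2. 0 < \<beta>1 \<and> \<beta>1 \<le> \<beta>2 \<and>
       (\<forall>\<beta>. 0 < \<beta> \<and> \<beta> < \<beta>1 \<longrightarrow> chi \<beta> < 0 \<and>
          (\<forall>\<nu>. initial_law \<nu> \<longrightarrow>
             (AE \<omega> in switched_space \<nu>. ((\<lambda>t. norm (switched_X A lam \<beta> t \<omega>)) \<longlongrightarrow> 0) at_top))) \<and>
       (\<forall>\<beta>. \<beta>2 < \<beta> \<longrightarrow> chi \<beta> > 0 \<and>
          (\<forall>\<nu>. initial_law \<nu> \<longrightarrow>
             (AE \<omega> in switched_space \<nu>.
                filterlim (\<lambda>t. norm (switched_X A lam \<beta> t \<omega>)) at_top at_top))))"
proof -
  obtain C lp rp rm K M a where a: "a > 0" and K: "K \<ge> 1"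
    and decay: "\<And>i s x. s \<ge> 0 \<Longrightarrow> norm (flow (A i) s *v x) \<le> K * exp (- a * s) * norm x"
    and sad: "\<And>\<beta>. \<beta> > 0 \<Longrightarrow> saddle A lam \<beta> C lp rp rm K lam_plus lam_minus M"
    using saddle_ex[OF assms] by blast
  \<comment> \<open>Rate per jump divided by mean time per jump; the sign is that of the rate per
    jump.\<close>
  define chi where "chi \<beta> = switched.\<gamma> A lam \<beta> / switched.\<tau> lam \<beta>" for \<beta>
  have lim: "AE \<omega> in switched_space \<nu>. ((\<lambda>t. 1 / t * ln (norm (switched_X A lam \<beta> t \<omega>))) \<longlongrightarrow> chi \<beta>) at_top"
    if "\<beta> > 0" "initial_law \<nu>" for \<beta> \<nu>
  proof -
    interpret saddle A lam \<beta> C lp rp rm K lam_plus lam_minus M by (rule sad[OF that(1)])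
    show ?thesis unfolding chi_def by (rule almost_sure_growth[OF that(2)])
  qed
  have tau: "switched.\<tau> lam \<beta> > 0" if "\<beta> > 0" for \<beta>
  proof -
    interpret saddle A lam \<beta> C lp rp rm K lam_plus lam_minus M by (rule sad[OF that])
    show ?thesis by (rule tau_pos)
  qed
  obtain \<beta>2 where \<beta>2: "\<beta>2 > 0" "\<And>\<beta>. \<beta> > \<beta>2 \<Longrightarrow> switched.\<gamma> A lam \<beta> > 0"
    using gamma_fast_switching[OF sad] by blast
  \<comment> \<open>For \<beta> < b one has ln K + 1 < a/\<beta>, so the slow-switching bound puts
    the rate per jump below -1.\<close>
  define b where "b = a / (ln K + 1)"
  have lnK: "ln K \<ge> 0" using K by simp
  have b: "b > 0" using a lnK by (simp add: b_def)
  have neg: "chi \<beta> < 0" if "0 < \<beta>" "\<beta> < b" for \<beta>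
  proof -
    interpret saddle A lam \<beta> C lp rp rm K lam_plus lam_minus M by (rule sad[OF that(1)])
    have "\<beta> * (ln K + 1) < a" using that(2) lnK by (simp add: b_def pos_less_divide_eq)
    then have "ln K + 1 < a / \<beta>" using that(1) by (simp add: pos_less_divide_eq mult.commute)
    then have "\<gamma> < 0" using gamma_slow_switching[OF K a decay] by simp
    then show ?thesis using tau[OF that(1)] by (simp add: chi_def divide_neg_pos)
  qed
  have pos: "chi \<beta> > 0" if "\<beta> > \<beta>2" for \<beta>
    using \<beta>2 that tau[of \<beta>] by (simp add: chi_def)
  have to_0: "AE \<omega> in switched_space \<nu>. ((\<lambda>t. norm (switched_X A lam \<beta> t \<omega>)) \<longlongrightarrow> 0) at_top"
    if "0 < \<beta>" "\<beta> < b" "initial_law \<nu>" for \<beta> \<nu>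
    using lim[OF that(1,3)] by eventually_elim (rule norm_limit_of_exponent(1)[OF _ neg[OF that(1,2)]])
  have to_infty: "AE \<omega> in switched_space \<nu>. filterlim (\<lambda>t. norm (switched_X A lam \<beta> t \<omega>)) at_top at_top"
    if "\<beta>2 < \<beta>" "initial_law \<nu>" for \<beta> \<nu>
  proof -
    have "\<beta> > 0" using that \<beta>2(1) by simp
    from lim[OF this that(2)] show ?thesis
      by eventually_elim (rule norm_limit_of_exponent(2)[OF _ pos[OF that(1)]])
  qed
  \<comment> \<open>Taking the minimum as first threshold gives the required order of the two
    thresholds and keeps it below b.\<close>
  have bounds: "0 < min b \<beta>2" "min b \<beta>2 \<le> \<beta>2" using b \<beta>2 by auto
  show ?thesis
    by (rule exI[of _ chi], rule conjI, use lim in blast, rule exI[of _ "min b \<beta>2"], rule exI[of _ \<beta>2])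
       (use neg pos to_0 to_infty bounds in simp)
qed

end
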